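(* Let $s\ge 1$ and $k\ge 0$ be integers and consider the sequence of active random intersection graphs $G_s(n,m,P)$, $n=1,2,\dots$, with $m=m_n$, $P=P_n$. Let $m,n\to\infty$. Assume that $Z_1=\binom{m}{s}^{-1/2}n^{1/2}\binom{X_1}{s}$ converges in distribution to a random variable $Z$, that $0<\mathbf{E}Z^2<\infty$ and $\lim_{n\to\infty}\mathbf{E}Z_1^2=\mathbf{E}Z^2$, and that $\binom{m}{s}n^{-1}\to\beta$ for some $\beta\in(0,+\infty)$. Then $$b=1+\beta^{-1}a_2+o(1),\qquad h=\beta^{-1}a_1+o(1),$$ and $$h_{k+1}=\frac{a_1}{\beta}\,\frac{k}{k+1}\,\frac{p_k}{p_{k+1}}+o(1),$$ $$b_{k+1}=1+\beta^{-1}(a_2-a_1)+h_{k+1}+o(1).$$ Here $a_1=(\beta\delta_1)^{1/2}+o(1)$ and $a_2=\beta\overline{\delta}_2/\delta_1+o(1)$.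
   Context: Active random intersection graph $G_s(n,m,P)$: let $W=\{w_1,\dots,w_m\}$ and let $P$ be a probability distribution on $\{0,1,\dots,m\}$. Let $D_1,\dots,D_n$ be independent identically distributed random subsets of $W$ with $\mathbf{P}(D_i=A)=\binom{m}{|A|}^{-1}P(|A|)$ for each $A\subset W$. Put $X_i=|D_i|$ (so $X_1,\dots,X_n$ are i.i.d. with distribution $P$). The vertex set is $\{v_1,\dots,v_n\}$, and distinct $v_i,v_j$ are adjacent, $v_i\sim v_j$, iff $|D_i\cap D_j|\ge s$. The integer $s$ is fixed while $m=m_n$ and $P=P_n$ depend on $n$. Let $d(v)$ denote the degree of $v$ and $d(v_i,v_j)$ the number of common neighbours of $v_i$ and $v_j$. Let $(v_1^*,v_2^* )$ be an ordered pair of distinct vertices drawn uniformly at random, independently of the random graph. Let $\mathbf{E}^*$ denote conditional expectation given $v_1^*\sim v_2^*$, and $\mathbf{E}^{*k}$ conditional expectation given $v_1^*\sim v_2^*$ and $d(v_2^* )=k$ (with respect to both the random graph and the random pair). Then $$b=\mathbf{E}^*d(v_1^* ),\quad h=\mathbf{E}^*d(v_1^*,v_2^* ),\quad b_k=\mathbf{E}^{*k}d(v_1^* ),\quad h_k=\mathbf{E}^{*k}d(v_1^*,v_2^* ).$$ Notation: $a_i=\mathbf{E}\binom{X_1}{s}^i$ (depends on $n$). Let $z_1=\mathbf{E}Z$ and let $d_*$ be a random variable with $\mathbf{P}(d_*=k)=p_k=(k!)^{-1}\mathbf{E}\left((z_1Z)^ke^{-z_1Z}\right)$, $k=0,1,\dots$.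 Then $\delta_i=\mathbf{E}d_*^i$ and $\overline{\delta}_i=\mathbf{E}(d_* )_i$, where $(x)_i=x(x-1)\cdots(x-i+1)$. The symbol $o(1)$ refers to $n\to\infty$ with $s,k$ fixed. *)

theory Defs
  imports "HOL-Probability.Probability" "HOL-Library.Landau_Symbols"
begin

definition attr_set_pmf :: "nat \<Rightarrow> nat pmf \<Rightarrow> nat set pmf" where
  "attr_set_pmf m P = bind_pmf P (\<lambda>x. pmf_of_set {A. A \<subseteq> {1..m} \<and> card A = x})"

lemma pmf_attr_set_pmf:
  assumes P: "set_pmf P \<subseteq> {0..m}" and A: "A \<subseteq> {1..m}"
  shows "pmf (attr_set_pmf m P) A = pmf P (card A) / real (m choose card A)"
proof -
  let ?S = "\<lambda>x. {B. B \<subseteq> {1..m} \<and> card B = x}"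
  have fin: "finite (?S x)" for x
    by (rule finite_subset[of _ "Pow {1..m}"]) auto
  have card_S: "card (?S x) = m choose x" for x
    using n_subsets[of "{1..m}" x] by simp
  have ne: "?S x \<noteq> {}" if "x \<le> m" for x
    using card_S[of x] that by (metis binomial_eq_0_iff card.empty not_less)
  have "pmf (attr_set_pmf m P) A = measure_pmf.expectation P (\<lambda>x. pmf (pmf_of_set (?S x)) A)"
    by (simp add: attr_set_pmf_def pmf_bind)
  also have "\<dots> = measure_pmf.expectation P
      (\<lambda>x. indicator {card A} x * (1 / real (m choose card A)))"
  proof (rule integral_cong_AE)
    show "AE x in P. pmf (pmf_of_set (?S x)) A =
        indicator {card A} x * (1 / real (m choose card A))"
      unfolding AE_measure_pmf_iff
    proof
      fix x assume "x \<in> set_pmf P"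
      then have "x \<le> m" using P by auto
      then show "pmf (pmf_of_set (?S x)) A = indicator {card A} x * (1 / real (m choose card A))"
        using A by (simp add: pmf_of_set[OF ne[OF \<open>x \<le> m\<close>] fin] card_S del: One_nat_def
          split: split_indicator)
    qed
  qed simp_all
  also have "\<dots> = pmf P (card A) / real (m choose card A)"
    by (simp add: measure_pmf_single)
  finally show ?thesis .
qed

definition adj :: "nat \<Rightarrow> (nat \<Rightarrow> nat set) \<Rightarrow> nat \<Rightarrow> nat \<Rightarrow> bool" where
  "adj s D i j \<longleftrightarrow> i \<noteq> j \<and> s \<le> card (D i \<inter> D j)"

definition deg :: "nat \<Rightarrow> nat \<Rightarrow> (nat \<Rightarrow> nat set) \<Rightarrow> nat \<Rightarrow> nat" where
  "deg s n D i = card {j \<in> {1..n}. adj s D i j}"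

definition codeg :: "nat \<Rightarrow> nat \<Rightarrow> (nat \<Rightarrow> nat set) \<Rightarrow> nat \<Rightarrow> nat \<Rightarrow> nat" where
  "codeg s n D i j = card {l \<in> {1..n}. adj s D i l \<and> adj s D j l}"

text \<open>Sample points are (D, (v1, v2)): the attribute sets of the vertices 1, ..., n and an
  independent uniform ordered pair of distinct vertices. For n < 2 there is no such pair and the
  law is unspecified.\<close>

definition rig_pair_pmf :: "nat \<Rightarrow> nat \<Rightarrow> nat pmf \<Rightarrow> ((nat \<Rightarrow> nat set) \<times> nat \<times> nat) pmf" where
  "rig_pair_pmf n m P =
     pair_pmf (Pi_pmf {1..n} {} (\<lambda>_. attr_set_pmf m P))
              (pmf_of_set {(i, j). i \<in> {1..n} \<and> j \<in> {1..n} \<and> i \<noteq> j})"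

definition adj_event :: "nat \<Rightarrow> ((nat \<Rightarrow> nat set) \<times> nat \<times> nat) set" where
  "adj_event s = {(D, v1, v2). adj s D v1 v2}"

definition adj_deg_event :: "nat \<Rightarrow> nat \<Rightarrow> nat \<Rightarrow> ((nat \<Rightarrow> nat set) \<times> nat \<times> nat) set" where
  "adj_deg_event s n k = {(D, v1, v2). adj s D v1 v2 \<and> deg s n D v2 = k}"

text \<open>Conditional expectations given an event are expectations under the conditional law. The
  conditional law is unspecified when the event has probability zero.\<close>

definition b_star :: "nat \<Rightarrow> nat \<Rightarrow> nat \<Rightarrow> nat pmf \<Rightarrow> real" where
  "b_star s n m P = measure_pmf.expectation (cond_pmf (rig_pair_pmf n m P) (adj_event s))
     (\<lambda>(D, v1, v2). real (deg s n D v1))"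

definition h_star :: "nat \<Rightarrow> nat \<Rightarrow> nat \<Rightarrow> nat pmf \<Rightarrow> real" where
  "h_star s n m P = measure_pmf.expectation (cond_pmf (rig_pair_pmf n m P) (adj_event s))
     (\<lambda>(D, v1, v2). real (codeg s n D v1 v2))"

definition b_star_k :: "nat \<Rightarrow> nat \<Rightarrow> nat \<Rightarrow> nat pmf \<Rightarrow> nat \<Rightarrow> real" where
  "b_star_k s n m P k = measure_pmf.expectation (cond_pmf (rig_pair_pmf n m P) (adj_deg_event s n k))
     (\<lambda>(D, v1, v2). real (deg s n D v1))"

definition h_star_k :: "nat \<Rightarrow> nat \<Rightarrow> nat \<Rightarrow> nat pmf \<Rightarrow> nat \<Rightarrow> real" where
  "h_star_k s n m P k = measure_pmf.expectation (cond_pmf (rig_pair_pmf n m P) (adj_deg_event s n k))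
     (\<lambda>(D, v1, v2). real (codeg s n D v1 v2))"

definition binom_moment :: "nat \<Rightarrow> nat pmf \<Rightarrow> nat \<Rightarrow> real" where
  "binom_moment s P i = measure_pmf.expectation P (\<lambda>x. real (x choose s) ^ i)"

definition Z_scaled :: "nat \<Rightarrow> nat \<Rightarrow> nat \<Rightarrow> nat \<Rightarrow> real" where
  "Z_scaled s n m x = real (m choose s) powr (-1/2) * real n powr (1/2) * real (x choose s)"

definition mixed_poisson_prob :: "'a measure \<Rightarrow> ('a \<Rightarrow> real) \<Rightarrow> nat \<Rightarrow> real" where
  "mixed_poisson_prob M Z k =
     (let z1 = integral\<^sup>L M Z
      in integral\<^sup>L M (\<lambda>\<omega>. (z1 * Z \<omega>) ^ k * exp (- (z1 * Z \<omega>))) / fact k)"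

definition moment :: "nat pmf \<Rightarrow> nat \<Rightarrow> real" where
  "moment p i = measure_pmf.expectation p (\<lambda>x. real x ^ i)"

definition factorial_moment :: "nat pmf \<Rightarrow> nat \<Rightarrow> real" where
  "factorial_moment p i = measure_pmf.expectation p (\<lambda>x. \<Prod>t<i. (real x - real t))"

end

theory Submission
  imports Defs
begin

text \<open>
  Write \<open>Y = (X choose s)\<close> for the number of \<open>s\<close>-subsets of an attribute set of size \<open>X\<close>, and \<open>N = (m
  choose s)\<close>, so that \<open>N \<approx> \<beta> n\<close>. Two attribute sets are linked essentially when they share exactly one
  \<open>s\<close>-subset, which has probability about \<open>Y\<^sub>1 Y\<^sub>2 / N\<close>; larger overlaps cost a further factor of order
  \<open>1/m\<close>. A path \<open>2 \<sim> 1 \<sim> 3\<close> has probability about \<open>Y\<^sub>2 Y\<^sub>1\<^sup>2 Y\<^sub>3 / N\<^sup>2\<close>, since its two edges may use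
  different \<open>s\<close>-subsets of the middle set. In a triangle all three sets contain the same \<open>s\<close>-subset,
  up to negligible events, which gives \<open>Y\<^sub>1 Y\<^sub>2 Y\<^sub>3 / N\<^sup>2\<close>.

  Given the attribute set \<open>A\<close> of \<open>v\<^sub>2\<close>, the other attribute sets are independent, so the vertices not
  yet revealed contribute a binomial number of neighbours of \<open>v\<^sub>2\<close>, with a Poisson limit of parameter
  \<open>Y a\<^sub>1 / \<beta>\<close>. Averaging over \<open>A\<close> replaces this parameter by \<open>\<Lambda> = z\<^sub>1 Z\<close>, because \<open>Y\<close> is asymptotically
  \<open>sqrt \<beta> Z\<close> and \<open>a\<^sub>1\<close> tends to \<open>sqrt \<beta> z\<^sub>1\<close>. Consequently, for a bounded function \<open>g\<close> of the degree of \<open>v\<^sub>2\<close>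
  with Poisson averages \<open>G\<^sub>1\<close> (one neighbour revealed) and \<open>G\<^sub>2\<close> (two neighbours revealed), the weights of
  edges, triangles and open paths at \<open>v\<^sub>2\<close>, scaled by \<open>n\<close>, \<open>n\<^sup>2\<close> and \<open>n\<^sup>2\<close>, converge to
  \<open>E \<Lambda> G\<^sub>1(\<Lambda>)\<close>, \<open>(a\<^sub>1/\<beta>) E \<Lambda> G\<^sub>2(\<Lambda>)\<close> and \<open>((a\<^sub>2 - a\<^sub>1)/\<beta>) E \<Lambda> G\<^sub>1(\<Lambda>)\<close>; this is
  \<open>weight_limits\<close>. The four conditional expectations are quotients of these weights: \<open>g = 1\<close> gives \<open>b\<close>
  and \<open>h\<close>, and the indicator of degree \<open>k + 1\<close> gives \<open>b\<^sub>k\<^sub>+\<^sub>1\<close> and \<open>h\<^sub>k\<^sub>+\<^sub>1\<close>, where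
  \<open>E \<Lambda> Poisson(\<Lambda>; k) = (k + 1) p\<^sub>k\<^sub>+\<^sub>1\<close>.

  The estimates for a known attribute set are first moment bounds from above and Bonferroni bounds
  from below (\<open>link_weighted_upper\<close>, \<open>link_weighted_lower\<close>, \<open>triangle_prob_upper\<close>). The lower bounds
  require sets of bounded size, and only two moments of \<open>Y\<close> are under control. Weak convergence together
  with convergence of the second moment makes \<open>Y\<^sup>2\<close> uniformly integrable, so large sets may be cut off
  at a slowly growing level (\<open>tail_2_limit\<close>), and pointwise limits may be integrated
  (\<open>dominated_limit\<close>, \<open>linear_growth_limit\<close>).
\<close>

section \<open>Expectations of finitely supported distributions\<close>

lemma expectation_bind_finite:
  fixes h :: "'b \<Rightarrow> real"
  assumes "finite (set_pmf p)" "\<And>x. x \<in> set_pmf p \<Longrightarrow> finite (set_pmf (f x))"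
  shows "measure_pmf.expectation (bind_pmf p f) h =
         measure_pmf.expectation p (\<lambda>x. measure_pmf.expectation (f x) h)"
proof -
  have "measure_pmf.expectation (bind_pmf p f) h =
      (\<Sum>a\<in>set_pmf p. pmf p a *\<^sub>R measure_pmf.expectation (f a) h)"
    by (rule pmf_expectation_bind) (use assms in auto)
  also have "\<dots> = measure_pmf.expectation p (\<lambda>x. measure_pmf.expectation (f x) h)"
    by (rule integral_measure_pmf[symmetric]) (use assms in auto)
  finally show ?thesis .
qed

lemma expectation_mono_finite:
  fixes f g :: "'b \<Rightarrow> real"
  assumes "finite (set_pmf p)" "\<And>x. x \<in> set_pmf p \<Longrightarrow> f x \<le> g x"
  shows "measure_pmf.expectation p f \<le> measure_pmf.expectation p g"
  by (rule integral_mono_AE)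
    (use assms in \<open>auto simp: AE_measure_pmf_iff intro: integrable_measure_pmf_finite\<close>)

lemma expectation_cong_pmf:
  fixes f g :: "'b \<Rightarrow> real"
  assumes "\<And>x. x \<in> set_pmf p \<Longrightarrow> f x = g x"
  shows "measure_pmf.expectation p f = measure_pmf.expectation p g"
  by (rule integral_cong_AE) (use assms in \<open>auto simp: AE_measure_pmf_iff\<close>)

text \<open>
  Turns a conditional expectation into a quotient of two unconditional ones. Every limit below is a
  limit of such a quotient, so the conditional laws themselves never have to be studied.
\<close>

lemma expectation_cond_pmf:
  fixes f :: "'b \<Rightarrow> real"
  assumes fin: "finite (set_pmf p)" and ne: "set_pmf p \<inter> S \<noteq> {}"
  shows "measure_pmf.expectation (cond_pmf p S) f =
    measure_pmf.expectation p (\<lambda>x. of_bool (x \<in> S) * f x) /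
    measure_pmf.expectation p (\<lambda>x. of_bool (x \<in> S))"
proof -
  have m: "measure_pmf.prob p S = measure_pmf.expectation p (\<lambda>x. of_bool (x \<in> S))"
  proof -
    have "(\<lambda>x. of_bool (x \<in> S) :: real) = indicator S" by (auto simp: fun_eq_iff)
    then show ?thesis by simp
  qed
  have "measure_pmf.expectation (cond_pmf p S) f =
      (\<Sum>a\<in>set_pmf p. pmf (cond_pmf p S) a *\<^sub>R f a)"
    by (rule integral_measure_pmf) (use fin ne in auto)
  also have "\<dots> = (\<Sum>a\<in>set_pmf p. pmf p a *\<^sub>R (of_bool (a \<in> S) * f a)) / measure_pmf.prob p S"
    unfolding sum_divide_distrib by (rule sum.cong) (simp_all add: pmf_cond[OF ne])
  also have "(\<Sum>a\<in>set_pmf p. pmf p a *\<^sub>R (of_bool (a \<in> S) * f a)) =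
      measure_pmf.expectation p (\<lambda>x. of_bool (x \<in> S) * f x)"
    by (rule integral_measure_pmf[symmetric]) (use fin in auto)
  finally show ?thesis by (simp add: m)
qed

lemma expectation_pos_imp_nonempty:
  assumes "measure_pmf.expectation p (\<lambda>x. of_bool (x \<in> S)) > (0::real)"
  shows "set_pmf p \<inter> S \<noteq> {}"
proof
  assume "set_pmf p \<inter> S = {}"
  then have "measure_pmf.expectation p (\<lambda>x. of_bool (x \<in> S) :: real) =
      measure_pmf.expectation p (\<lambda>x. 0)"
    by (intro expectation_cong_pmf) auto
  with assms show False by simp
qed

section \<open>Random attribute sets\<close>

lemma finite_subsets_of_card: "finite {A. A \<subseteq> {1..m::nat} \<and> card A = x}"
  by (rule finite_subset[of _ "Pow {1..m}"]) auto

lemma subsets_of_card_nonempty: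
  assumes "x \<le> m" shows "{A. A \<subseteq> {1..m::nat} \<and> card A = x} \<noteq> {}"
  using n_subsets[of "{1..m}" x] assms by (metis binomial_eq_0_iff card.empty not_less card_atLeastAtMost diff_Suc_1 finite_atLeastAtMost)

lemma card_supersets_of_card:
  fixes B :: "nat set"
  assumes B: "B \<subseteq> {1..m}" and j: "card B \<le> x"
  shows "card {A. A \<subseteq> {1..m} \<and> card A = x \<and> B \<subseteq> A} = (m - card B) choose (x - card B)"
proof -
  have finB: "finite B" using B finite_subset by blast
  have "bij_betw (\<lambda>A. A - B) {A. A \<subseteq> {1..m} \<and> card A = x \<and> B \<subseteq> A}
      {C. C \<subseteq> {1..m} - B \<and> card C = x - card B}"
  proof (rule bij_betw_byWitness[where f' = "\<lambda>C. C \<union> B"])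
    show "(\<lambda>A. A - B) ` {A. A \<subseteq> {1..m} \<and> card A = x \<and> B \<subseteq> A} \<subseteq>
        {C. C \<subseteq> {1..m} - B \<and> card C = x - card B}"
      using finB by (auto simp: card_Diff_subset)
    show "(\<lambda>C. C \<union> B) ` {C. C \<subseteq> {1..m} - B \<and> card C = x - card B} \<subseteq>
        {A. A \<subseteq> {1..m} \<and> card A = x \<and> B \<subseteq> A}"
    proof safe
      fix C assume C: "C \<subseteq> {1..m} - B" "card C = x - card B"
      have "finite C" using C(1) finite_subset by blast
      then show "card (C \<union> B) = x"
        using C finB j by (subst card_Un_disjoint) auto
    qed (use B in auto)
  qed auto
  then have "card {A. A \<subseteq> {1..m} \<and> card A = x \<and> B \<subseteq> A} =
      card {C. C \<subseteq> {1..m} - B \<and> card C = x - card B}"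
    by (rule bij_betw_same_card)
  also have "\<dots> = card ({1..m} - B) choose (x - card B)"
    by (rule n_subsets) auto
  also have "card ({1..m} - B) = m - card B"
    using B finB by (simp add: card_Diff_subset)
  finally show ?thesis .
qed

text \<open>
  One random attribute set \<open>Q\<close> of a vertex, for fixed \<open>m\<close> and \<open>P\<close>. The support condition makes
  all distributions finitely supported, so that integrability is never an issue.
\<close>

locale random_attr_set =
  fixes s m :: nat and P :: "nat pmf"
  assumes supp: "set_pmf P \<subseteq> {0..m}"
begin

definition Q :: "nat set pmf" where "Q = attr_set_pmf m P"

lemma finite_P: "finite (set_pmf P)" using supp finite_subset by blast

lemma expectation_Q:
  fixes f :: "nat set \<Rightarrow> real"
  shows "measure_pmf.expectation Q f = measure_pmf.expectation P
    (\<lambda>x. measure_pmf.expectation (pmf_of_set {A. A \<subseteq> {1..m} \<and> card A = x}) f)"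
  unfolding Q_def attr_set_pmf_def
proof (rule expectation_bind_finite[OF finite_P])
  fix x assume "x \<in> set_pmf P"
  then have "x \<le> m" using supp by auto
  then show "finite (set_pmf (pmf_of_set {A. A \<subseteq> {1..m} \<and> card A = x}))"
    using subsets_of_card_nonempty[of x m] finite_subsets_of_card[of m x] by simp
qed

lemma set_Q:
  assumes "A \<in> set_pmf Q" shows "A \<subseteq> {1..m} \<and> card A \<in> set_pmf P"
proof -
  from assms obtain x where x: "x \<in> set_pmf P" "A \<in> set_pmf (pmf_of_set {A. A \<subseteq> {1..m} \<and> card A = x})"
    unfolding Q_def attr_set_pmf_def by (auto simp: set_bind_pmf)
  then have "x \<le> m" using supp by auto
  then show ?thesis
    using x set_pmf_of_set[OF subsets_of_card_nonempty finite_subsets_of_card] by auto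
qed

lemma finite_Q: "finite (set_pmf Q)"
  by (rule finite_subset[of _ "Pow {1..m}"]) (use set_Q in auto)

text \<open>
  The one computation with the law of a random attribute set: a uniform \<open>x\<close>-subset of \<open>{1..m}\<close>
  contains \<open>B\<close> with probability \<open>(x choose |B|) / (m choose |B|)\<close>. The weight \<open>\<psi>\<close> depends on the
  size only and therefore factors out once the size is fixed.
\<close>

lemma expectation_superset:
  fixes \<psi> :: "nat \<Rightarrow> real"
  assumes B: "B \<subseteq> {1..m}"
  shows "measure_pmf.expectation Q (\<lambda>D. of_bool (B \<subseteq> D) * \<psi> (card D)) =
    measure_pmf.expectation P (\<lambda>x. real (x choose card B) * \<psi> x) / real (m choose card B)"
proof -
  let ?S = "\<lambda>x. {A. A \<subseteq> {1..m} \<and> card A = x}"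
  let ?j = "card B"
  have jm: "?j \<le> m" using card_mono[OF _ B] by simp
  have "measure_pmf.expectation (pmf_of_set (?S x)) (\<lambda>D. of_bool (B \<subseteq> D) * \<psi> (card D)) =
      real (x choose ?j) * \<psi> x / real (m choose ?j)" if "x \<in> set_pmf P" for x
  proof -
    have xm: "x \<le> m" using that supp by auto
    have "measure_pmf.expectation (pmf_of_set (?S x)) (\<lambda>D. of_bool (B \<subseteq> D) * \<psi> (card D)) =
        (\<Sum>D\<in>?S x. of_bool (B \<subseteq> D) * \<psi> (card D)) / real (card (?S x))"
      by (rule integral_pmf_of_set[OF subsets_of_card_nonempty[OF xm] finite_subsets_of_card])
    also have "(\<Sum>D\<in>?S x. of_bool (B \<subseteq> D) * \<psi> (card D)) = (\<Sum>D\<in>?S x. of_bool (B \<subseteq> D)) * \<psi> x"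
      by (simp add: sum_distrib_right)
    also have "(\<Sum>D\<in>?S x. of_bool (B \<subseteq> D)) = real (card {A. A \<subseteq> {1..m} \<and> card A = x \<and> B \<subseteq> A})"
      by (subst sum_of_bool_eq) (auto simp: finite_subsets_of_card Int_def conj_assoc)
    also have "card (?S x) = m choose x" using n_subsets[of "{1..m}" x] by simp
    also have "real (card {A. A \<subseteq> {1..m} \<and> card A = x \<and> B \<subseteq> A}) * \<psi> x / real (m choose x) =
       real (x choose ?j) * \<psi> x / real (m choose ?j)"
    proof (cases "?j \<le> x")
      case True
      have c: "real (m choose x) * real (x choose ?j) = real (m choose ?j) * real ((m - ?j) choose (x - ?j))"
        using choose_mult[OF True xm] by (metis of_nat_mult)
      have "real (m choose x) > 0" "real (m choose ?j) > 0" using xm jm by auto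
      with c show ?thesis
        unfolding card_supersets_of_card[OF B True] by (simp add: divide_simps mult_ac)
    next
      case False
      have "A \<subseteq> {1..m} \<and> card A = x \<and> B \<subseteq> A \<Longrightarrow> False" for A
        using False card_mono[of A B] finite_subset[of A "{1..m}"] by auto
      then have "{A. A \<subseteq> {1..m} \<and> card A = x \<and> B \<subseteq> A} = {}" by blast
      then show ?thesis using False by (simp only: card.empty) (simp add: binomial_eq_0)
    qed
    finally show ?thesis .
  qed
  then have "measure_pmf.expectation Q (\<lambda>D. of_bool (B \<subseteq> D) * \<psi> (card D)) =
     measure_pmf.expectation P (\<lambda>x. real (x choose ?j) * \<psi> x / real (m choose ?j))"
    unfolding expectation_Q by (rule expectation_cong_pmf)
  then show ?thesis by simp
qed

lemma expectation_card:
  fixes \<psi> :: "nat \<Rightarrow> real"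
  shows "measure_pmf.expectation Q (\<lambda>D. \<psi> (card D)) = measure_pmf.expectation P \<psi>"
  using expectation_superset[of "{}" \<psi>] by simp

text \<open>
  Counting the \<open>j\<close>-subsets of the overlap \<open>A \<inter> D\<close> linearises it: it is a sum over \<open>B \<subseteq> A\<close> of the
  events \<open>B \<subseteq> D\<close>. With \<open>j = s\<close> this is the first moment bound for adjacency, with \<open>j = s + 1\<close> the
  error term of the corresponding Bonferroni inequality.
\<close>

lemma expectation_overlap:
  fixes \<psi> :: "nat \<Rightarrow> real"
  assumes A: "A \<subseteq> {1..m}"
  shows "measure_pmf.expectation Q (\<lambda>D. real (card (A \<inter> D) choose j) * \<psi> (card D)) =
    real (card A choose j) / real (m choose j) *
      measure_pmf.expectation P (\<lambda>x. real (x choose j) * \<psi> x)"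
proof -
  have finA: "finite A" using A finite_subset by blast
  let ?B = "{B. B \<subseteq> A \<and> card B = j}"
  have finB: "finite ?B" using finA by simp
  have "real (card (A \<inter> D) choose j) = (\<Sum>B\<in>?B. of_bool (B \<subseteq> D))" for D
  proof -
    have "(\<Sum>B\<in>?B. of_bool (B \<subseteq> D) :: real) = real (card {B. B \<subseteq> A \<inter> D \<and> card B = j})"
      by (subst sum_of_bool_eq) (auto simp: finB Int_def intro!: arg_cong[where f = card])
    then show ?thesis using n_subsets[of "A \<inter> D" j] finA by simp
  qed
  then have "measure_pmf.expectation Q (\<lambda>D. real (card (A \<inter> D) choose j) * \<psi> (card D)) =
      measure_pmf.expectation Q (\<lambda>D. (\<Sum>B\<in>?B. of_bool (B \<subseteq> D) * \<psi> (card D)))"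
    by (simp add: sum_distrib_right)
  also have "\<dots> = (\<Sum>B\<in>?B. measure_pmf.expectation Q (\<lambda>D. of_bool (B \<subseteq> D) * \<psi> (card D)))"
    by (rule Bochner_Integration.integral_sum) (auto intro: integrable_measure_pmf_finite finite_Q)
  also have "\<dots> = (\<Sum>B\<in>?B. measure_pmf.expectation P (\<lambda>x. real (x choose j) * \<psi> x) / real (m choose j))"
    by (rule sum.cong) (use A in \<open>auto simp: expectation_superset\<close>)
  also have "\<dots> = real (card A choose j) / real (m choose j) *
      measure_pmf.expectation P (\<lambda>x. real (x choose j) * \<psi> x)"
    using n_subsets[OF finA, of j] by simp
  finally show ?thesis .
qed

end

section \<open>Link, path and triangle probabilities\<close>

lemma Suc_times_binomial_Suc:
  "real (Suc k) * real (n choose Suc k) = (real n - real k) * real (n choose k)"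
proof (cases "k \<le> n")
  case True
  have "Suc k * (n choose Suc k) = (n - k) * (n choose k)"
    by (simp only: binomial_absorption binomial_absorb_comp)
  then have "real (Suc k * (n choose Suc k)) = real ((n - k) * (n choose k))" by simp
  then show ?thesis using True by (simp only: of_nat_mult of_nat_diff)
next
  case False
  then show ?thesis by (simp add: binomial_eq_0)
qed

lemma binomial_Suc_le:
  assumes "n \<le> R"
  shows "real (Suc k) * real (n choose Suc k) \<le> real R * real (n choose k)"
  unfolding Suc_times_binomial_Suc using assms by (intro mult_right_mono) auto

lemma of_bool_le_binomial: "(of_bool (k \<le> c) :: real) \<le> real (c choose k)"
  by (cases "k \<le> c") (auto simp: Suc_le_eq)

text \<open>
  Bonferroni: a set of size \<open>c > k\<close> has at most \<open>(k + 1) (c choose (k + 1))\<close> subsets of size \<open>k\<close>,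
  so the overcount in \<open>of_bool_le_binomial\<close> is paid for by subsets of size \<open>k + 1\<close>.
\<close>

lemma binomial_minus_le_of_bool:
  "real (c choose k) - real (Suc k) * real (c choose Suc k) \<le> of_bool (k \<le> c)"
proof (cases "c \<le> k")
  case True
  then show ?thesis by (cases "c = k") (auto simp: binomial_eq_0)
next
  case False
  have "1 * real (c choose k) \<le> real (Suc k) * real (c choose Suc k)"
    unfolding Suc_times_binomial_Suc using False by (intro mult_right_mono) auto
  then show ?thesis by simp
qed

text \<open>
  The combinatorial reason why a triangle comes from one common \<open>s\<close>-set. If \<open>C\<close> meets \<open>A\<close> and \<open>B\<close>
  in \<open>s\<close> points each but not in \<open>s\<close> common ones, then inclusion-exclusion gives \<open>C\<close> at least
  \<open>s + 1\<close> points in \<open>A \<union> B\<close>, which is less likely by a factor of order \<open>1/m\<close>.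
\<close>

lemma overlap_of_two_overlaps:
  assumes "finite C" "s \<le> card (A \<inter> C)" "s \<le> card (B \<inter> C)"
  shows "s \<le> card ((A \<inter> B) \<inter> C) \<or> Suc s \<le> card ((A \<union> B) \<inter> C)"
proof -
  have "card (A \<inter> C) + card (B \<inter> C) = card ((A \<inter> C) \<union> (B \<inter> C)) + card ((A \<inter> C) \<inter> (B \<inter> C))"
    by (rule card_Un_Int) (use assms in auto)
  moreover have "(A \<inter> C) \<union> (B \<inter> C) = (A \<union> B) \<inter> C" "(A \<inter> C) \<inter> (B \<inter> C) = (A \<inter> B) \<inter> C" by auto
  ultimately have "card (A \<inter> C) + card (B \<inter> C) = card ((A \<union> B) \<inter> C) + card ((A \<inter> B) \<inter> C)" by simp
  then show ?thesis using assms(2,3) by linarith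
qed

context random_attr_set
begin

abbreviation EP :: "(nat \<Rightarrow> real) \<Rightarrow> real" where "EP \<equiv> measure_pmf.expectation P"
abbreviation EQ :: "(nat set \<Rightarrow> real) \<Rightarrow> real" where "EQ \<equiv> measure_pmf.expectation Q"
abbreviation Y :: "nat \<Rightarrow> real" where "Y x \<equiv> real (x choose s)"
abbreviation N :: real where "N \<equiv> real (m choose s)"

text \<open>
  Probabilities seen from a vertex whose attribute set \<open>A\<close> is known: \<open>link_prob A\<close> that another
  vertex is adjacent to it, \<open>triangle_prob A\<close> that two others form a triangle with it, and
  \<open>path_prob A\<close> that it starts a path of length two, whether or not the path closes up.
\<close>

definition link_prob :: "nat set \<Rightarrow> real" where
  "link_prob A = EQ (\<lambda>B. of_bool (s \<le> card (A \<inter> B)))"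

definition triangle_prob :: "nat set \<Rightarrow> real" where
  "triangle_prob A = EQ (\<lambda>B. of_bool (s \<le> card (A \<inter> B)) *
     EQ (\<lambda>C. of_bool (s \<le> card (A \<inter> C) \<and> s \<le> card (B \<inter> C))))"

definition path_prob :: "nat set \<Rightarrow> real" where
  "path_prob A = EQ (\<lambda>B. of_bool (s \<le> card (A \<inter> B)) * link_prob B)"

definition mom :: "nat \<Rightarrow> real" where "mom i = EP (\<lambda>x. Y x ^ i)"

text \<open>
  Lower bounds are only available for sets of size at most \<open>R\<close>; they involve these truncated moments
  of \<open>Y\<close> in place of the full ones.
\<close>

definition trunc_mom :: "nat \<Rightarrow> nat \<Rightarrow> real" where
  "trunc_mom R i = EP (\<lambda>x. Y x ^ i * of_bool (x \<le> R))"

lemma integrable_P [simp]: "integrable (measure_pmf P) (f :: nat \<Rightarrow> real)"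
  by (rule integrable_measure_pmf_finite[OF finite_P])

lemma integrable_Q [simp]: "integrable (measure_pmf Q) (f :: nat set \<Rightarrow> real)"
  by (rule integrable_measure_pmf_finite[OF finite_Q])

lemmas EP_mono = expectation_mono_finite[OF finite_P]
lemmas EQ_mono = expectation_mono_finite[OF finite_Q]

lemma finite_set_Q: "A \<in> set_pmf Q \<Longrightarrow> finite A"
  using set_Q finite_subset by blast

lemma mom_nonneg: "mom i \<ge> 0" and trunc_mom_nonneg: "trunc_mom R i \<ge> 0"
  unfolding mom_def trunc_mom_def by (auto intro!: Bochner_Integration.integral_nonneg)

lemma tail_mom: "mom i - trunc_mom R i = EP (\<lambda>x. Y x ^ i * of_bool (\<not> x \<le> R))"
proof -
  have "EP (\<lambda>x. Y x ^ i * of_bool (\<not> x \<le> R)) + trunc_mom R i =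
      EP (\<lambda>x. Y x ^ i * of_bool (\<not> x \<le> R) + Y x ^ i * of_bool (x \<le> R))"
    unfolding trunc_mom_def by (subst Bochner_Integration.integral_add) auto
  also have "\<dots> = mom i" unfolding mom_def by (intro Bochner_Integration.integral_cong) auto
  finally show ?thesis by simp
qed

lemma link_weighted_upper:
  assumes A: "A \<subseteq> {1..m}" and \<psi>: "\<And>x. \<psi> x \<ge> 0"
  shows "EQ (\<lambda>D. of_bool (s \<le> card (A \<inter> D)) * \<psi> (card D)) \<le>
    Y (card A) / N * EP (\<lambda>x. Y x * \<psi> x)"
proof -
  have "EQ (\<lambda>D. of_bool (s \<le> card (A \<inter> D)) * \<psi> (card D)) \<le>
      EQ (\<lambda>D. real (card (A \<inter> D) choose s) * \<psi> (card D))"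
    by (intro EQ_mono mult_right_mono of_bool_le_binomial \<psi>)
  then show ?thesis by (simp add: expectation_overlap[OF A])
qed

text \<open>
  Restricted to sizes at most \<open>R\<close>, the Bonferroni error is at most the fraction \<open>R\<^sup>2 / (m - s)\<close> of the
  main term, because \<open>(s + 1) (x choose (s + 1)) = (x - s) (x choose s)\<close> for each of the three binomial
  coefficients involved. The bound is thus multiplicative, which lets it be iterated along paths.
\<close>

lemma link_weighted_lower:
  assumes A: "A \<subseteq> {1..m}" and AR: "card A \<le> R" and sm: "s < m" and \<psi>: "\<And>x. \<psi> x \<ge> 0"
  shows "Y (card A) / N * (1 - real R ^ 2 / (real m - real s)) *
      EP (\<lambda>x. Y x * (\<psi> x * of_bool (x \<le> R))) \<le>
    EQ (\<lambda>D. of_bool (s \<le> card (A \<inter> D)) * (\<psi> (card D) * of_bool (card D \<le> R)))"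
proof -
  define w where "w = (\<lambda>x. \<psi> x * of_bool (x \<le> R))"
  have w: "w x \<ge> 0" for x using \<psi> by (simp add: w_def)
  let ?E = "EP (\<lambda>x. Y x * w x)"
  have E0: "?E \<ge> 0" using w by (intro Bochner_Integration.integral_nonneg) auto
  have N0: "N > 0" using sm by simp
  have ms: "real m - real s > 0" using sm by simp
  have mS: "real (Suc s) * real (m choose Suc s) = (real m - real s) * N"
    by (rule Suc_times_binomial_Suc)
  have mS0: "real (m choose Suc s) > 0" using sm by simp
  let ?G = "EP (\<lambda>x. real (x choose Suc s) * w x)"
  have "real (Suc s) * ?G = EP (\<lambda>x. real (Suc s) * real (x choose Suc s) * w x)"
    by (simp add: mult.assoc)
  also have "\<dots> \<le> EP (\<lambda>x. real R * Y x * w x)"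
  proof (rule EP_mono)
    fix x
    show "real (Suc s) * real (x choose Suc s) * w x \<le> real R * Y x * w x"
    proof (cases "x \<le> R")
      case True
      show ?thesis by (intro mult_right_mono binomial_Suc_le[OF True] w)
    qed (simp add: w_def)
  qed
  also have "\<dots> = real R * ?E" by (simp add: mult.assoc)
  finally have G: "real (Suc s) * ?G \<le> real R * ?E" .
  have "real (Suc s) * (real (card A choose Suc s) / real (m choose Suc s) * ?G) =
      (real (Suc s) * real (card A choose Suc s)) * (real (Suc s) * ?G) /
      (real (Suc s) * real (m choose Suc s))"
    by (simp add: divide_simps)
  also have "\<dots> \<le> (real R * Y (card A)) * (real R * ?E) / ((real m - real s) * N)"
    unfolding mS using N0 ms w
    by (intro divide_right_mono mult_mono G binomial_Suc_le[OF AR])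
       (auto intro!: mult_nonneg_nonneg Bochner_Integration.integral_nonneg)
  also have "\<dots> = Y (card A) / N * (real R ^ 2 / (real m - real s)) * ?E"
    by (simp add: power2_eq_square mult_ac)
  finally have exc: "real (Suc s) * (real (card A choose Suc s) / real (m choose Suc s) * ?G) \<le>
     Y (card A) / N * (real R ^ 2 / (real m - real s)) * ?E" .
  have "Y (card A) / N * (1 - real R ^ 2 / (real m - real s)) * ?E \<le>
      Y (card A) / N * ?E - real (Suc s) * (real (card A choose Suc s) / real (m choose Suc s) * ?G)"
    using exc by (simp add: algebra_simps)
  also have "\<dots> = EQ (\<lambda>D. real (card (A \<inter> D) choose s) * w (card D)) -
      real (Suc s) * EQ (\<lambda>D. real (card (A \<inter> D) choose Suc s) * w (card D))"
    by (simp only: expectation_overlap[OF A])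
  also have "\<dots> = EQ (\<lambda>D. (real (card (A \<inter> D) choose s) -
      real (Suc s) * real (card (A \<inter> D) choose Suc s)) * w (card D))"
    by (simp add: left_diff_distrib mult.assoc del: of_nat_Suc)
  also have "\<dots> \<le> EQ (\<lambda>D. of_bool (s \<le> card (A \<inter> D)) * w (card D))"
    by (intro EQ_mono mult_right_mono binomial_minus_le_of_bool w)
  finally show ?thesis by (simp add: w_def)
qed

text \<open>
  An overlap of size \<open>s + 1\<close> costs an additional factor \<open>1 / (m - s)\<close> compared with an overlap of
  size \<open>s\<close>; this is what makes all configurations other than the typical one negligible.
\<close>

lemma overlap_Suc_upper:
  assumes C: "C \<subseteq> {1..m}" "card C \<le> c" and sm: "s < m"
  shows "EQ (\<lambda>D. of_bool (Suc s \<le> card (C \<inter> D) \<and> card D \<le> R)) \<le>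
    real c ^ Suc s * real R * mom 1 / ((real m - real s) * N)"
proof -
  have N0: "N > 0" and ms: "real m - real s > 0" using sm by auto
  have "EQ (\<lambda>D. of_bool (Suc s \<le> card (C \<inter> D) \<and> card D \<le> R)) \<le>
      EQ (\<lambda>D. real (card (C \<inter> D) choose Suc s) * of_bool (card D \<le> R))"
    unfolding of_bool_conj by (intro EQ_mono mult_right_mono of_bool_le_binomial) auto
  also have "\<dots> = real (card C choose Suc s) / real (m choose Suc s) *
      EP (\<lambda>x. real (x choose Suc s) * of_bool (x \<le> R))"
    by (rule expectation_overlap[OF C(1)])
  also have "\<dots> = real (card C choose Suc s) *
      EP (\<lambda>x. real (Suc s) * real (x choose Suc s) * of_bool (x \<le> R)) / ((real m - real s) * N)"
    unfolding Suc_times_binomial_Suc[of s m, symmetric]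
    by (simp add: mult.assoc del: binomial_Suc_Suc of_nat_Suc)
  also have "\<dots> \<le> real c ^ Suc s * EP (\<lambda>x. real R * Y x) / ((real m - real s) * N)"
  proof (intro divide_right_mono mult_mono)
    have "card C choose Suc s \<le> c ^ Suc s"
    proof (cases "Suc s \<le> card C")
      case True
      then have "card C choose Suc s \<le> card C ^ Suc s" by (rule binomial_le_pow)
      also have "\<dots> \<le> c ^ Suc s" by (rule power_mono[OF C(2)]) simp
      finally show ?thesis .
    next
      case False
      then show ?thesis by (simp add: binomial_eq_0)
    qed
    then show "real (card C choose Suc s) \<le> real c ^ Suc s" by (metis of_nat_le_iff of_nat_power)
    have "real (Suc s) * real (x choose Suc s) * of_bool (x \<le> R) \<le> real R * Y x" for x
      using binomial_Suc_le[of x R s] by (cases "x \<le> R") auto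
    then show "EP (\<lambda>x. real (Suc s) * real (x choose Suc s) * of_bool (x \<le> R)) \<le> EP (\<lambda>x. real R * Y x)"
      by (intro EP_mono)
  qed (use N0 ms in \<open>auto intro!: Bochner_Integration.integral_nonneg\<close>)
  also have "\<dots> = real c ^ Suc s * real R * mom 1 / ((real m - real s) * N)"
    by (simp add: mom_def mult.assoc)
  finally show ?thesis .
qed

lemma link_prob_nonneg: "link_prob A \<ge> 0"
  unfolding link_prob_def by (intro Bochner_Integration.integral_nonneg) auto

lemma link_prob_le_1: "link_prob A \<le> 1"
proof -
  have "link_prob A \<le> EQ (\<lambda>_. 1)" unfolding link_prob_def by (rule EQ_mono) auto
  then show ?thesis by simp
qed

lemma link_prob_mono: "finite A \<Longrightarrow> B \<subseteq> A \<Longrightarrow> link_prob B \<le> link_prob A"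
  unfolding link_prob_def
proof (rule EQ_mono)
  fix D assume "finite A" "B \<subseteq> A"
  then have "card (B \<inter> D) \<le> card (A \<inter> D)" by (intro card_mono) auto
  then show "(of_bool (s \<le> card (B \<inter> D)) :: real) \<le> of_bool (s \<le> card (A \<inter> D))" by auto
qed

lemma link_prob_upper: "A \<subseteq> {1..m} \<Longrightarrow> link_prob A \<le> Y (card A) / N * mom 1"
  using link_weighted_upper[of A "\<lambda>_. 1"] by (simp add: link_prob_def mom_def)

lemma link_tail_upper:
  "A \<subseteq> {1..m} \<Longrightarrow> EQ (\<lambda>D. of_bool (s \<le> card (A \<inter> D) \<and> \<not> card D \<le> R)) \<le>
     Y (card A) / N * (mom 1 - trunc_mom R 1)"
  using link_weighted_upper[of A "\<lambda>x. of_bool (\<not> x \<le> R)"] by (simp add: tail_mom of_bool_conj)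

lemma link_prob_lower:
  assumes "A \<subseteq> {1..m}" "card A \<le> R" "s < m"
  shows "Y (card A) / N * (1 - real R ^ 2 / (real m - real s)) * trunc_mom R 1 \<le> link_prob A"
proof -
  have "Y (card A) / N * (1 - real R ^ 2 / (real m - real s)) * trunc_mom R 1 \<le>
    EQ (\<lambda>D. of_bool (s \<le> card (A \<inter> D)) * (1 * of_bool (card D \<le> R)))"
    using link_weighted_lower[OF assms, of "\<lambda>_. 1"] by (simp add: trunc_mom_def)
  also have "\<dots> \<le> link_prob A" unfolding link_prob_def by (rule EQ_mono) auto
  finally show ?thesis .
qed

lemma path_prob_upper:
  assumes A: "A \<subseteq> {1..m}"
  shows "path_prob A \<le> Y (card A) / N ^ 2 * mom 1 * mom 2"
proof -
  have "path_prob A \<le> EQ (\<lambda>B. of_bool (s \<le> card (A \<inter> B)) * (Y (card B) / N * mom 1))"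
    unfolding path_prob_def by (intro EQ_mono mult_left_mono link_prob_upper) (use set_Q in auto)
  also have "\<dots> \<le> Y (card A) / N * EP (\<lambda>x. Y x * (Y x / N * mom 1))"
    by (intro link_weighted_upper A) (auto simp: mom_nonneg)
  also have "EP (\<lambda>x. Y x * (Y x / N * mom 1)) = mom 1 / N * mom 2"
    unfolding mom_def[of 2] by (subst Bochner_Integration.integral_mult_right_zero[symmetric])
      (auto simp: power2_eq_square mult_ac intro!: Bochner_Integration.integral_cong)
  finally show ?thesis by (simp add: power2_eq_square mult_ac)
qed

lemma path_prob_lower:
  assumes A: "A \<subseteq> {1..m}" and AR: "card A \<le> R" and sm: "s < m"
  defines "\<theta> \<equiv> 1 - real R ^ 2 / (real m - real s)"
  assumes \<theta>: "\<theta> \<ge> 0"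
  shows "Y (card A) / N ^ 2 * \<theta> ^ 2 * trunc_mom R 1 * trunc_mom R 2 \<le> path_prob A"
proof -
  let ?c = "\<theta> * trunc_mom R 1 / N"
  have c: "?c \<ge> 0" using \<theta> trunc_mom_nonneg by simp
  have "EP (\<lambda>x. Y x * (?c * Y x * of_bool (x \<le> R))) = ?c * trunc_mom R 2"
    unfolding trunc_mom_def[of _ 2] by (subst Bochner_Integration.integral_mult_right_zero[symmetric])
      (auto simp: power2_eq_square mult_ac intro!: Bochner_Integration.integral_cong)
  then have "Y (card A) / N ^ 2 * \<theta> ^ 2 * trunc_mom R 1 * trunc_mom R 2 =
      Y (card A) / N * \<theta> * EP (\<lambda>x. Y x * (?c * Y x * of_bool (x \<le> R)))"
    by (simp only:) (simp add: power2_eq_square mult_ac)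
  also have "\<dots> \<le> EQ (\<lambda>D. of_bool (s \<le> card (A \<inter> D)) * (?c * Y (card D) * of_bool (card D \<le> R)))"
    unfolding \<theta>_def by (rule link_weighted_lower[OF A AR sm])
      (rule mult_nonneg_nonneg[OF c[unfolded \<theta>_def] of_nat_0_le_iff])
  also have "\<dots> \<le> path_prob A"
    unfolding path_prob_def
  proof (intro EQ_mono mult_left_mono)
    fix D assume "D \<in> set_pmf Q"
    then have D: "D \<subseteq> {1..m}" using set_Q by auto
    show "?c * Y (card D) * of_bool (card D \<le> R) \<le> link_prob D"
      using link_prob_lower[OF D _ sm, of R] link_prob_nonneg[of D]
      by (cases "card D \<le> R") (auto simp: \<theta>_def mult_ac)
  qed auto
  finally show ?thesis .
qed

text \<open>
  If \<open>B\<close> meets \<open>A\<close> in an \<open>s\<close>-set \<open>S\<close>, every set linked to \<open>S\<close> is linked to both \<open>A\<close> and \<open>B\<close>.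
\<close>

lemma triangle_prob_lower:
  assumes A: "A \<subseteq> {1..m}" and sR: "s \<le> R" and sm: "s < m"
  shows "link_prob A * ((1 - real R ^ 2 / (real m - real s)) * trunc_mom R 1 / N) \<le> triangle_prob A"
proof -
  let ?L = "(1 - real R ^ 2 / (real m - real s)) * trunc_mom R 1 / N"
  have "link_prob A * ?L = EQ (\<lambda>B. of_bool (s \<le> card (A \<inter> B)) * ?L)"
    unfolding link_prob_def by simp
  also have "\<dots> \<le> triangle_prob A"
    unfolding triangle_prob_def
  proof (rule EQ_mono)
    fix B assume "B \<in> set_pmf Q"
    then have B: "B \<subseteq> {1..m}" using set_Q by auto
    have finA: "finite A" "finite (A \<inter> B)" using A finite_subset by blast+
    show "of_bool (s \<le> card (A \<inter> B)) * ?L \<le> of_bool (s \<le> card (A \<inter> B)) *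
       EQ (\<lambda>C. of_bool (s \<le> card (A \<inter> C) \<and> s \<le> card (B \<inter> C)))"
    proof (cases "s \<le> card (A \<inter> B)")
      case True
      then obtain S where S: "S \<subseteq> A \<inter> B" "card S = s" by (meson obtain_subset_with_card_n)
      have "?L \<le> link_prob S"
        using link_prob_lower[of S R] S A sR sm by auto
      also have "\<dots> \<le> link_prob (A \<inter> B)" using S finA by (intro link_prob_mono) auto
      also have "\<dots> \<le> EQ (\<lambda>C. of_bool (s \<le> card (A \<inter> C) \<and> s \<le> card (B \<inter> C)))"
        unfolding link_prob_def
      proof (rule EQ_mono)
        fix C assume "C \<in> set_pmf Q"
        then have "finite C" by (rule finite_set_Q)
        then have "card (A \<inter> B \<inter> C) \<le> card (A \<inter> C)" "card (A \<inter> B \<inter> C) \<le> card (B \<inter> C)"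
          by (auto intro!: card_mono)
        then show "(of_bool (s \<le> card (A \<inter> B \<inter> C)) :: real) \<le>
            of_bool (s \<le> card (A \<inter> C) \<and> s \<le> card (B \<inter> C))" by auto
      qed
      finally show ?thesis using True by simp
    qed simp
  qed
  finally show ?thesis .
qed

text \<open>
  Typically \<open>|A \<inter> B| = s\<close> and \<open>|B| \<le> R\<close>; then \<open>overlap_of_two_overlaps\<close> says that the third set
  contains the \<open>s\<close>-set \<open>A \<inter> B\<close>, or has an exceptional overlap (\<open>\<eta>\<close>), or is large (\<open>\<tau>\<close>). For an
  atypical \<open>B\<close> the condition between \<open>B\<close> and the third set is dropped, which leaves a link to \<open>A\<close>
  and again costs \<open>\<eta>\<close> or \<open>\<tau>\<close>.
\<close>

lemma triangle_prob_upper: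
  assumes A: "A \<subseteq> {1..m}" and AR: "card A \<le> R" and sm: "s < m"
  defines "\<eta> \<equiv> (2 * real R) ^ Suc s * real R * mom 1 / ((real m - real s) * N)"
    and "\<tau> \<equiv> Y (card A) / N * (mom 1 - trunc_mom R 1)"
  shows "triangle_prob A \<le> link_prob A * (mom 1 / N + 2 * \<eta> + 2 * \<tau>)"
proof -
  let ?r = "\<lambda>B. EQ (\<lambda>C. of_bool (s \<le> card (A \<inter> C) \<and> s \<le> card (B \<inter> C)))"
  let ?K = "mom 1 / N + \<eta> + \<tau>"
  have finA: "finite A" using A finite_subset by blast
  have N0: "N > 0" using sm by simp
  have \<eta>0: "\<eta> \<ge> 0" using sm mom_nonneg unfolding \<eta>_def by (intro divide_nonneg_nonneg) auto
  have \<tau>0: "\<tau> \<ge> 0" unfolding \<tau>_def tail_mom by (intro mult_nonneg_nonneg Bochner_Integration.integral_nonneg) auto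
  have K0: "?K \<ge> 0" using \<eta>0 \<tau>0 mom_nonneg[of 1] N0
    by (intro add_nonneg_nonneg divide_nonneg_nonneg) auto
  have r_typical: "?r B \<le> ?K" if B: "B \<subseteq> {1..m}" "card B \<le> R" "card (A \<inter> B) = s" for B
  proof -
    have "?r B \<le> EQ (\<lambda>C. of_bool (s \<le> card ((A \<inter> B) \<inter> C)) +
        of_bool (Suc s \<le> card ((A \<union> B) \<inter> C) \<and> card C \<le> R) +
        of_bool (s \<le> card (A \<inter> C) \<and> \<not> card C \<le> R))"
    proof (rule EQ_mono)
      fix C assume "C \<in> set_pmf Q"
      then have "finite C" by (rule finite_set_Q)
      then show "(of_bool (s \<le> card (A \<inter> C) \<and> s \<le> card (B \<inter> C)) :: real) \<le>
        of_bool (s \<le> card ((A \<inter> B) \<inter> C)) +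
        of_bool (Suc s \<le> card ((A \<union> B) \<inter> C) \<and> card C \<le> R) +
        of_bool (s \<le> card (A \<inter> C) \<and> \<not> card C \<le> R)"
        using overlap_of_two_overlaps[of C s A B] by auto
    qed
    also have "\<dots> = link_prob (A \<inter> B) +
        EQ (\<lambda>C. of_bool (Suc s \<le> card ((A \<union> B) \<inter> C) \<and> card C \<le> R)) +
        EQ (\<lambda>C. of_bool (s \<le> card (A \<inter> C) \<and> \<not> card C \<le> R))"
      by (simp add: link_prob_def)
    also have "\<dots> \<le> ?K"
    proof (intro add_mono)
      show "link_prob (A \<inter> B) \<le> mom 1 / N"
        using link_prob_upper[of "A \<inter> B"] A B by auto
      have "card (A \<union> B) \<le> 2 * R" using card_Un_le[of A B] AR B by linarith
      then show "EQ (\<lambda>C. of_bool (Suc s \<le> card ((A \<union> B) \<inter> C) \<and> card C \<le> R)) \<le> \<eta>"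
        using overlap_Suc_upper[of "A \<union> B" "2 * R" R] A B sm by (simp add: \<eta>_def)
      show "EQ (\<lambda>C. of_bool (s \<le> card (A \<inter> C) \<and> \<not> card C \<le> R)) \<le> \<tau>"
        unfolding \<tau>_def by (rule link_tail_upper[OF A])
    qed
    finally show ?thesis .
  qed
  have r_le: "?r B \<le> link_prob A" for B
    unfolding link_prob_def by (rule EQ_mono) auto
  have r0: "?r B \<ge> 0" for B by (intro Bochner_Integration.integral_nonneg) auto
  have "triangle_prob A \<le> EQ (\<lambda>B. of_bool (s \<le> card (A \<inter> B)) * ?K +
      of_bool (Suc s \<le> card (A \<inter> B) \<and> card B \<le> R) * link_prob A +
      of_bool (s \<le> card (A \<inter> B) \<and> \<not> card B \<le> R) * link_prob A)"
    unfolding triangle_prob_def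
  proof (rule EQ_mono)
    fix B assume "B \<in> set_pmf Q"
    then have B: "B \<subseteq> {1..m}" using set_Q by auto
    consider "\<not> s \<le> card (A \<inter> B)" | "s \<le> card (A \<inter> B)" "\<not> card B \<le> R"
      | "Suc s \<le> card (A \<inter> B)" "card B \<le> R" | "card (A \<inter> B) = s" "card B \<le> R" by linarith
    then show "of_bool (s \<le> card (A \<inter> B)) * ?r B \<le> of_bool (s \<le> card (A \<inter> B)) * ?K +
      of_bool (Suc s \<le> card (A \<inter> B) \<and> card B \<le> R) * link_prob A +
      of_bool (s \<le> card (A \<inter> B) \<and> \<not> card B \<le> R) * link_prob A"
      using r_typical[OF B] r_le[of B] K0 by cases auto
  qed
  also have "\<dots> = link_prob A * ?K +
      EQ (\<lambda>B. of_bool (Suc s \<le> card (A \<inter> B) \<and> card B \<le> R)) * link_prob A +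
      EQ (\<lambda>B. of_bool (s \<le> card (A \<inter> B) \<and> \<not> card B \<le> R)) * link_prob A"
    by (simp add: link_prob_def)
  also have "\<dots> \<le> link_prob A * ?K + \<eta> * link_prob A + \<tau> * link_prob A"
  proof (intro add_mono mult_right_mono order.refl link_prob_nonneg)
    show "EQ (\<lambda>B. of_bool (Suc s \<le> card (A \<inter> B) \<and> card B \<le> R)) \<le> \<eta>"
      using overlap_Suc_upper[of A "2 * R" R] A AR sm by (simp add: \<eta>_def)
    show "EQ (\<lambda>B. of_bool (s \<le> card (A \<inter> B) \<and> \<not> card B \<le> R)) \<le> \<tau>"
      unfolding \<tau>_def by (rule link_tail_upper[OF A])
  qed (rule K0)
  finally show ?thesis by (simp add: algebra_simps)
qed

end

section \<open>From the graph to its attribute sets\<close>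

context random_attr_set
begin

(* Keeps the vertex set in the form {1..n}. *)
declare One_nat_def [simp del]

abbreviation attr_family :: "nat set \<Rightarrow> (nat \<Rightarrow> nat set) pmf" where
  "attr_family V \<equiv> Pi_pmf V {} (\<lambda>_. Q)"

abbreviation E_binomial :: "nat \<Rightarrow> nat set \<Rightarrow> (nat \<Rightarrow> real) \<Rightarrow> real" where
  "E_binomial n A \<equiv> measure_pmf.expectation (binomial_pmf n (link_prob A))"

lemma finite_attr_family: "finite V \<Longrightarrow> finite (set_pmf (attr_family V))"
  by (subst set_Pi_pmf) (auto intro!: finite_PiE_dflt finite_Q)

lemma bernoulli_link: "map_pmf (\<lambda>B. s \<le> card (A \<inter> B)) Q = bernoulli_pmf (link_prob A)"
proof (rule pmf_eqI)
  fix b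
  have T: "pmf (map_pmf (\<lambda>B. s \<le> card (A \<inter> B)) Q) True = link_prob A"
  proof -
    have "(\<lambda>B. of_bool (s \<le> card (A \<inter> B)) :: real) = indicator ((\<lambda>B. s \<le> card (A \<inter> B)) -` {True})"
      by (auto simp: fun_eq_iff)
    then show ?thesis by (simp add: pmf_map link_prob_def)
  qed
  show "pmf (map_pmf (\<lambda>B. s \<le> card (A \<inter> B)) Q) b = pmf (bernoulli_pmf (link_prob A)) b"
  proof (cases b)
    case True then show ?thesis using T by (simp add: link_prob_nonneg link_prob_le_1)
  next
    case False
    then show ?thesis using T
      by (simp add: link_prob_nonneg link_prob_le_1 pmf_False_conv_True)
  qed
qed

text \<open>
  Given the attribute set \<open>A\<close> of a vertex, the other vertices decide independently whether to be
  adjacent to it. This is the source of the binomial, and in the limit Poisson, degree.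
\<close>

lemma count_links_binomial:
  assumes V: "finite V"
  shows "map_pmf (\<lambda>f. card {v \<in> V. s \<le> card (A \<inter> f v)}) (attr_family V) = binomial_pmf (card V) (link_prob A)"
proof -
  have "binomial_pmf (card V) (link_prob A) =
      map_pmf (\<lambda>f. card {v \<in> V. f v}) (Pi_pmf V (s \<le> card (A \<inter> {})) (\<lambda>_. bernoulli_pmf (link_prob A)))"
    by (rule binomial_pmf_altdef') (use V link_prob_nonneg link_prob_le_1 in auto)
  also have "Pi_pmf V (s \<le> card (A \<inter> {})) (\<lambda>_. bernoulli_pmf (link_prob A)) =
      map_pmf (\<lambda>h. (\<lambda>B. s \<le> card (A \<inter> B)) \<circ> h) (attr_family V)"
    unfolding bernoulli_link[symmetric] by (rule Pi_pmf_map) (use V in auto)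
  finally show ?thesis by (simp add: map_pmf_comp o_def)
qed

lemma expectation_attr_family_insert:
  fixes h :: "_ \<Rightarrow> real"
  assumes V: "finite V" "x \<notin> V"
  shows "measure_pmf.expectation (attr_family (insert x V)) h =
    EQ (\<lambda>B. measure_pmf.expectation (attr_family V) (\<lambda>f. h (f(x := B))))"
  unfolding Pi_pmf_insert'[OF V]
  by (subst expectation_bind_finite, auto simp: finite_Q finite_attr_family V)
     (subst expectation_bind_finite, auto simp: finite_Q finite_attr_family V)

text \<open>
  Conditioning on the attribute sets of \<open>j\<close> and \<open>i\<close> leaves a binomial number of further neighbours
  of \<open>j\<close>. The result does not depend on \<open>i\<close> and \<open>j\<close>, which is how exchangeability of the vertices
  enters.
\<close>

lemma expectation_edge:
  fixes F :: "nat set \<Rightarrow> nat set \<Rightarrow> nat \<Rightarrow> real"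
  assumes ij: "i \<in> {1..n}" "j \<in> {1..n}" "i \<noteq> j"
  shows "measure_pmf.expectation (attr_family {1..n})
      (\<lambda>D. F (D j) (D i) (card {v \<in> {1..n} - {i, j}. s \<le> card (D j \<inter> D v)})) =
    EQ (\<lambda>A. EQ (\<lambda>B. E_binomial (n - 2) A (F A B)))"
proof -
  define V where "V = {1..n} - {i, j}"
  have n: "{1..n} = insert j (insert i V)" using ij by (auto simp: V_def)
  have cV: "card V = n - 2" unfolding V_def using ij by (subst card_Diff_subset) auto
  have fV: "finite V" "i \<notin> V" "j \<notin> insert i V" using ij by (auto simp: V_def)
  have upd: "(f(i := B, j := A)) j = A" "(f(i := B, j := A)) i = B"
    "card {v \<in> V. s \<le> card (A \<inter> (f(i := B, j := A)) v)} = card {v \<in> V. s \<le> card (A \<inter> f v)}"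
    for f :: "nat \<Rightarrow> nat set" and A B
    using ij fV by (auto intro!: arg_cong[where f = card])
  have "EQ (\<lambda>A. EQ (\<lambda>B. E_binomial (n - 2) A (F A B))) =
     EQ (\<lambda>A. EQ (\<lambda>B. measure_pmf.expectation
     (map_pmf (\<lambda>f. card {v \<in> V. s \<le> card (A \<inter> f v)}) (attr_family V)) (F A B)))"
    by (simp only: count_links_binomial[OF fV(1)] cV)
  also have "\<dots> = measure_pmf.expectation (attr_family (insert j (insert i V)))
      (\<lambda>D. F (D j) (D i) (card {v \<in> V. s \<le> card (D j \<inter> D v)}))"
    unfolding expectation_attr_family_insert[OF finite.insertI[OF fV(1)] fV(3)] expectation_attr_family_insert[OF fV(1,2)]
    by (simp only: upd integral_map_pmf)
  finally show ?thesis unfolding n[symmetric] by (simp add: V_def)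
qed

lemma expectation_wedge:
  fixes F :: "nat set \<Rightarrow> nat set \<Rightarrow> nat set \<Rightarrow> nat \<Rightarrow> real"
  assumes ij: "i \<in> {1..n}" "j \<in> {1..n}" "l \<in> {1..n}" "i \<noteq> j" "l \<noteq> i" "l \<noteq> j"
  shows "measure_pmf.expectation (attr_family {1..n})
      (\<lambda>D. F (D j) (D i) (D l) (card {v \<in> {1..n} - {i, j, l}. s \<le> card (D j \<inter> D v)})) =
    EQ (\<lambda>A. EQ (\<lambda>B. EQ (\<lambda>C. E_binomial (n - 3) A (F A B C))))"
proof -
  define V where "V = {1..n} - {i, j, l}"
  have n: "{1..n} = insert j (insert i (insert l V))" using ij by (auto simp: V_def)
  have cV: "card V = n - 3" unfolding V_def using ij by (subst card_Diff_subset) auto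
  have fV: "finite V" "l \<notin> V" "i \<notin> insert l V" "j \<notin> insert i (insert l V)"
    using ij by (auto simp: V_def)
  have upd: "(f(l := C, i := B, j := A)) j = A" "(f(l := C, i := B, j := A)) i = B"
    "(f(l := C, i := B, j := A)) l = C"
    "card {v \<in> V. s \<le> card (A \<inter> (f(l := C, i := B, j := A)) v)} = card {v \<in> V. s \<le> card (A \<inter> f v)}"
    for f :: "nat \<Rightarrow> nat set" and A B C
    using ij fV by (auto intro!: arg_cong[where f = card])
  have "EQ (\<lambda>A. EQ (\<lambda>B. EQ (\<lambda>C. E_binomial (n - 3) A (F A B C)))) =
     EQ (\<lambda>A. EQ (\<lambda>B. EQ (\<lambda>C. measure_pmf.expectation
     (map_pmf (\<lambda>f. card {v \<in> V. s \<le> card (A \<inter> f v)}) (attr_family V)) (F A B C))))"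
    by (simp only: count_links_binomial[OF fV(1)] cV)
  also have "\<dots> = measure_pmf.expectation (attr_family (insert j (insert i (insert l V))))
      (\<lambda>D. F (D j) (D i) (D l) (card {v \<in> V. s \<le> card (D j \<inter> D v)}))"
    unfolding expectation_attr_family_insert[OF finite.insertI[OF finite.insertI[OF fV(1)]] fV(4)]
      expectation_attr_family_insert[OF finite.insertI[OF fV(1)] fV(3)] expectation_attr_family_insert[OF fV(1,2)]
    by (simp only: upd integral_map_pmf)
  finally show ?thesis unfolding n[symmetric] by (simp add: V_def)
qed

text \<open>
  Expectations of a function \<open>g\<close> of the degree of the distinguished vertex \<open>v\<^sub>2\<close>, on the events that
  \<open>v\<^sub>1\<close> is its neighbour, that \<open>v\<^sub>1\<close> and a third vertex form a triangle with it, and that \<open>v\<^sub>1\<close> joins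
  it to a third vertex that is not its neighbour. The shifts in \<open>g\<close> count the neighbours of \<open>v\<^sub>2\<close>
  that are already fixed by the event. With \<open>g = 1\<close> and with \<open>g\<close> the indicator of a degree, these
  weights serve the unconditioned and the degree-conditioned quantities at the same time.
\<close>

definition edge_weight :: "nat \<Rightarrow> (nat \<Rightarrow> real) \<Rightarrow> real" where
  "edge_weight n g = EQ (\<lambda>A. link_prob A * E_binomial (n - 2) A (\<lambda>c. g (Suc c)))"

definition triangle_weight :: "nat \<Rightarrow> (nat \<Rightarrow> real) \<Rightarrow> real" where
  "triangle_weight n g = EQ (\<lambda>A. triangle_prob A * E_binomial (n - 3) A (\<lambda>c. g (Suc (Suc c))))"

definition wedge_weight :: "nat \<Rightarrow> (nat \<Rightarrow> real) \<Rightarrow> real" where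
  "wedge_weight n g = EQ (\<lambda>A. (path_prob A - triangle_prob A) * E_binomial (n - 3) A (\<lambda>c. g (Suc c)))"

lemma adj_iff: "i \<noteq> j \<Longrightarrow> adj s D i j \<longleftrightarrow> s \<le> card (D j \<inter> D i)"
  by (auto simp: adj_def Int_commute)

lemma card_filter_insert:
  assumes "finite V" "x \<notin> V"
  shows "card {v \<in> insert x V. p v} = of_bool (p x) + card {v \<in> V. p v}"
proof -
  have "{v \<in> insert x V. p v} = (if p x then insert x {v \<in> V. p v} else {v \<in> V. p v})" by auto
  then show ?thesis using assms by simp
qed

lemma deg_remove_one:
  assumes "i \<in> {1..n}" "j \<in> {1..n}" "i \<noteq> j"
  shows "deg s n D j = of_bool (s \<le> card (D j \<inter> D i)) +
    card {v \<in> {1..n} - {i, j}. s \<le> card (D j \<inter> D v)}"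
proof -
  have "{v \<in> {1..n}. adj s D j v} = {v \<in> insert i ({1..n} - {i, j}). s \<le> card (D j \<inter> D v)}"
    using assms by (auto simp: adj_def)
  then show ?thesis unfolding deg_def by (simp only:) (subst card_filter_insert; simp)
qed

lemma deg_remove_two:
  assumes "i \<in> {1..n}" "j \<in> {1..n}" "i \<noteq> j" "l \<in> {1..n}" "l \<noteq> i" "l \<noteq> j"
  shows "deg s n D j = of_bool (s \<le> card (D j \<inter> D i)) + of_bool (s \<le> card (D j \<inter> D l)) +
    card {v \<in> {1..n} - {i, j, l}. s \<le> card (D j \<inter> D v)}"
proof -
  have "{v \<in> {1..n}. adj s D j v} = {v \<in> insert i (insert l ({1..n} - {i, j, l})). s \<le> card (D j \<inter> D v)}"
    using assms by (auto simp: adj_def)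
  then have "deg s n D j = card {v \<in> insert i (insert l ({1..n} - {i, j, l})). s \<le> card (D j \<inter> D v)}"
    by (simp only: deg_def)
  also have "\<dots> = of_bool (s \<le> card (D j \<inter> D i)) +
      card {v \<in> insert l ({1..n} - {i, j, l}). s \<le> card (D j \<inter> D v)}"
    using assms by (intro card_filter_insert) auto
  also have "card {v \<in> insert l ({1..n} - {i, j, l}). s \<le> card (D j \<inter> D v)} =
      of_bool (s \<le> card (D j \<inter> D l)) + card {v \<in> {1..n} - {i, j, l}. s \<le> card (D j \<inter> D v)}"
    by (intro card_filter_insert) auto
  finally show ?thesis by (simp only: add.assoc)
qed

lemma expectation_adj:
  assumes ij: "i \<in> {1..n}" "j \<in> {1..n}" "i \<noteq> j"
  shows "measure_pmf.expectation (attr_family {1..n}) (\<lambda>D. of_bool (adj s D i j) * g (deg s n D j)) =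
    edge_weight n g"
proof -
  have "measure_pmf.expectation (attr_family {1..n}) (\<lambda>D. of_bool (adj s D i j) * g (deg s n D j)) =
    EQ (\<lambda>A. EQ (\<lambda>B. E_binomial (n - 2) A (\<lambda>c. of_bool (s \<le> card (A \<inter> B)) * g (Suc c))))"
    unfolding expectation_edge[OF ij, symmetric]
    by (intro Bochner_Integration.integral_cong) (auto simp: adj_iff ij deg_remove_one[OF ij] One_nat_def)
  also have "\<dots> = edge_weight n g"
    by (simp add: edge_weight_def link_prob_def)
  finally show ?thesis .
qed

lemma expectation_triangle:
  assumes ij: "i \<in> {1..n}" "j \<in> {1..n}" "l \<in> {1..n}" "i \<noteq> j" "l \<noteq> i" "l \<noteq> j"
  shows "measure_pmf.expectation (attr_family {1..n})
      (\<lambda>D. of_bool (adj s D i j) * g (deg s n D j) * of_bool (adj s D i l \<and> adj s D j l)) =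
    triangle_weight n g"
proof -
  have "measure_pmf.expectation (attr_family {1..n})
      (\<lambda>D. of_bool (adj s D i j) * g (deg s n D j) * of_bool (adj s D i l \<and> adj s D j l)) =
    EQ (\<lambda>A. EQ (\<lambda>B. EQ (\<lambda>C. E_binomial (n - 3) A (\<lambda>c. of_bool (s \<le> card (A \<inter> B)) *
       (of_bool (s \<le> card (A \<inter> C) \<and> s \<le> card (B \<inter> C)) * g (Suc (Suc c)))))))"
    unfolding expectation_wedge[OF ij, symmetric]
    by (intro Bochner_Integration.integral_cong)
      (use ij in \<open>auto simp: adj_iff adj_def deg_remove_two Int_commute One_nat_def\<close>)
  also have "\<dots> = EQ (\<lambda>A. EQ (\<lambda>B. of_bool (s \<le> card (A \<inter> B)) *
      EQ (\<lambda>C. of_bool (s \<le> card (A \<inter> C) \<and> s \<le> card (B \<inter> C))) * E_binomial (n - 3) A (\<lambda>c. g (Suc (Suc c)))))"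
    by (intro Bochner_Integration.integral_cong refl) (simp add: mult.assoc)
  also have "\<dots> = triangle_weight n g"
    by (simp add: triangle_weight_def triangle_prob_def)
  finally show ?thesis .
qed

lemma expectation_open_wedge:
  assumes ij: "i \<in> {1..n}" "j \<in> {1..n}" "l \<in> {1..n}" "i \<noteq> j" "l \<noteq> i" "l \<noteq> j"
  shows "measure_pmf.expectation (attr_family {1..n})
      (\<lambda>D. of_bool (adj s D i j) * g (deg s n D j) * of_bool (adj s D i l \<and> \<not> adj s D j l)) =
    wedge_weight n g"
proof -
  have inner: "EQ (\<lambda>C. E_binomial (n - 3) A (\<lambda>c. of_bool (s \<le> card (A \<inter> B)) *
       ((of_bool (s \<le> card (B \<inter> C)) -
         of_bool (s \<le> card (A \<inter> C) \<and> s \<le> card (B \<inter> C))) * g (Suc c)))) =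
       of_bool (s \<le> card (A \<inter> B)) * (link_prob B -
      EQ (\<lambda>C. of_bool (s \<le> card (A \<inter> C) \<and> s \<le> card (B \<inter> C)))) * E_binomial (n - 3) A (\<lambda>c. g (Suc c))"
    for A B
  proof -
    have "EQ (\<lambda>C. of_bool (s \<le> card (B \<inter> C)) - of_bool (s \<le> card (A \<inter> C) \<and> s \<le> card (B \<inter> C))) =
       link_prob B - EQ (\<lambda>C. of_bool (s \<le> card (A \<inter> C) \<and> s \<le> card (B \<inter> C)))"
      by (simp add: link_prob_def)
    then show ?thesis
      by (simp only: integral_mult_right_zero integral_mult_left_zero mult.assoc)
  qed
  have "measure_pmf.expectation (attr_family {1..n})
      (\<lambda>D. of_bool (adj s D i j) * g (deg s n D j) * of_bool (adj s D i l \<and> \<not> adj s D j l)) =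
    EQ (\<lambda>A. EQ (\<lambda>B. EQ (\<lambda>C. E_binomial (n - 3) A (\<lambda>c. of_bool (s \<le> card (A \<inter> B)) *
       ((of_bool (s \<le> card (B \<inter> C)) -
         of_bool (s \<le> card (A \<inter> C) \<and> s \<le> card (B \<inter> C))) * g (Suc c))))))"
    unfolding expectation_wedge[OF ij, symmetric]
    by (intro Bochner_Integration.integral_cong)
      (use ij in \<open>auto simp: adj_iff adj_def deg_remove_two Int_commute One_nat_def\<close>)
  also have "\<dots> = EQ (\<lambda>A. EQ (\<lambda>B. of_bool (s \<le> card (A \<inter> B)) * (link_prob B -
      EQ (\<lambda>C. of_bool (s \<le> card (A \<inter> C) \<and> s \<le> card (B \<inter> C))))) * E_binomial (n - 3) A (\<lambda>c. g (Suc c)))"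
    by (simp only: inner integral_mult_left_zero)
  also have "\<dots> = wedge_weight n g"
    by (simp add: wedge_weight_def triangle_prob_def path_prob_def right_diff_distrib)
  finally show ?thesis .
qed

lemma expectation_rig_pair:
  fixes f :: "_ \<Rightarrow> real"
  assumes n: "n \<ge> 2"
    and f: "\<And>i j. i \<in> {1..n} \<Longrightarrow> j \<in> {1..n} \<Longrightarrow> i \<noteq> j \<Longrightarrow>
      measure_pmf.expectation (attr_family {1..n}) (\<lambda>D. f (D, i, j)) = c"
  shows "measure_pmf.expectation (rig_pair_pmf n m P) f = c"
proof -
  let ?S = "{(i, j). i \<in> {1..n} \<and> j \<in> {1..n} \<and> i \<noteq> j}"
  have finS: "finite ?S" by (rule finite_subset[of _ "{1..n} \<times> {1..n}"]) auto
  have "(1, 2) \<in> ?S" using n by auto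
  then have neS: "?S \<noteq> {}" by blast
  note sS = set_pmf_of_set[OF neS finS]
  have "rig_pair_pmf n m P = bind_pmf (pmf_of_set ?S) (\<lambda>p. bind_pmf (attr_family {1..n}) (\<lambda>D. return_pmf (D, p)))"
    unfolding rig_pair_pmf_def pair_pmf_def Q_def by (rule bind_commute_pmf)
  then have "measure_pmf.expectation (rig_pair_pmf n m P) f =
      measure_pmf.expectation (bind_pmf (pmf_of_set ?S) (\<lambda>p. bind_pmf (attr_family {1..n}) (\<lambda>D. return_pmf (D, p)))) f"
    by (rule arg_cong)
  also have "\<dots> = measure_pmf.expectation (pmf_of_set ?S)
      (\<lambda>p. measure_pmf.expectation (bind_pmf (attr_family {1..n}) (\<lambda>D. return_pmf (D, p))) f)"
  proof (rule expectation_bind_finite)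
    show "finite (set_pmf (pmf_of_set ?S))" using finS by (simp only: sS)
  qed (simp add: finite_attr_family)
  also have "\<dots> = measure_pmf.expectation (pmf_of_set ?S) (\<lambda>p. measure_pmf.expectation (attr_family {1..n}) (\<lambda>D. f (D, p)))"
    by (subst expectation_bind_finite) (simp_all add: finite_attr_family)
  also have "\<dots> = measure_pmf.expectation (pmf_of_set ?S) (\<lambda>p. c)"
    by (rule expectation_cong_pmf) (use sS f in auto)
  finally show ?thesis by simp
qed

lemma finite_rig_pair:
  assumes n: "n \<ge> 2" shows "finite (set_pmf (rig_pair_pmf n m P))"
proof -
  let ?S = "{(i, j). i \<in> {1..n} \<and> j \<in> {1..n} \<and> i \<noteq> j}"
  have finS: "finite ?S" by (rule finite_subset[of _ "{1..n} \<times> {1..n}"]) auto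
  have "(1, 2) \<in> ?S" using n by auto
  then have neS: "?S \<noteq> {}" by blast
  show ?thesis unfolding rig_pair_pmf_def
    unfolding set_pair_pmf set_pmf_of_set[OF neS finS]
    using finite_attr_family[of "{1..n}"] finS by (intro finite_cartesian_product) (simp_all add: Q_def)
qed

lemma expectation_rig_edge:
  assumes n: "n \<ge> 2"
  shows "measure_pmf.expectation (rig_pair_pmf n m P)
    (\<lambda>(D, i, j). of_bool (adj s D i j) * g (deg s n D j)) = edge_weight n g"
  by (rule expectation_rig_pair[OF n]) (simp add: expectation_adj)

lemma expectation_rig_codeg:
  assumes n: "n \<ge> 2"
  shows "measure_pmf.expectation (rig_pair_pmf n m P)
    (\<lambda>(D, i, j). of_bool (adj s D i j) * g (deg s n D j) * real (codeg s n D i j)) =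
    (real n - 2) * triangle_weight n g"
proof (rule expectation_rig_pair[OF n])
  fix i j assume ij: "i \<in> {1..n}" "j \<in> {1..n}" "i \<noteq> j"
  let ?V = "{1..n} - {i, j}"
  have cV: "card ?V = n - 2" using ij by (subst card_Diff_subset) auto
  have codeg: "real (codeg s n D i j) = (\<Sum>l\<in>?V. of_bool (adj s D i l \<and> adj s D j l))" for D
  proof -
    have "{l \<in> {1..n}. adj s D i l \<and> adj s D j l} = {l \<in> ?V. adj s D i l \<and> adj s D j l}"
      by (auto simp: adj_def)
    then show ?thesis unfolding codeg_def by (simp add: sum_of_bool_eq Int_def)
  qed
  have "measure_pmf.expectation (attr_family {1..n})
      (\<lambda>D. of_bool (adj s D i j) * g (deg s n D j) * real (codeg s n D i j)) =
    (\<Sum>l\<in>?V. measure_pmf.expectation (attr_family {1..n})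
      (\<lambda>D. of_bool (adj s D i j) * g (deg s n D j) * of_bool (adj s D i l \<and> adj s D j l)))"
    unfolding codeg sum_distrib_left
    by (rule Bochner_Integration.integral_sum) (auto intro!: integrable_measure_pmf_finite finite_attr_family)
  also have "\<dots> = (\<Sum>l\<in>?V. triangle_weight n g)"
    by (rule sum.cong[OF refl], rule expectation_triangle) (use ij in auto)
  finally show "measure_pmf.expectation (attr_family {1..n}) (\<lambda>D. case (D, i, j) of (D, i, j) \<Rightarrow>
      of_bool (adj s D i j) * g (deg s n D j) * real (codeg s n D i j)) =
      (real n - 2) * triangle_weight n g"
    using n by (simp add: cV of_nat_diff)
qed

text \<open>
  A neighbour of \<open>v\<^sub>1\<close> is \<open>v\<^sub>2\<close> itself, a common neighbour, or a vertex that is not adjacent to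
  \<open>v\<^sub>2\<close>; the three summands correspond to these cases.
\<close>

lemma expectation_rig_deg:
  assumes n: "n \<ge> 2"
  shows "measure_pmf.expectation (rig_pair_pmf n m P)
    (\<lambda>(D, i, j). of_bool (adj s D i j) * g (deg s n D j) * real (deg s n D i)) =
    edge_weight n g + (real n - 2) * (triangle_weight n g + wedge_weight n g)"
proof (rule expectation_rig_pair[OF n])
  fix i j assume ij: "i \<in> {1..n}" "j \<in> {1..n}" "i \<noteq> j"
  let ?V = "{1..n} - {i, j}"
  let ?f = "\<lambda>D. of_bool (adj s D i j) * g (deg s n D j)"
  have cV: "card ?V = n - 2" using ij by (subst card_Diff_subset) auto
  have fin: "finite (set_pmf (attr_family {1..n}))" by (rule finite_attr_family) simp
  note [simp] = integrable_measure_pmf_finite[OF fin]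
  have deg: "?f D * real (deg s n D i) = ?f D +
     (\<Sum>l\<in>?V. ?f D * of_bool (adj s D i l \<and> adj s D j l) +
               ?f D * of_bool (adj s D i l \<and> \<not> adj s D j l))" for D
  proof (cases "adj s D i j")
    case True
    have "{l \<in> {1..n}. adj s D i l} = insert j {l \<in> ?V. adj s D i l}"
      using True ij by (auto simp: adj_def)
    then have "real (deg s n D i) = 1 + (\<Sum>l\<in>?V. of_bool (adj s D i l))"
      unfolding deg_def by (simp add: sum_of_bool_eq Int_def)
    also have "(\<Sum>l\<in>?V. of_bool (adj s D i l) :: real) =
       (\<Sum>l\<in>?V. of_bool (adj s D i l \<and> adj s D j l) + of_bool (adj s D i l \<and> \<not> adj s D j l))"
      by (rule sum.cong) auto
    finally show ?thesis by (simp add: distrib_left sum_distrib_left)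
  qed simp
  have "measure_pmf.expectation (attr_family {1..n}) (\<lambda>D. ?f D * real (deg s n D i)) =
    edge_weight n g + (\<Sum>l\<in>?V. measure_pmf.expectation (attr_family {1..n})
      (\<lambda>D. ?f D * of_bool (adj s D i l \<and> adj s D j l)) + measure_pmf.expectation (attr_family {1..n})
      (\<lambda>D. ?f D * of_bool (adj s D i l \<and> \<not> adj s D j l)))"
    unfolding deg
    by (subst Bochner_Integration.integral_add, simp, simp, subst Bochner_Integration.integral_sum, simp,
        subst Bochner_Integration.integral_add, simp, simp) (simp add: expectation_adj[OF ij])
  also have "\<dots> = edge_weight n g + (\<Sum>l\<in>?V. triangle_weight n g + wedge_weight n g)"
    by (rule arg_cong2[where f = "(+)"], simp, rule sum.cong[OF refl],
        rule arg_cong2[where f = "(+)"], rule expectation_triangle, use ij in auto)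
      (rule expectation_open_wedge, use ij in auto)
  finally show "measure_pmf.expectation (attr_family {1..n}) (\<lambda>D. case (D, i, j) of (D, i, j) \<Rightarrow>
      of_bool (adj s D i j) * g (deg s n D j) * real (deg s n D i)) =
      edge_weight n g + (real n - 2) * (triangle_weight n g + wedge_weight n g)"
    using n by (simp add: cV of_nat_diff)
qed

lemma expectation_cond_rig:
  assumes n: "n \<ge> 2" and pos: "edge_weight n g > 0"
    and S: "\<And>D i j. of_bool ((D, i, j) \<in> S) = of_bool (adj s D i j) * g (deg s n D j)"
  shows "measure_pmf.expectation (cond_pmf (rig_pair_pmf n m P) S)
      (\<lambda>(D, v1, v2). real (codeg s n D v1 v2)) =
      (real n - 2) * triangle_weight n g / edge_weight n g"
    and "measure_pmf.expectation (cond_pmf (rig_pair_pmf n m P) S)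
      (\<lambda>(D, v1, v2). real (deg s n D v1)) =
      1 + (real n - 2) * (triangle_weight n g + wedge_weight n g) / edge_weight n g"
proof -
  have S': "(\<lambda>x. of_bool (x \<in> S)) = (\<lambda>(D, i, j). of_bool (adj s D i j) * g (deg s n D j))"
    using S by auto
  have E: "measure_pmf.expectation (rig_pair_pmf n m P) (\<lambda>x. of_bool (x \<in> S)) = edge_weight n g"
    unfolding S' by (rule expectation_rig_edge[OF n])
  have ne: "set_pmf (rig_pair_pmf n m P) \<inter> S \<noteq> {}"
    by (rule expectation_pos_imp_nonempty) (simp add: E pos)
  have a: "(\<lambda>x. of_bool (x \<in> S) * (case x of (D, v1, v2) \<Rightarrow> real (codeg s n D v1 v2))) =
      (\<lambda>(D, i, j). of_bool (adj s D i j) * g (deg s n D j) * real (codeg s n D i j))"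
    using S by auto
  have b: "(\<lambda>x. of_bool (x \<in> S) * (case x of (D, v1, v2) \<Rightarrow> real (deg s n D v1))) =
      (\<lambda>(D, i, j). of_bool (adj s D i j) * g (deg s n D j) * real (deg s n D i))"
    using S by auto
  show "measure_pmf.expectation (cond_pmf (rig_pair_pmf n m P) S)
      (\<lambda>(D, v1, v2). real (codeg s n D v1 v2)) =
      (real n - 2) * triangle_weight n g / edge_weight n g"
    unfolding expectation_cond_pmf[OF finite_rig_pair[OF n] ne] a E expectation_rig_codeg[OF n] ..
  show "measure_pmf.expectation (cond_pmf (rig_pair_pmf n m P) S)
      (\<lambda>(D, v1, v2). real (deg s n D v1)) =
      1 + (real n - 2) * (triangle_weight n g + wedge_weight n g) / edge_weight n g"
    unfolding expectation_cond_pmf[OF finite_rig_pair[OF n] ne] b E expectation_rig_deg[OF n]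
    using pos by (simp add: field_simps)
qed

end

section \<open>Poisson limits and weak convergence\<close>

text \<open>
  The law of rare events along an arbitrary filter. The filter is needed because below the success
  probability depends not only on \<open>n\<close> but also on an attribute set.
\<close>

lemma binomial_tendsto_poisson:
  fixes N :: "'b \<Rightarrow> nat" and q :: "'b \<Rightarrow> real"
  assumes N: "filterlim N at_top F" and q: "\<And>x. 0 \<le> q x" "\<And>x. q x \<le> 1"
    and Nq: "((\<lambda>x. real (N x) * q x) \<longlongrightarrow> r) F"
  shows "((\<lambda>x. pmf (binomial_pmf (N x) (q x)) k) \<longlongrightarrow> r ^ k / fact k * exp (- r)) F"
proof -
  have N': "filterlim (\<lambda>x. real (N x)) at_top F"
    by (rule filterlim_compose[OF filterlim_real_sequentially N])
  have N1: "eventually (\<lambda>x. N x > k) F"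
    using N unfolding filterlim_at_top by (auto simp: Suc_le_eq dest: spec[of _ "Suc k"])
  have "((\<lambda>x. (real (N x) * q x) * inverse (real (N x))) \<longlongrightarrow> r * 0) F"
    by (intro tendsto_mult Nq tendsto_inverse_0_at_top N')
  then have "((\<lambda>x. (real (N x) * q x) * inverse (real (N x))) \<longlongrightarrow> 0) F" by simp
  then have q0: "(q \<longlongrightarrow> 0) F"
    by (rule Lim_transform_eventually) (rule eventually_mono[OF N1], auto)
  then have q1: "eventually (\<lambda>x. q x < 1) F" by (rule order_tendstoD) simp
  have "((\<lambda>x. real (N x) * ln (1 - q x)) \<longlongrightarrow> - r) F"
  proof (rule tendsto_sandwich[where f = "\<lambda>x. - (real (N x) * q x) / (1 - q x)"
        and h = "\<lambda>x. - (real (N x) * q x)"])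
    show "((\<lambda>x. - (real (N x) * q x)) \<longlongrightarrow> - r) F" by (intro tendsto_minus Nq)
    have "((\<lambda>x. - (real (N x) * q x) / (1 - q x)) \<longlongrightarrow> - r / (1 - 0)) F"
      by (intro tendsto_intros Nq q0) auto
    then show "((\<lambda>x. - (real (N x) * q x) / (1 - q x)) \<longlongrightarrow> - r) F" by simp
    show "eventually (\<lambda>x. - (real (N x) * q x) / (1 - q x) \<le> real (N x) * ln (1 - q x)) F"
      using q1
    proof eventually_elim
      case (elim x)
      have "ln (1 / (1 - q x)) \<le> 1 / (1 - q x) - 1" using elim by (intro ln_le_minus_one) simp
      then have "- (q x / (1 - q x)) \<le> ln (1 - q x)" using elim
        by (simp add: ln_div field_simps)
      then have "real (N x) * (- (q x / (1 - q x))) \<le> real (N x) * ln (1 - q x)"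
        by (rule mult_left_mono) simp
      then show ?case by simp
    qed
    show "eventually (\<lambda>x. real (N x) * ln (1 - q x) \<le> - (real (N x) * q x)) F"
      using q1
    proof eventually_elim
      case (elim x)
      have "ln (1 - q x) \<le> - q x" using ln_le_minus_one[of "1 - q x"] elim by simp
      then have "real (N x) * ln (1 - q x) \<le> real (N x) * - q x" by (rule mult_left_mono) simp
      then show ?case by simp
    qed
  qed
  then have e: "((\<lambda>x. exp (real (N x) * ln (1 - q x)) / (1 - q x) ^ k) \<longlongrightarrow> exp (- r) / (1 - 0) ^ k) F"
    by (intro tendsto_intros q0) auto
  have "((\<lambda>x. (\<Prod>i<k. real (N x) * q x - real i * q x) / fact k) \<longlongrightarrow> (\<Prod>i<k. r - real i * 0) / fact k) F"
    by (intro tendsto_intros Nq q0) auto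
  from tendsto_mult[OF this e]
  have "((\<lambda>x. (\<Prod>i<k. real (N x) * q x - real i * q x) / fact k *
      (exp (real (N x) * ln (1 - q x)) / (1 - q x) ^ k)) \<longlongrightarrow> r ^ k / fact k * exp (- r)) F"
    by simp
  moreover have "eventually (\<lambda>x. (\<Prod>i<k. real (N x) * q x - real i * q x) / fact k *
      (exp (real (N x) * ln (1 - q x)) / (1 - q x) ^ k) = pmf (binomial_pmf (N x) (q x)) k) F"
    using q1 N1
  proof eventually_elim
    case (elim x)
    have "(1 - q x) ^ N x = (1 - q x) ^ (N x - k) * (1 - q x) ^ k"
      using elim by (simp flip: power_add)
    moreover have "exp (real (N x) * ln (1 - q x)) = (1 - q x) ^ N x"
      using elim by (simp add: exp_of_nat_mult)
    ultimately have e: "exp (real (N x) * ln (1 - q x)) / (1 - q x) ^ k = (1 - q x) ^ (N x - k)"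
      using elim by simp
    have "real (N x choose k) = (\<Prod>i<k. real (N x) - real i) / fact k"
      by (simp add: binomial_gbinomial gbinomial_prod_rev atLeast0LessThan)
    then have "real (N x choose k) * q x ^ k = (\<Prod>i<k. real (N x) - real i) * (\<Prod>i<k. q x) / fact k"
      by simp
    also have "\<dots> = (\<Prod>i<k. (real (N x) - real i) * q x) / fact k"
      by (simp only: prod.distrib)
    also have "\<dots> = (\<Prod>i<k. real (N x) * q x - real i * q x) / fact k"
      by (simp only: left_diff_distrib)
    finally show ?case unfolding e using q by simp
  qed
  ultimately show ?thesis by (rule Lim_transform_eventually)
qed

lemma poisson_density_le_1:
  assumes "(r::real) \<ge> 0" shows "r ^ k / fact k * exp (- r) \<le> 1"
proof -
  have "(\<Sum>i\<in>{k}. r ^ i /\<^sub>R fact i) \<le> exp r"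
    using sum_le_suminf[OF sums_summable[OF exp_converges], of "{k}" r] assms exp_converges[of r]
    by (auto simp: sums_iff)
  then have "r ^ k / fact k \<le> exp r" by (simp add: field_simps)
  then have "r ^ k / fact k * exp (- r) \<le> exp r * exp (- r)" by (rule mult_right_mono) simp
  then show ?thesis by (simp flip: exp_add)
qed

lemma poisson_moment_sums:
  fixes r :: real
  shows "(\<lambda>j. r ^ j * exp (- r) / fact j * real j) sums r"
    and "(\<lambda>j. r ^ j * exp (- r) / fact j * (real j * (real j - 1))) sums r\<^sup>2"
proof -
  have e: "(\<lambda>j. r ^ j / fact j) sums exp r"
    using exp_converges[of r] by (simp add: field_simps)
  have "(\<lambda>j. r * exp (- r) * (r ^ j / fact j)) sums (r * exp (- r) * exp r)"
    by (rule sums_mult[OF e])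
  also have "(\<lambda>j. r * exp (- r) * (r ^ j / fact j)) =
      (\<lambda>j. r ^ Suc j * exp (- r) / fact (Suc j) * real (Suc j))"
    by (rule ext, simp only: fact_Suc of_nat_mult power_Suc) (simp add: divide_simps del: of_nat_Suc)
  finally have "(\<lambda>j. r ^ j * exp (- r) / fact j * real j) sums (r * exp (- r) * exp r + 0)"
    by (subst (asm) sums_Suc_iff) simp
  then show 1: "(\<lambda>j. r ^ j * exp (- r) / fact j * real j) sums r"
    by (simp add: mult.assoc flip: exp_add)
  have "(\<lambda>j. r * (r ^ j * exp (- r) / fact j * real j)) sums (r * r)"
    by (rule sums_mult[OF 1])
  also have "(\<lambda>j. r * (r ^ j * exp (- r) / fact j * real j)) =
      (\<lambda>j. r ^ Suc j * exp (- r) / fact (Suc j) * (real (Suc j) * (real (Suc j) - 1)))"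
  proof
    fix j
    have "real (Suc j) - 1 = real j" by simp
    then show "r * (r ^ j * exp (- r) / fact j * real j) =
        r ^ Suc j * exp (- r) / fact (Suc j) * (real (Suc j) * (real (Suc j) - 1))"
      by (simp only: fact_Suc of_nat_mult power_Suc) (simp add: divide_simps del: of_nat_Suc)
  qed
  finally have "(\<lambda>j. r ^ j * exp (- r) / fact j * (real j * (real j - 1))) sums (r * r + 0)"
    by (subst (asm) sums_Suc_iff) simp
  then show "(\<lambda>j. r ^ j * exp (- r) / fact j * (real j * (real j - 1))) sums r\<^sup>2"
    by (simp add: power2_eq_square)
qed

text \<open>
  A form of the definition of convergence suited to truncation arguments, where the error is a sum of
  parts that are only known to be small with respect to a given tolerance.
\<close>

lemma tendsto_of_approximation:
  fixes f :: "nat \<Rightarrow> real"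
  assumes "\<And>e. e > 0 \<Longrightarrow> eventually (\<lambda>n. \<bar>f n - L\<bar> \<le> e) sequentially"
  shows "f \<longlonglongrightarrow> L"
proof (rule tendstoI)
  fix e :: real assume "e > 0"
  then have "eventually (\<lambda>n. \<bar>f n - L\<bar> \<le> e / 2) sequentially" by (intro assms) simp
  then show "eventually (\<lambda>n. dist (f n) L < e) sequentially"
    by eventually_elim (use \<open>e > 0\<close> in \<open>auto simp: dist_real_def\<close>)
qed

text \<open>
  Weak convergence of \<open>W n\<close> to \<open>Z\<close> together with convergence of second moments. The second condition
  makes the squares uniformly integrable, and therefore allows test functions of linear growth.
\<close>

locale weak_conv_second_moment =
  prob_space M for M :: "'a measure" and Z :: "'a \<Rightarrow> real" and P :: "nat \<Rightarrow> 'b pmf" and W :: "nat \<Rightarrow> 'b \<Rightarrow> real" +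
  assumes Z [measurable]: "Z \<in> borel_measurable M"
    and finite_support: "\<And>n. n \<ge> 1 \<Longrightarrow> finite (set_pmf (P n))"
    and conv: "weak_conv_m (\<lambda>n. distr (measure_pmf (P n)) borel (W n)) (distr M borel Z)"
    and Z2_int: "integrable M (\<lambda>\<omega>. (Z \<omega>)\<^sup>2)"
    and W2_lim: "(\<lambda>n. measure_pmf.expectation (P n) (\<lambda>x. (W n x)\<^sup>2))
                   \<longlonglongrightarrow> integral\<^sup>L M (\<lambda>\<omega>. (Z \<omega>)\<^sup>2)"
begin

lemma bounded_continuous_limit:
  fixes f :: "real \<Rightarrow> real"
  assumes cont: "continuous_on UNIV f" and bd: "\<And>x. \<bar>f x\<bar> \<le> B"
  shows "(\<lambda>n. measure_pmf.expectation (P n) (\<lambda>x. f (W n x))) \<longlonglongrightarrow> integral\<^sup>L M (\<lambda>\<omega>. f (Z \<omega>))"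
proof -
  have [measurable]: "f \<in> borel_measurable borel" using cont by (rule borel_measurable_continuous_onI)
  have "(\<lambda>n. integral\<^sup>L (distr (measure_pmf (P n)) borel (W n)) f) \<longlonglongrightarrow> integral\<^sup>L (distr M borel Z) f"
  proof (rule weak_conv_imp_integral_bdd_continuous_conv[OF _ _ conv])
    show "real_distribution (distr (measure_pmf (P n)) borel (W n))" for n
      by (intro prob_space.real_distribution_distr) (auto intro: measure_pmf.prob_space_axioms)
    show "real_distribution (distr M borel Z)" by (intro real_distribution_distr) simp
    show "isCont f x" for x using cont by (simp add: continuous_on_eq_continuous_at)
    show "norm (f x) \<le> B" for x using bd by simp
  qed
  then show ?thesis by (simp add: integral_distr)
qed

lemma integrable_P: "n \<ge> 1 \<Longrightarrow> integrable (measure_pmf (P n)) (f :: 'b \<Rightarrow> real)"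
  by (rule integrable_measure_pmf_finite[OF finite_support])

lemma integrable_linear_growth:
  fixes f :: "real \<Rightarrow> real"
  assumes cont: "continuous_on UNIV f" and bd: "\<And>x. \<bar>f x\<bar> \<le> C * \<bar>x\<bar>"
  shows "integrable M (\<lambda>\<omega>. f (Z \<omega>))"
proof (rule Bochner_Integration.integrable_bound)
  have [measurable]: "f \<in> borel_measurable borel" using cont by (rule borel_measurable_continuous_onI)
  show "(\<lambda>\<omega>. f (Z \<omega>)) \<in> borel_measurable M" by simp
  have C0: "C \<ge> 0" using bd[of 1] by simp
  show "integrable M (\<lambda>\<omega>. C * (1 + (Z \<omega>)\<^sup>2))" using Z2_int by simp
  have "\<bar>f z\<bar> \<le> C * (1 + z\<^sup>2)" for z
  proof -
    have "0 \<le> (\<bar>z\<bar> - 1)\<^sup>2" by simp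
    then have "2 * \<bar>z\<bar> \<le> 1 + z\<^sup>2" by (simp add: power2_diff)
    then have "\<bar>z\<bar> \<le> 1 + z\<^sup>2" by linarith
    then show ?thesis using bd[of z] C0 by (meson mult_left_mono order_trans)
  qed
  then show "AE \<omega> in M. norm (f (Z \<omega>)) \<le> norm (C * (1 + (Z \<omega>)\<^sup>2))"
    using C0 by (intro AE_I2) (auto simp: abs_mult intro: order_trans)
qed

text \<open>
  Clamping the argument to \<open>[-K, K]\<close> makes the test function bounded; the error is at most
  \<open>2 C |z| \<le> (2 C / K) z\<^sup>2\<close> and only occurs where \<open>|z| > K\<close>, so bounded second moments control it.
\<close>

lemma linear_growth_limit:
  fixes f :: "real \<Rightarrow> real"
  assumes cont: "continuous_on UNIV f" and bd: "\<And>x. \<bar>f x\<bar> \<le> C * \<bar>x\<bar>"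
  shows "(\<lambda>n. measure_pmf.expectation (P n) (\<lambda>x. f (W n x))) \<longlonglongrightarrow> integral\<^sup>L M (\<lambda>\<omega>. f (Z \<omega>))"
proof (rule tendsto_of_approximation)
  fix e :: real assume e: "e > 0"
  have C0: "C \<ge> 0" using bd[of 1] by simp
  let ?z2 = "integral\<^sup>L M (\<lambda>\<omega>. (Z \<omega>)\<^sup>2)"
  have z2: "?z2 \<ge> 0" by (intro Bochner_Integration.integral_nonneg) simp
  (* Chosen such that the truncation error (2 C / K) E W\<^sup>2 is at most e / 3, as E W\<^sup>2 < ?z2 + 1
     eventually. *)
  define K where "K = (2 * C * (?z2 + 1)) * 3 / e + 1"
  have K0: "K \<ge> 1" unfolding K_def using C0 z2 e by simp
  have Ke: "2 * C / K * (?z2 + 1) \<le> e / 3"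
  proof -
    have "2 * C * (?z2 + 1) * 3 \<le> K * e" unfolding K_def using e by (simp add: field_simps)
    then show ?thesis using K0 by (simp add: field_simps)
  qed
  define cl where "cl z = max (- K) (min K z)" for z :: real
  have diff: "\<bar>f z - f (cl z)\<bar> \<le> 2 * C / K * z\<^sup>2" for z
  proof (cases "\<bar>z\<bar> \<le> K")
    case True
    then have "cl z = z" by (auto simp: cl_def)
    then show ?thesis using C0 K0 by simp
  next
    case False
    have "\<bar>cl z\<bar> \<le> \<bar>z\<bar>" using False K0 by (auto simp: cl_def)
    then have "\<bar>f (cl z)\<bar> \<le> C * \<bar>z\<bar>" using bd[of "cl z"] C0 by (meson mult_left_mono order_trans)
    then have "\<bar>f z - f (cl z)\<bar> \<le> 2 * C * \<bar>z\<bar>" using bd[of z] by simp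
    also have "\<dots> \<le> 2 * C * (\<bar>z\<bar> * \<bar>z\<bar> / K)"
    proof (intro mult_left_mono)
      have "\<bar>z\<bar> * K \<le> \<bar>z\<bar> * \<bar>z\<bar>" using False by (intro mult_left_mono) auto
      then show "\<bar>z\<bar> \<le> \<bar>z\<bar> * \<bar>z\<bar> / K" using K0 by (simp add: pos_le_divide_eq)
    qed (use C0 in simp)
    finally show ?thesis by (simp add: power2_eq_square)
  qed
  have cont_cl: "continuous_on UNIV (\<lambda>z. f (cl z))"
    unfolding cl_def by (rule continuous_on_compose2[OF cont]) (auto intro!: continuous_intros)
  have bd_cl: "\<bar>f (cl z)\<bar> \<le> C * K" for z
  proof -
    have "\<bar>cl z\<bar> \<le> K" using K0 by (auto simp: cl_def)
    then show ?thesis using bd[of "cl z"] C0 by (meson mult_left_mono order_trans)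
  qed
  have [measurable]: "f \<in> borel_measurable borel" "(\<lambda>z. f (cl z)) \<in> borel_measurable borel"
    using cont cont_cl by (auto intro: borel_measurable_continuous_onI)
  have int_f: "integrable M (\<lambda>\<omega>. f (Z \<omega>))" by (rule integrable_linear_growth[OF cont bd])
  have int_cl: "integrable M (\<lambda>\<omega>. f (cl (Z \<omega>)))"
    by (rule integrable_const_bound[where B = "C * K"]) (use bd_cl in auto)
  have M_close: "\<bar>integral\<^sup>L M (\<lambda>\<omega>. f (Z \<omega>)) - integral\<^sup>L M (\<lambda>\<omega>. f (cl (Z \<omega>)))\<bar> \<le> e / 3"
  proof -
    have "\<bar>integral\<^sup>L M (\<lambda>\<omega>. f (Z \<omega>)) - integral\<^sup>L M (\<lambda>\<omega>. f (cl (Z \<omega>)))\<bar> =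
        \<bar>integral\<^sup>L M (\<lambda>\<omega>. f (Z \<omega>) - f (cl (Z \<omega>)))\<bar>"
      using int_f int_cl by simp
    also have "\<dots> \<le> integral\<^sup>L M (\<lambda>\<omega>. 2 * C / K * (Z \<omega>)\<^sup>2)"
      using int_f int_cl Z2_int diff
      by (intro order_trans[OF integral_abs_bound] Bochner_Integration.integral_mono) auto
    also have "\<dots> = 2 * C / K * ?z2" by simp
    also have "\<dots> \<le> 2 * C / K * (?z2 + 1)" using C0 K0 by (intro mult_left_mono) auto
    finally show ?thesis using Ke by linarith
  qed
  have "eventually (\<lambda>n. measure_pmf.expectation (P n) (\<lambda>x. (W n x)\<^sup>2) < ?z2 + 1) sequentially"
    by (rule order_tendstoD[OF W2_lim]) simp
  moreover have "eventually (\<lambda>n. \<bar>measure_pmf.expectation (P n) (\<lambda>x. f (cl (W n x))) -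
      integral\<^sup>L M (\<lambda>\<omega>. f (cl (Z \<omega>)))\<bar> < e / 3) sequentially"
    using tendstoD[OF bounded_continuous_limit[OF cont_cl bd_cl], of "e / 3"] e
    by (simp add: dist_real_def)
  moreover have "eventually (\<lambda>n. n \<ge> 1) sequentially" by (rule eventually_ge_at_top)
  ultimately show "eventually (\<lambda>n. \<bar>measure_pmf.expectation (P n) (\<lambda>x. f (W n x)) -
      integral\<^sup>L M (\<lambda>\<omega>. f (Z \<omega>))\<bar> \<le> e) sequentially"
  proof eventually_elim
    case (elim n)
    note [simp] = integrable_P[OF elim(3)]
    have "\<bar>measure_pmf.expectation (P n) (\<lambda>x. f (W n x)) - measure_pmf.expectation (P n) (\<lambda>x. f (cl (W n x)))\<bar> =
        \<bar>measure_pmf.expectation (P n) (\<lambda>x. f (W n x) - f (cl (W n x)))\<bar>" by simp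
    also have "\<dots> \<le> measure_pmf.expectation (P n) (\<lambda>x. 2 * C / K * (W n x)\<^sup>2)"
      using diff by (intro order_trans[OF integral_abs_bound] Bochner_Integration.integral_mono) auto
    also have "\<dots> = 2 * C / K * measure_pmf.expectation (P n) (\<lambda>x. (W n x)\<^sup>2)" by simp
    also have "\<dots> \<le> 2 * C / K * (?z2 + 1)"
      using elim(1) C0 K0 by (intro mult_left_mono) auto
    finally show ?case using Ke elim(2) M_close by linarith
  qed
qed

text \<open>
  Uniform integrability of the squares: \<open>min z\<^sup>2 K\<close> is a bounded continuous test function, so the
  mean excess of \<open>W\<^sup>2\<close> over \<open>K\<close> converges to that of \<open>Z\<^sup>2\<close>, which is small for large \<open>K\<close>.
\<close>

lemma second_moment_tail:
  assumes e: "e > 0"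
  obtains K where "K > 0" "eventually (\<lambda>n. measure_pmf.expectation (P n)
    (\<lambda>x. (W n x)\<^sup>2 * of_bool ((W n x)\<^sup>2 \<ge> K)) \<le> e) sequentially"
proof -
  have "(\<lambda>j. integral\<^sup>L M (\<lambda>\<omega>. min ((Z \<omega>)\<^sup>2) (real j))) \<longlonglongrightarrow> integral\<^sup>L M (\<lambda>\<omega>. (Z \<omega>)\<^sup>2)"
  proof (rule integral_dominated_convergence[OF _ _ Z2_int])
    show "AE \<omega> in M. (\<lambda>j. min ((Z \<omega>)\<^sup>2) (real j)) \<longlonglongrightarrow> (Z \<omega>)\<^sup>2"
    proof (rule AE_I2)
      fix \<omega>
      have "eventually (\<lambda>j. min ((Z \<omega>)\<^sup>2) (real j) = (Z \<omega>)\<^sup>2) sequentially"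
        using eventually_ge_at_top[of "nat \<lceil>(Z \<omega>)\<^sup>2\<rceil>"] by eventually_elim linarith
      then show "(\<lambda>j. min ((Z \<omega>)\<^sup>2) (real j)) \<longlonglongrightarrow> (Z \<omega>)\<^sup>2" by (rule tendsto_eventually)
    qed
  qed auto
  then have "eventually (\<lambda>j. integral\<^sup>L M (\<lambda>\<omega>. min ((Z \<omega>)\<^sup>2) (real j)) > integral\<^sup>L M (\<lambda>\<omega>. (Z \<omega>)\<^sup>2) - e / 4) sequentially"
    by (rule order_tendstoD) (use e in simp)
  then obtain j where j: "integral\<^sup>L M (\<lambda>\<omega>. min ((Z \<omega>)\<^sup>2) (real j)) > integral\<^sup>L M (\<lambda>\<omega>. (Z \<omega>)\<^sup>2) - e / 4" "j \<ge> 1"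
    using eventually_conj[OF _ eventually_ge_at_top[of 1]] by (metis (no_types, lifting) eventually_sequentially order.refl)
  let ?K = "real j"
  have "(\<lambda>n. measure_pmf.expectation (P n) (\<lambda>x. min ((W n x)\<^sup>2) ?K)) \<longlonglongrightarrow> integral\<^sup>L M (\<lambda>\<omega>. min ((Z \<omega>)\<^sup>2) ?K)"
    by (rule bounded_continuous_limit[where B = ?K and f = "\<lambda>z. min (z\<^sup>2) ?K"])
      (auto intro!: continuous_intros)
  from order_tendstoD(1)[OF this j(1)]
  have "eventually (\<lambda>n. measure_pmf.expectation (P n) (\<lambda>x. min ((W n x)\<^sup>2) ?K) > integral\<^sup>L M (\<lambda>\<omega>. (Z \<omega>)\<^sup>2) - e / 4) sequentially" .
  moreover have "eventually (\<lambda>n. measure_pmf.expectation (P n) (\<lambda>x. (W n x)\<^sup>2) < integral\<^sup>L M (\<lambda>\<omega>. (Z \<omega>)\<^sup>2) + e / 4) sequentially"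
    by (rule order_tendstoD[OF W2_lim]) (use e in simp)
  moreover have "eventually (\<lambda>n. n \<ge> 1) sequentially" by (rule eventually_ge_at_top)
  ultimately have "eventually (\<lambda>n. measure_pmf.expectation (P n)
    (\<lambda>x. (W n x)\<^sup>2 * of_bool ((W n x)\<^sup>2 \<ge> 2 * ?K)) \<le> e) sequentially"
    (* Above 2 K the excess of the square over K is at least half of the square. *)
  proof eventually_elim
    case (elim n)
    note [simp] = integrable_P[OF elim(3)]
    have "measure_pmf.expectation (P n) (\<lambda>x. (W n x)\<^sup>2 * of_bool ((W n x)\<^sup>2 \<ge> 2 * ?K)) \<le>
        measure_pmf.expectation (P n) (\<lambda>x. 2 * ((W n x)\<^sup>2 - min ((W n x)\<^sup>2) ?K))"
      by (intro Bochner_Integration.integral_mono) auto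
    also have "\<dots> = 2 * (measure_pmf.expectation (P n) (\<lambda>x. (W n x)\<^sup>2) -
        measure_pmf.expectation (P n) (\<lambda>x. min ((W n x)\<^sup>2) ?K))" by simp
    also have "\<dots> \<le> 2 * ((integral\<^sup>L M (\<lambda>\<omega>. (Z \<omega>)\<^sup>2) + e / 4) - (integral\<^sup>L M (\<lambda>\<omega>. (Z \<omega>)\<^sup>2) - e / 4))"
      using elim(1,2) by (intro mult_left_mono diff_mono) auto
    finally show ?case by simp
  qed
  then show ?thesis using that[of "2 * ?K"] j by auto
qed

lemma nonneg_limit:
  assumes "\<And>n x. W n x \<ge> 0"
  shows "AE \<omega> in M. Z \<omega> \<ge> 0"
proof -
  let ?f = "\<lambda>z::real. min 1 (max 0 (- z))"
  have "(\<lambda>n. measure_pmf.expectation (P n) (\<lambda>x. ?f (W n x))) \<longlonglongrightarrow> integral\<^sup>L M (\<lambda>\<omega>. ?f (Z \<omega>))"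
    by (rule bounded_continuous_limit[where B = 1]) (auto intro!: continuous_intros)
  moreover have "?f (W n x) = 0" for n x using assms[of n x] by simp
  ultimately have "(\<lambda>n. 0 :: real) \<longlonglongrightarrow> integral\<^sup>L M (\<lambda>\<omega>. ?f (Z \<omega>))" by simp
  then have "integral\<^sup>L M (\<lambda>\<omega>. ?f (Z \<omega>)) = 0" using LIMSEQ_unique tendsto_const by blast
  moreover have "integrable M (\<lambda>\<omega>. ?f (Z \<omega>))"
    by (rule integrable_const_bound[where B = 1]) auto
  ultimately have "AE \<omega> in M. ?f (Z \<omega>) = 0"
    by (subst (asm) integral_nonneg_eq_0_iff_AE) auto
  then show ?thesis by eventually_elim (auto simp: min_def max_def split: if_splits)
qed

end

section \<open>Limits of the link, path and triangle probabilities\<close>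

text \<open>
  Makes \<open>x choose s\<close> tend to infinity with \<open>x\<close>, so that bounds on the size of an attribute set and
  bounds on the number of its \<open>s\<close>-subsets can be exchanged.
\<close>

lemma binomial_ge_linear:
  assumes "s \<ge> 1" shows "real x - real s + 1 \<le> real (x choose s)"
proof (induction x)
  case 0
  then show ?case using assms by (cases s) auto
next
  case (Suc x)
  obtain t where t: "s = Suc t" using assms by (cases s) auto
  show ?case
  proof (cases "t \<le> x")
    case True
    then have "1 \<le> x choose t" by (simp add: Suc_le_eq)
    then have "1 \<le> real (x choose t)" by simp
    then show ?thesis using Suc.IH by (simp add: t)
  qed (simp add: t)
qed

locale rig_limit = prob_space M
  for M :: "'a measure" and Z :: "'a \<Rightarrow> real" and s :: nat and m :: "nat \<Rightarrow> nat"
    and P :: "nat \<Rightarrow> nat pmf" and \<beta> :: real +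
  assumes s: "s \<ge> 1"
    and supp: "\<And>n. n \<ge> 1 \<Longrightarrow> set_pmf (P n) \<subseteq> {0..m n}"
    and m: "filterlim m at_top sequentially"
    and Z_meas: "Z \<in> borel_measurable M"
    and Z_conv: "weak_conv_m (\<lambda>n. distr (measure_pmf (P n)) borel (Z_scaled s n (m n))) (distr M borel Z)"
    and Z2_integrable: "integrable M (\<lambda>\<omega>. (Z \<omega>)\<^sup>2)"
    and Z2_lim: "(\<lambda>n. measure_pmf.expectation (P n) (\<lambda>x. (Z_scaled s n (m n) x)\<^sup>2))
                   \<longlonglongrightarrow> integral\<^sup>L M (\<lambda>\<omega>. (Z \<omega>)\<^sup>2)"
    and beta: "0 < \<beta>" "(\<lambda>n. real (m n choose s) / real n) \<longlonglongrightarrow> \<beta>"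
begin

sublocale weak_conv_second_moment M Z P "\<lambda>n. Z_scaled s n (m n)"
proof
  show "finite (set_pmf (P n))" if "n \<ge> 1" for n using supp[OF that] finite_subset by blast
qed (use Z_meas Z_conv Z2_integrable Z2_lim in auto)

lemma attr_set_model: "n \<ge> 1 \<Longrightarrow> random_attr_set (m n) (P n)"
  using supp by unfold_locales auto

abbreviation "Y x \<equiv> real (x choose s)"
abbreviation "N n \<equiv> real (m n choose s)"
abbreviation "W n \<equiv> Z_scaled s n (m n)"
abbreviation "EPn n \<equiv> measure_pmf.expectation (P n)"
abbreviation "EQn n \<equiv> measure_pmf.expectation (random_attr_set.Q (m n) (P n))"
abbreviation "linkp n \<equiv> random_attr_set.link_prob s (m n) (P n)"
abbreviation "trianglep n \<equiv> random_attr_set.triangle_prob s (m n) (P n)"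
abbreviation "pathp n \<equiv> random_attr_set.path_prob s (m n) (P n)"
abbreviation "momn n \<equiv> random_attr_set.mom s (P n)"
abbreviation "truncn n \<equiv> random_attr_set.trunc_mom s (P n)"

definition z1 :: real where "z1 = integral\<^sup>L M Z"
definition z2 :: real where "z2 = integral\<^sup>L M (\<lambda>\<omega>. (Z \<omega>)\<^sup>2)"
definition \<alpha>1 :: real where "\<alpha>1 = sqrt \<beta> * z1"
definition \<alpha>2 :: real where "\<alpha>2 = \<beta> * z2"
text \<open>
  The limit of the expected degree of a vertex with \<open>x\<close> attributes, the parameter of the limiting
  Poisson degree.
\<close>

definition rate :: "nat \<Rightarrow> real" where "rate x = Y x * \<alpha>1 / \<beta>"

lemma ev_m: "eventually (\<lambda>n. m n \<ge> c) sequentially"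
  using m by (simp add: filterlim_at_top)

lemma ev_ge: "eventually (\<lambda>n::nat. n \<ge> c) sequentially"
  by (rule eventually_ge_at_top)

lemma ratio: "(\<lambda>n. real n / N n) \<longlonglongrightarrow> 1 / \<beta>"
  using tendsto_divide[OF tendsto_const[of 1] beta(2)] beta(1) by simp

lemma Z_nonneg: "AE \<omega> in M. Z \<omega> \<ge> 0"
  by (rule nonneg_limit) (simp add: Z_scaled_def)

lemma Z_integrable: "integrable M Z"
  using integrable_linear_growth[of "\<lambda>z. z" 1] by simp

lemma z1_nonneg: "z1 \<ge> 0"
  unfolding z1_def by (rule integral_nonneg_AE[OF Z_nonneg])

lemma Z_scaled_eq: "Z_scaled s n (m n) x = sqrt (real n / N n) * Y x"
proof -
  have "N n powr (-1/2) = 1 / sqrt (N n)"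
    by (simp add: powr_minus_divide powr_half_sqrt)
  then show ?thesis
    by (simp add: Z_scaled_def powr_half_sqrt real_sqrt_divide)
qed

lemma mom_1_limit: "(\<lambda>n. momn n 1) \<longlonglongrightarrow> \<alpha>1"
proof (rule Lim_transform_eventually)
  have "(\<lambda>n. EPn n (\<lambda>x. W n x)) \<longlonglongrightarrow> z1"
    unfolding z1_def using linear_growth_limit[of "\<lambda>z. z" 1] by simp
  then show "(\<lambda>n. sqrt (N n / real n) * EPn n (\<lambda>x. W n x)) \<longlonglongrightarrow> \<alpha>1"
    unfolding \<alpha>1_def by (intro tendsto_intros beta)
  show "eventually (\<lambda>n. sqrt (N n / real n) * EPn n (\<lambda>x. W n x) = momn n 1) sequentially"
    using ev_m[of s] ev_ge[of 1]
  proof eventually_elim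
    case (elim n)
    interpret R: random_attr_set s "m n" "P n" by (rule attr_set_model[OF elim(2)])
    have "sqrt (N n / real n) * sqrt (real n / N n) = 1"
      using elim by (simp flip: real_sqrt_mult)
    then show ?case
      by (simp add: Z_scaled_eq R.mom_def flip: mult.assoc)
  qed
qed

lemma mom_2_limit: "(\<lambda>n. momn n 2) \<longlonglongrightarrow> \<alpha>2"
proof (rule Lim_transform_eventually)
  show "(\<lambda>n. (N n / real n) * EPn n (\<lambda>x. (W n x)\<^sup>2)) \<longlonglongrightarrow> \<alpha>2"
    unfolding \<alpha>2_def z2_def by (intro tendsto_intros beta Z2_lim)
  show "eventually (\<lambda>n. (N n / real n) * EPn n (\<lambda>x. (W n x)\<^sup>2) = momn n 2) sequentially"
    using ev_m[of s] ev_ge[of 1]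
  proof eventually_elim
    case (elim n)
    interpret R: random_attr_set s "m n" "P n" by (rule attr_set_model[OF elim(2)])
    show ?case using elim
      by (simp add: Z_scaled_eq R.mom_def power_mult_distrib)
  qed
qed

text \<open>
  Sizes are truncated at a level tending to infinity so slowly that its power \<open>s + 2\<close>, which occurs
  in the error term of the triangle probability, is still negligible against \<open>m\<close>. A level depending on
  \<open>n\<close> turns the double limit (first \<open>n\<close>, then the truncation level) into a single one.
\<close>

definition cutoff :: "nat \<Rightarrow> nat" where "cutoff n = nat \<lfloor>root (s + 3) (real (m n))\<rfloor>"

lemma cutoff_at_top: "filterlim cutoff at_top sequentially"
  unfolding filterlim_at_top
proof
  fix c
  show "eventually (\<lambda>n. c \<le> cutoff n) sequentially"
    using ev_m[of "c ^ (s + 3)"]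
  proof eventually_elim
    case (elim n)
    then have "real c ^ (s + 3) \<le> real (m n)" by (metis of_nat_le_iff of_nat_power)
    then have "root (s + 3) (real c ^ (s + 3)) \<le> root (s + 3) (real (m n))"
      by (intro real_root_le_mono) auto
    then have "real c \<le> root (s + 3) (real (m n))" by (simp add: real_root_power_cancel)
    then show ?case unfolding cutoff_def by (simp add: le_nat_iff le_floor_iff)
  qed
qed

lemma ev_cutoff: "eventually (\<lambda>n. cutoff n \<ge> c) sequentially"
  using cutoff_at_top by (simp add: filterlim_at_top)

lemma cutoff_power: "real (cutoff n) ^ (s + 3) \<le> real (m n)"
proof -
  have r0: "root (s + 3) (real (m n)) \<ge> 0" by simp
  then have "real (cutoff n) \<le> root (s + 3) (real (m n))" unfolding cutoff_def by linarith
  then have "real (cutoff n) ^ (s + 3) \<le> root (s + 3) (real (m n)) ^ (s + 3)"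
    by (intro power_mono) auto
  also have "\<dots> = real (m n)" by (simp add: real_root_pow_pos2)
  finally show ?thesis .
qed

lemma cutoff_negligible: "(\<lambda>n. real (cutoff n) ^ (s + 2) / (real (m n) - real s)) \<longlonglongrightarrow> 0"
proof (rule tendsto_sandwich[OF _ _ tendsto_const])
  have "(\<lambda>n. inverse (real (cutoff n))) \<longlonglongrightarrow> 0"
    by (intro tendsto_inverse_0_at_top filterlim_compose[OF filterlim_real_sequentially cutoff_at_top])
  from tendsto_mult[OF tendsto_const[of 2] this] show "(\<lambda>n. 2 * inverse (real (cutoff n))) \<longlonglongrightarrow> 0" by simp
  show "eventually (\<lambda>n. 0 \<le> real (cutoff n) ^ (s + 2) / (real (m n) - real s)) sequentially"
    using ev_m[of s] by eventually_elim auto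
  show "eventually (\<lambda>n. real (cutoff n) ^ (s + 2) / (real (m n) - real s) \<le> 2 * inverse (real (cutoff n))) sequentially"
    using ev_m[of "2 * s"] ev_m[of "Suc s"] ev_cutoff[of 1]
  proof eventually_elim
    case (elim n)
    have "real (cutoff n) * real (cutoff n) ^ (s + 2) \<le> 2 * (real (m n) - real s)"
      using cutoff_power[of n] elim by (simp add: eval_nat_numeral)
    then show ?case using elim by (simp add: field_simps)
  qed
qed

text \<open>
  The multiplicative error of the lower bounds at the truncation level.
\<close>

definition \<theta> :: "nat \<Rightarrow> real" where "\<theta> n = 1 - real (cutoff n) ^ 2 / (real (m n) - real s)"

lemma \<theta>_limit: "\<theta> \<longlonglongrightarrow> 1"
proof -
  have "(\<lambda>n. real (cutoff n) ^ 2 / (real (m n) - real s)) \<longlonglongrightarrow> 0"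
  proof (rule tendsto_sandwich[OF _ _ tendsto_const cutoff_negligible])
    show "eventually (\<lambda>n. 0 \<le> real (cutoff n) ^ 2 / (real (m n) - real s)) sequentially"
      using ev_m[of s] by eventually_elim auto
    show "eventually (\<lambda>n. real (cutoff n) ^ 2 / (real (m n) - real s) \<le>
        real (cutoff n) ^ (s + 2) / (real (m n) - real s)) sequentially"
      using ev_m[of s] ev_cutoff[of 1]
    proof eventually_elim
      case (elim n)
      have "real (cutoff n) ^ 2 \<le> real (cutoff n) ^ (s + 2)"
        by (rule power_increasing) (use elim in auto)
      then show ?case using elim by (intro divide_right_mono) auto
    qed
  qed
  from tendsto_diff[OF tendsto_const[of 1] this] show ?thesis unfolding \<theta>_def by simp
qed

text \<open>
  The second moment of \<open>Y\<close> does not lose mass at infinity: above the truncation level \<open>W\<^sup>2\<close> exceeds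
  any constant \<open>K\<close>, so the uniform integrability of \<open>W\<^sup>2\<close> applies.
\<close>

lemma tail_2_limit: "(\<lambda>n. momn n 2 - truncn n (cutoff n) 2) \<longlonglongrightarrow> 0"
proof (rule tendsto_of_approximation)
  fix e :: real assume e: "e > 0"
  define e' where "e' = e / (\<beta> + 1)"
  have e': "e' > 0" using e beta by (simp add: e'_def)
  obtain K where K: "K > 0" "eventually (\<lambda>n. EPn n (\<lambda>x. (W n x)\<^sup>2 * of_bool ((W n x)\<^sup>2 \<ge> K)) \<le> e') sequentially"
    by (rule second_moment_tail[OF e'])
  obtain c where c: "real c \<ge> K * (\<beta> + 1)" by (meson real_arch_simple)
  have "eventually (\<lambda>n. N n / real n < \<beta> + 1) sequentially" by (rule order_tendstoD[OF beta(2)]) simp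
  with K(2) show "eventually (\<lambda>n. \<bar>momn n 2 - truncn n (cutoff n) 2 - 0\<bar> \<le> e) sequentially"
    using ev_m[of s] ev_ge[of 1] ev_cutoff[of "s + c + 1"]
  proof eventually_elim
    case (elim n)
    interpret R: random_attr_set s "m n" "P n" by (rule attr_set_model[OF elim(4)])
    have pos: "N n > 0" "real n > 0" using elim by auto
    have "momn n 2 - truncn n (cutoff n) 2 = EPn n (\<lambda>x. Y x ^ 2 * of_bool (\<not> x \<le> cutoff n))"
      by (rule R.tail_mom)
    also have "\<dots> \<le> EPn n (\<lambda>x. N n / real n * ((W n x)\<^sup>2 * of_bool ((W n x)\<^sup>2 \<ge> K)))"
    proof (rule R.EP_mono)
      fix x
      have W: "(W n x)\<^sup>2 = real n / N n * Y x ^ 2"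
        using pos by (simp add: Z_scaled_eq power_mult_distrib)
      have "(W n x)\<^sup>2 \<ge> K" if "\<not> x \<le> cutoff n"
      proof -
        have "real c + 1 \<le> Y x" using binomial_ge_linear[OF s, of x] that elim(5) by linarith
        then have "real c \<le> Y x" "1 \<le> Y x" by auto
        then have "real c * 1 \<le> Y x * Y x" by (intro mult_mono) auto
        then have Y2: "K * (\<beta> + 1) \<le> Y x ^ 2" using c by (simp add: power2_eq_square)
        have "K * (N n / real n) \<le> K * (\<beta> + 1)" using K(1) elim(2) by (intro mult_left_mono) auto
        then have "K * (N n / real n) \<le> Y x ^ 2" using Y2 by linarith
        then show ?thesis unfolding W using pos by (simp add: field_simps)
      qed
      then show "Y x ^ 2 * of_bool (\<not> x \<le> cutoff n) \<le> N n / real n * ((W n x)\<^sup>2 * of_bool ((W n x)\<^sup>2 \<ge> K))"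
        using pos unfolding W by (cases "x \<le> cutoff n") auto
    qed
    also have "\<dots> = N n / real n * EPn n (\<lambda>x. (W n x)\<^sup>2 * of_bool ((W n x)\<^sup>2 \<ge> K))" by simp
    also have "\<dots> \<le> (\<beta> + 1) * e'"
      using elim(1,2) pos beta(1)
      by (intro mult_mono) (auto intro!: Bochner_Integration.integral_nonneg)
    also have "\<dots> = e" using beta by (simp add: e'_def)
    finally have "momn n 2 - truncn n (cutoff n) 2 \<le> e" .
    moreover have "momn n 2 - truncn n (cutoff n) 2 \<ge> 0"
      unfolding R.tail_mom by (intro Bochner_Integration.integral_nonneg) auto
    ultimately show ?case by simp
  qed
qed

lemma tail_1_limit: "(\<lambda>n. momn n 1 - truncn n (cutoff n) 1) \<longlonglongrightarrow> 0"
proof (rule tendsto_sandwich[OF _ _ tendsto_const tail_2_limit])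
  show "eventually (\<lambda>n. 0 \<le> momn n 1 - truncn n (cutoff n) 1) sequentially"
    using ev_ge[of 1]
  proof eventually_elim
    case (elim n)
    interpret R: random_attr_set s "m n" "P n" by (rule attr_set_model[OF elim])
    show ?case unfolding R.tail_mom by (intro Bochner_Integration.integral_nonneg) auto
  qed
  show "eventually (\<lambda>n. momn n 1 - truncn n (cutoff n) 1 \<le> momn n 2 - truncn n (cutoff n) 2) sequentially"
    using ev_ge[of 1]
  proof eventually_elim
    case (elim n)
    interpret R: random_attr_set s "m n" "P n" by (rule attr_set_model[OF elim])
    show ?case unfolding R.tail_mom
    proof (intro R.EP_mono mult_right_mono)
      fix x
      have "(x choose s) ^ 1 \<le> (x choose s) ^ 2"
        by (simp only: power_one_right power2_eq_square le_square)
      then show "Y x ^ 1 \<le> Y x ^ 2" by (metis of_nat_le_iff of_nat_power)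
    qed auto
  qed
qed

lemma trunc_1_limit: "(\<lambda>n. truncn n (cutoff n) 1) \<longlonglongrightarrow> \<alpha>1"
  using tendsto_diff[OF mom_1_limit tail_1_limit] by simp

lemma trunc_2_limit: "(\<lambda>n. truncn n (cutoff n) 2) \<longlonglongrightarrow> \<alpha>2"
  using tendsto_diff[OF mom_2_limit tail_2_limit] by simp

text \<open>
  Limits in \<open>n\<close> that are uniform over all attribute sets of a given size are limits along this filter
  on pairs. This spares a proof that the probabilities depend on the attribute set through its size
  alone, and the usual calculus of limits applies.
\<close>

definition at_size :: "nat \<Rightarrow> (nat \<times> nat set) filter" where
  "at_size x = inf (filtercomap fst sequentially) (principal {(n, A). A \<subseteq> {1..m n} \<and> card A = x})"

lemma eventually_at_size:
  "eventually (\<lambda>p. R (fst p) (snd p)) (at_size x) \<longleftrightarrow>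
    eventually (\<lambda>n. \<forall>A. A \<subseteq> {1..m n} \<longrightarrow> card A = x \<longrightarrow> R n A) sequentially"
proof
  assume "eventually (\<lambda>p. R (fst p) (snd p)) (at_size x)"
  then obtain Q where Q: "eventually Q sequentially"
    "\<And>n A. Q n \<Longrightarrow> A \<subseteq> {1..m n} \<Longrightarrow> card A = x \<Longrightarrow> R n A"
    unfolding at_size_def eventually_inf_principal eventually_filtercomap by force
  from Q(1) show "eventually (\<lambda>n. \<forall>A. A \<subseteq> {1..m n} \<longrightarrow> card A = x \<longrightarrow> R n A) sequentially"
    by (rule eventually_mono) (use Q(2) in auto)
next
  assume "eventually (\<lambda>n. \<forall>A. A \<subseteq> {1..m n} \<longrightarrow> card A = x \<longrightarrow> R n A) sequentially"
  then show "eventually (\<lambda>p. R (fst p) (snd p)) (at_size x)"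
    unfolding at_size_def eventually_inf_principal eventually_filtercomap by force
qed

lemma eventually_at_sizeI:
  assumes "eventually (\<lambda>n. \<forall>A. A \<subseteq> {1..m n} \<longrightarrow> card A = x \<longrightarrow> R n A) sequentially"
  shows "eventually (\<lambda>p. R (fst p) (snd p)) (at_size x)"
  using assms by (simp add: eventually_at_size)

lemma fst_at_size: "filterlim fst sequentially (at_size x)"
  unfolding at_size_def by (rule filterlim_mono[OF filterlim_filtercomap order.refl inf_le1])

lemma tendsto_at_size: "f \<longlonglongrightarrow> L \<Longrightarrow> ((\<lambda>p. f (fst p)) \<longlongrightarrow> L) (at_size x)"
  by (rule filterlim_compose[OF _ fst_at_size])

lemma link_upper_eventually:
  "eventually (\<lambda>n. \<forall>A. A \<subseteq> {1..m n} \<longrightarrow> 0 \<le> linkp n A \<and> linkp n A \<le> 1 \<and>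
     real n * linkp n A \<le> Y (card A) * (real n / N n * momn n 1)) sequentially"
  using ev_ge[of 1]
proof eventually_elim
  case (elim n)
  interpret R: random_attr_set s "m n" "P n" by (rule attr_set_model[OF elim])
  show ?case
  proof safe
    fix A assume "A \<subseteq> {1..m n}"
    from mult_left_mono[OF R.link_prob_upper[OF this], of "real n"]
    show "real n * R.link_prob A \<le> Y (card A) * (real n / N n * R.mom 1)" by (simp add: mult_ac)
  qed (rule R.link_prob_nonneg R.link_prob_le_1)+
qed

text \<open>
  Upper and lower first moment bounds agree in the limit. The same squeeze yields \<open>path_limit\<close> and
  \<open>triangle_limit\<close>.
\<close>

lemma link_limit: "((\<lambda>p. real (fst p) * linkp (fst p) (snd p)) \<longlongrightarrow> rate x) (at_size x)"
proof (rule tendsto_sandwich)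
  have "(\<lambda>n. Y x * (real n / N n * \<theta> n * truncn n (cutoff n) 1)) \<longlonglongrightarrow> Y x * (1 / \<beta> * 1 * \<alpha>1)"
    by (intro tendsto_intros ratio \<theta>_limit trunc_1_limit)
  from tendsto_at_size[OF this]
  show "((\<lambda>p. Y x * (real (fst p) / N (fst p) * \<theta> (fst p) * truncn (fst p) (cutoff (fst p)) 1)) \<longlongrightarrow> rate x) (at_size x)"
    by (simp add: rate_def)
  have "(\<lambda>n. Y x * (real n / N n * momn n 1)) \<longlonglongrightarrow> Y x * (1 / \<beta> * \<alpha>1)"
    by (intro tendsto_intros ratio mom_1_limit)
  from tendsto_at_size[OF this]
  show "((\<lambda>p. Y x * (real (fst p) / N (fst p) * momn (fst p) 1)) \<longlongrightarrow> rate x) (at_size x)"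
    by (simp add: rate_def)
  show "eventually (\<lambda>p. real (fst p) * linkp (fst p) (snd p) \<le>
      Y x * (real (fst p) / N (fst p) * momn (fst p) 1)) (at_size x)"
    by (rule eventually_at_sizeI, rule eventually_mono[OF link_upper_eventually]) auto
  show "eventually (\<lambda>p. Y x * (real (fst p) / N (fst p) * \<theta> (fst p) * truncn (fst p) (cutoff (fst p)) 1) \<le>
      real (fst p) * linkp (fst p) (snd p)) (at_size x)"
  proof (rule eventually_at_sizeI)
    show "eventually (\<lambda>n. \<forall>A. A \<subseteq> {1..m n} \<longrightarrow> card A = x \<longrightarrow>
      Y x * (real n / N n * \<theta> n * truncn n (cutoff n) 1) \<le> real n * linkp n A) sequentially"
      using ev_ge[of 1] ev_m[of "Suc s"] ev_cutoff[of x]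
    proof eventually_elim
      case (elim n)
      interpret R: random_attr_set s "m n" "P n" by (rule attr_set_model[OF elim(1)])
      show ?case
      proof safe
        fix A assume A: "A \<subseteq> {1..m n}" "x = card A"
        have "Y (card A) / N n * \<theta> n * R.trunc_mom (cutoff n) 1 \<le> R.link_prob A"
          unfolding \<theta>_def by (rule R.link_prob_lower) (use A elim in auto)
        from mult_left_mono[OF this, of "real n"]
        show "Y (card A) * (real n / N n * \<theta> n * R.trunc_mom (cutoff n) 1) \<le> real n * R.link_prob A"
          by (simp add: mult_ac)
      qed
    qed
  qed
qed

lemma path_upper_eventually:
  "eventually (\<lambda>n. \<forall>A. A \<subseteq> {1..m n} \<longrightarrow> 0 \<le> trianglep n A \<and> trianglep n A \<le> pathp n A \<and>
     real n ^ 2 * pathp n A \<le> Y (card A) * ((real n / N n) ^ 2 * momn n 1 * momn n 2)) sequentially"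
  using ev_ge[of 1]
proof eventually_elim
  case (elim n)
  interpret R: random_attr_set s "m n" "P n" by (rule attr_set_model[OF elim])
  show ?case
  proof safe
    fix A assume A: "A \<subseteq> {1..m n}"
    from mult_left_mono[OF R.path_prob_upper[OF A], of "real n ^ 2"]
    show "real n ^ 2 * R.path_prob A \<le> Y (card A) * ((real n / N n) ^ 2 * R.mom 1 * R.mom 2)"
      by (simp add: mult_ac power_divide)
    show "0 \<le> R.triangle_prob A" unfolding R.triangle_prob_def
      by (intro Bochner_Integration.integral_nonneg mult_nonneg_nonneg) auto
    show "R.triangle_prob A \<le> R.path_prob A"
      unfolding R.triangle_prob_def R.path_prob_def R.link_prob_def
      by (intro R.EQ_mono mult_left_mono) auto
  qed
qed

lemma path_limit:
  "((\<lambda>p. real (fst p) ^ 2 * pathp (fst p) (snd p)) \<longlongrightarrow> rate x * \<alpha>2 / \<beta>) (at_size x)"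
proof (rule tendsto_sandwich)
  have "(\<lambda>n. Y x * ((real n / N n) ^ 2 * \<theta> n ^ 2 * truncn n (cutoff n) 1 * truncn n (cutoff n) 2)) \<longlonglongrightarrow>
      Y x * ((1 / \<beta>) ^ 2 * 1 ^ 2 * \<alpha>1 * \<alpha>2)"
    by (intro tendsto_intros ratio \<theta>_limit trunc_1_limit trunc_2_limit)
  from tendsto_at_size[OF this]
  show "((\<lambda>p. Y x * ((real (fst p) / N (fst p)) ^ 2 * \<theta> (fst p) ^ 2 *
      truncn (fst p) (cutoff (fst p)) 1 * truncn (fst p) (cutoff (fst p)) 2)) \<longlongrightarrow> rate x * \<alpha>2 / \<beta>) (at_size x)"
    by (simp add: rate_def power2_eq_square mult_ac)
  have "(\<lambda>n. Y x * ((real n / N n) ^ 2 * momn n 1 * momn n 2)) \<longlonglongrightarrow> Y x * ((1 / \<beta>) ^ 2 * \<alpha>1 * \<alpha>2)"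
    by (intro tendsto_intros ratio mom_1_limit mom_2_limit)
  from tendsto_at_size[OF this]
  show "((\<lambda>p. Y x * ((real (fst p) / N (fst p)) ^ 2 * momn (fst p) 1 * momn (fst p) 2)) \<longlongrightarrow> rate x * \<alpha>2 / \<beta>) (at_size x)"
    by (simp add: rate_def power2_eq_square mult_ac)
  show "eventually (\<lambda>p. real (fst p) ^ 2 * pathp (fst p) (snd p) \<le>
      Y x * ((real (fst p) / N (fst p)) ^ 2 * momn (fst p) 1 * momn (fst p) 2)) (at_size x)"
    by (rule eventually_at_sizeI, rule eventually_mono[OF path_upper_eventually]) auto
  show "eventually (\<lambda>p. Y x * ((real (fst p) / N (fst p)) ^ 2 * \<theta> (fst p) ^ 2 *
      truncn (fst p) (cutoff (fst p)) 1 * truncn (fst p) (cutoff (fst p)) 2) \<le>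
      real (fst p) ^ 2 * pathp (fst p) (snd p)) (at_size x)"
  proof (rule eventually_at_sizeI)
    have "eventually (\<lambda>n. \<theta> n > 0) sequentially" by (rule order_tendstoD[OF \<theta>_limit]) simp
    then show "eventually (\<lambda>n. \<forall>A. A \<subseteq> {1..m n} \<longrightarrow> card A = x \<longrightarrow>
      Y x * ((real n / N n) ^ 2 * \<theta> n ^ 2 * truncn n (cutoff n) 1 * truncn n (cutoff n) 2) \<le>
      real n ^ 2 * pathp n A) sequentially"
      using ev_ge[of 1] ev_m[of "Suc s"] ev_cutoff[of x]
    proof eventually_elim
      case (elim n)
      interpret R: random_attr_set s "m n" "P n" by (rule attr_set_model[OF elim(2)])
      show ?case
      proof safe
        fix A assume A: "A \<subseteq> {1..m n}" "x = card A"
        have "Y (card A) / N n ^ 2 * \<theta> n ^ 2 * R.trunc_mom (cutoff n) 1 * R.trunc_mom (cutoff n) 2 \<le> R.path_prob A"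
          unfolding \<theta>_def by (rule R.path_prob_lower) (use A elim in \<open>auto simp: \<theta>_def\<close>)
        from mult_left_mono[OF this, of "real n ^ 2"]
        show "Y (card A) * ((real n / N n) ^ 2 * \<theta> n ^ 2 * R.trunc_mom (cutoff n) 1 * R.trunc_mom (cutoff n) 2) \<le>
            real n ^ 2 * R.path_prob A"
          by (simp add: mult_ac power_divide)
      qed
    qed
  qed
qed

lemma triangle_limit:
  "((\<lambda>p. real (fst p) ^ 2 * trianglep (fst p) (snd p)) \<longlongrightarrow> rate x * \<alpha>1 / \<beta>) (at_size x)"
proof (rule tendsto_sandwich)
  let ?l = "\<lambda>p. real (fst p) * linkp (fst p) (snd p)"
  let ?err = "\<lambda>n. 2 * (2 ^ Suc s * (real (cutoff n) ^ (s + 2) / (real (m n) - real s)) * momn n 1 * (real n / N n)) +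
     2 * (Y x * (real n / N n) * (momn n 1 - truncn n (cutoff n) 1))"
  have "(\<lambda>n. \<theta> n * truncn n (cutoff n) 1 * (real n / N n)) \<longlonglongrightarrow> 1 * \<alpha>1 * (1 / \<beta>)"
    by (intro tendsto_intros ratio \<theta>_limit trunc_1_limit)
  from tendsto_mult[OF link_limit tendsto_at_size[OF this]]
  show "((\<lambda>p. ?l p * (\<theta> (fst p) * truncn (fst p) (cutoff (fst p)) 1 * (real (fst p) / N (fst p)))) \<longlongrightarrow>
      rate x * \<alpha>1 / \<beta>) (at_size x)" by simp
  have "?err \<longlonglongrightarrow> 2 * (2 ^ Suc s * 0 * \<alpha>1 * (1 / \<beta>)) + 2 * (Y x * (1 / \<beta>) * 0)"
    by (intro tendsto_intros ratio tail_1_limit mom_1_limit cutoff_negligible)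
  then have err: "?err \<longlonglongrightarrow> 0" by simp
  have "(\<lambda>n. real n / N n * momn n 1 + ?err n) \<longlonglongrightarrow> 1 / \<beta> * \<alpha>1 + 0"
    by (intro tendsto_add[OF _ err] tendsto_mult ratio mom_1_limit)
  from tendsto_mult[OF link_limit tendsto_at_size[OF this]]
  show "((\<lambda>p. ?l p * (real (fst p) / N (fst p) * momn (fst p) 1 + ?err (fst p))) \<longlongrightarrow>
      rate x * \<alpha>1 / \<beta>) (at_size x)" by simp
  show "eventually (\<lambda>p. ?l p * (\<theta> (fst p) * truncn (fst p) (cutoff (fst p)) 1 * (real (fst p) / N (fst p))) \<le>
      real (fst p) ^ 2 * trianglep (fst p) (snd p)) (at_size x)"
  proof (rule eventually_at_sizeI)
    show "eventually (\<lambda>n. \<forall>A. A \<subseteq> {1..m n} \<longrightarrow> card A = x \<longrightarrow>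
      real n * linkp n A * (\<theta> n * truncn n (cutoff n) 1 * (real n / N n)) \<le>
      real n ^ 2 * trianglep n A) sequentially"
      using ev_ge[of 1] ev_m[of "Suc s"] ev_cutoff[of s]
    proof eventually_elim
      case (elim n)
      interpret R: random_attr_set s "m n" "P n" by (rule attr_set_model[OF elim(1)])
      show ?case
      proof safe
        fix A assume A: "A \<subseteq> {1..m n}" "x = card A"
        have "R.link_prob A * (\<theta> n * R.trunc_mom (cutoff n) 1 / N n) \<le> R.triangle_prob A"
          unfolding \<theta>_def by (rule R.triangle_prob_lower) (use A elim in auto)
        from mult_left_mono[OF this, of "real n ^ 2"]
        show "real n * R.link_prob A * (\<theta> n * R.trunc_mom (cutoff n) 1 * (real n / N n)) \<le>
            real n ^ 2 * R.triangle_prob A"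
          by (simp add: mult_ac power2_eq_square)
      qed
    qed
  qed
  show "eventually (\<lambda>p. real (fst p) ^ 2 * trianglep (fst p) (snd p) \<le>
      ?l p * (real (fst p) / N (fst p) * momn (fst p) 1 + ?err (fst p))) (at_size x)"
  proof (rule eventually_at_sizeI)
    show "eventually (\<lambda>n. \<forall>A. A \<subseteq> {1..m n} \<longrightarrow> card A = x \<longrightarrow>
      real n ^ 2 * trianglep n A \<le>
      real n * linkp n A * (real n / N n * momn n 1 + ?err n)) sequentially"
      using ev_ge[of 1] ev_m[of "Suc s"] ev_cutoff[of x]
    proof eventually_elim
      case (elim n)
      interpret R: random_attr_set s "m n" "P n" by (rule attr_set_model[OF elim(1)])
      have pw: "(2 * real (cutoff n)) ^ Suc s * real (cutoff n) = 2 ^ Suc s * real (cutoff n) ^ (s + 2)"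
        by (simp add: power_mult_distrib)
      show ?case
      proof safe
        fix A assume A: "A \<subseteq> {1..m n}" "x = card A"
        have "R.triangle_prob A \<le> R.link_prob A *
          (R.mom 1 / N n + 2 * (2 ^ Suc s * real (cutoff n) ^ (s + 2) * R.mom 1 / ((real (m n) - real s) * N n)) +
            2 * (Y (card A) / N n * (R.mom 1 - R.trunc_mom (cutoff n) 1)))"
          unfolding pw[symmetric] by (rule R.triangle_prob_upper) (use A elim in auto)
        from mult_left_mono[OF this, of "real n ^ 2"]
        have "real n ^ 2 * R.triangle_prob A \<le> real n ^ 2 * (R.link_prob A *
          (R.mom 1 / N n + 2 * (2 ^ Suc s * real (cutoff n) ^ (s + 2) * R.mom 1 / ((real (m n) - real s) * N n)) +
            2 * (Y (card A) / N n * (R.mom 1 - R.trunc_mom (cutoff n) 1))))"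
          by simp
        also have "\<dots> = real n * R.link_prob A * (real n * (R.mom 1 / N n +
            2 * (2 ^ Suc s * real (cutoff n) ^ (s + 2) * R.mom 1 / ((real (m n) - real s) * N n)) +
            2 * (Y (card A) / N n * (R.mom 1 - R.trunc_mom (cutoff n) 1))))"
          by (simp add: power2_eq_square mult_ac)
        also have "real n * (R.mom 1 / N n +
            2 * (2 ^ Suc s * real (cutoff n) ^ (s + 2) * R.mom 1 / ((real (m n) - real s) * N n)) +
            2 * (Y (card A) / N n * (R.mom 1 - R.trunc_mom (cutoff n) 1))) =
          real n / N n * R.mom 1 + (2 * (2 ^ Suc s * (real (cutoff n) ^ (s + 2) / (real (m n) - real s)) * R.mom 1 * (real n / N n)) +
            2 * (Y (card A) * (real n / N n) * (R.mom 1 - R.trunc_mom (cutoff n) 1)))"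
          unfolding distrib_left by (simp add: mult_ac)
        finally show "real n ^ 2 * R.triangle_prob A \<le> real n * R.link_prob A *
          (real n / N n * R.mom 1 + (2 * (2 ^ Suc s * (real (cutoff n) ^ (s + 2) / (real (m n) - real s)) * R.mom 1 * (real n / N n)) +
            2 * (Y (card A) * (real n / N n) * (R.mom 1 - R.trunc_mom (cutoff n) 1))))" .
      qed
    qed
  qed
qed

end

section \<open>Limits of the weights\<close>

context rig_limit
begin

text \<open>
  A dominated convergence theorem for the changing laws of the attribute set: sizes up to a constant
  are covered by finitely many limits, and beyond it \<open>Y \<le> Y\<^sup>2 / \<rho>\<close> with \<open>\<rho>\<close> large, so that the bounded
  second moment of \<open>Y\<close> controls the rest.
\<close>

lemma dominated_limit:
  assumes lim: "\<And>x. ((\<lambda>p. \<phi> (fst p) (snd p)) \<longlongrightarrow> 0) (at_size x)"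
    and C: "C \<ge> 0"
    and dom: "eventually (\<lambda>n. \<forall>A. A \<subseteq> {1..m n} \<longrightarrow> \<bar>\<phi> n A\<bar> \<le> C * Y (card A)) sequentially"
  shows "(\<lambda>n. EQn n (\<phi> n)) \<longlonglongrightarrow> 0"
proof (rule tendsto_of_approximation)
  fix e :: real assume e: "e > 0"
  obtain c where c: "real c \<ge> 2 * C * (\<alpha>2 + 1) / e" by (meson real_arch_simple)
  define \<rho> where "\<rho> = real (Suc c)"
  have \<rho>: "\<rho> > 0" "C / \<rho> * (\<alpha>2 + 1) \<le> e / 2"
  proof -
    show "\<rho> > 0" by (simp add: \<rho>_def)
    have "2 * C * (\<alpha>2 + 1) / e \<le> \<rho>" using c by (simp add: \<rho>_def)
    then show "C / \<rho> * (\<alpha>2 + 1) \<le> e / 2" using e \<open>\<rho> > 0\<close> by (simp add: field_simps)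
  qed
  have "eventually (\<lambda>n. \<forall>x\<in>{..s + c}. \<forall>A. A \<subseteq> {1..m n} \<longrightarrow> card A = x \<longrightarrow> \<bar>\<phi> n A\<bar> \<le> e / 2) sequentially"
  proof (rule eventually_ball_finite)
    show "\<forall>x\<in>{..s + c}. eventually (\<lambda>n. \<forall>A. A \<subseteq> {1..m n} \<longrightarrow> card A = x \<longrightarrow> \<bar>\<phi> n A\<bar> \<le> e / 2) sequentially"
    proof
      fix x
      have "eventually (\<lambda>p. \<bar>\<phi> (fst p) (snd p)\<bar> < e / 2) (at_size x)"
        using tendstoD[OF lim[of x], of "e / 2"] e by simp
      then have "eventually (\<lambda>p. \<bar>\<phi> (fst p) (snd p)\<bar> \<le> e / 2) (at_size x)" by eventually_elim simp
      then show "eventually (\<lambda>n. \<forall>A. A \<subseteq> {1..m n} \<longrightarrow> card A = x \<longrightarrow> \<bar>\<phi> n A\<bar> \<le> e / 2) sequentially"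
        by (simp only: eventually_at_size[of "\<lambda>n A. \<bar>\<phi> n A\<bar> \<le> e / 2"])
    qed
  qed simp
  moreover have "eventually (\<lambda>n. momn n 2 < \<alpha>2 + 1) sequentially"
    by (rule order_tendstoD[OF mom_2_limit]) simp
  ultimately show "eventually (\<lambda>n. \<bar>EQn n (\<phi> n) - 0\<bar> \<le> e) sequentially"
    using dom ev_ge[of 1]
  proof eventually_elim
    case (elim n)
    interpret R: random_attr_set s "m n" "P n" by (rule attr_set_model[OF elim(4)])
    have "\<bar>EQn n (\<phi> n)\<bar> \<le> EQn n (\<lambda>A. \<bar>\<phi> n A\<bar>)" by (rule integral_abs_bound)
    also have "\<dots> \<le> EQn n (\<lambda>A. e / 2 + C / \<rho> * Y (card A) ^ 2)"
    proof (rule R.EQ_mono)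
      fix A assume "A \<in> set_pmf R.Q"
      then have A: "A \<subseteq> {1..m n}" using R.set_Q by auto
      show "\<bar>\<phi> n A\<bar> \<le> e / 2 + C / \<rho> * Y (card A) ^ 2"
      proof (cases "card A \<le> s + c")
        case True
        then have "\<bar>\<phi> n A\<bar> \<le> e / 2" using elim(1) A by auto
        moreover have "0 \<le> C / \<rho> * Y (card A) ^ 2" using C \<rho> by simp
        ultimately show ?thesis by linarith
      next
        case False
        then have "\<rho> \<le> Y (card A)" using binomial_ge_linear[OF s, of "card A"] by (simp add: \<rho>_def)
        then have "Y (card A) * \<rho> \<le> Y (card A) * Y (card A)" by (rule mult_left_mono) simp
        then have "Y (card A) \<le> Y (card A) ^ 2 / \<rho>" using \<rho> by (simp add: power2_eq_square field_simps)
        then have "C * Y (card A) \<le> C * (Y (card A) ^ 2 / \<rho>)" using C by (rule mult_left_mono)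
        moreover have "\<bar>\<phi> n A\<bar> \<le> C * Y (card A)" using elim(3) A by auto
        ultimately show ?thesis using e by simp
      qed
    qed
    also have "\<dots> = e / 2 + C / \<rho> * EQn n (\<lambda>A. Y (card A) ^ 2)" by simp
    also have "EQn n (\<lambda>A. Y (card A) ^ 2) = momn n 2"
      unfolding R.mom_def by (rule R.expectation_card)
    also have "e / 2 + C / \<rho> * momn n 2 \<le> e / 2 + C / \<rho> * (\<alpha>2 + 1)"
      using elim(2) C \<rho> by (intro add_left_mono mult_left_mono) auto
    also have "\<dots> \<le> e" using \<rho>(2) by linarith
    finally show ?case by simp
  qed
qed

text \<open>
  A pointwise limit in terms of \<open>rate\<close> becomes an integral over \<open>Z\<close>. Since \<open>rate x\<close> is the limit of
  \<open>z1 * W n x\<close>, the function \<open>\<psi>\<close> may be replaced by \<open>f (z1 * W)\<close> by \<open>dominated_limit\<close>, and then the weak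
  convergence of \<open>W\<close> to \<open>Z\<close> takes over.
\<close>

lemma expectation_limit:
  assumes cont: "continuous_on UNIV f" and bd: "\<And>t. t \<ge> 0 \<Longrightarrow> \<bar>f t\<bar> \<le> C * t" and C: "C \<ge> 0"
    and lim: "\<And>x. ((\<lambda>p. \<psi> (fst p) (snd p)) \<longlongrightarrow> f (rate x)) (at_size x)"
    and B: "B \<ge> 0"
    and dom: "eventually (\<lambda>n. \<forall>A. A \<subseteq> {1..m n} \<longrightarrow> \<bar>\<psi> n A\<bar> \<le> B * Y (card A)) sequentially"
  shows "(\<lambda>n. EQn n (\<psi> n)) \<longlonglongrightarrow> integral\<^sup>L M (\<lambda>\<omega>. f (z1 * Z \<omega>))"
proof -
  (* The bound on f holds for nonnegative arguments only; as Z is nonnegative almost surely, the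
     positive part does not change the limit. *)
  define h where "h z = f (z1 * max 0 z)" for z
  have cont_h: "continuous_on UNIV h" unfolding h_def
    by (rule continuous_on_compose2[OF cont]) (auto intro!: continuous_intros)
  have bd_h: "\<bar>h z\<bar> \<le> C * z1 * \<bar>z\<bar>" for z
  proof -
    have "\<bar>h z\<bar> \<le> C * (z1 * max 0 z)" unfolding h_def using z1_nonneg by (intro bd) simp
    also have "\<dots> \<le> C * (z1 * \<bar>z\<bar>)" using C z1_nonneg by (intro mult_left_mono) auto
    finally show ?thesis by simp
  qed
  have "integral\<^sup>L M (\<lambda>\<omega>. h (Z \<omega>)) = integral\<^sup>L M (\<lambda>\<omega>. f (z1 * Z \<omega>))"
  proof (rule integral_cong_AE)
    have [measurable]: "f \<in> borel_measurable borel" "h \<in> borel_measurable borel"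
      using cont cont_h by (auto intro: borel_measurable_continuous_onI)
    show "(\<lambda>\<omega>. h (Z \<omega>)) \<in> borel_measurable M" "(\<lambda>\<omega>. f (z1 * Z \<omega>)) \<in> borel_measurable M" by simp_all
    show "AE \<omega> in M. h (Z \<omega>) = f (z1 * Z \<omega>)" using Z_nonneg by eventually_elim (simp add: h_def)
  qed
  then have h_lim: "(\<lambda>n. EPn n (\<lambda>x. h (W n x))) \<longlonglongrightarrow> integral\<^sup>L M (\<lambda>\<omega>. f (z1 * Z \<omega>))"
    using linear_growth_limit[OF cont_h bd_h] by simp
  have W_lim: "(\<lambda>n. h (W n x)) \<longlonglongrightarrow> f (rate x)" for x
  proof -
    have "(\<lambda>n. sqrt (real n / N n) * Y x) \<longlonglongrightarrow> sqrt (1 / \<beta>) * Y x" by (intro tendsto_intros ratio)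
    then have "(\<lambda>n. W n x) \<longlonglongrightarrow> sqrt (1 / \<beta>) * Y x" by (simp add: Z_scaled_eq)
    then have "(\<lambda>n. h (W n x)) \<longlonglongrightarrow> h (sqrt (1 / \<beta>) * Y x)"
      using cont_h by (intro continuous_on_tendsto_compose[OF cont_h]) auto
    also have "h (sqrt (1 / \<beta>) * Y x) = f (z1 * (sqrt (1 / \<beta>) * Y x))"
      using beta(1) by (simp add: h_def)
    also have "z1 * (sqrt (1 / \<beta>) * Y x) = rate x"
    proof -
      have "sqrt (1 / \<beta>) = sqrt \<beta> / \<beta>" using beta(1) by (simp add: real_sqrt_divide field_simps)
      then show ?thesis by (simp add: rate_def \<alpha>1_def)
    qed
    finally show ?thesis .
  qed
  have "(\<lambda>n. EQn n (\<lambda>A. \<psi> n A - h (W n (card A)))) \<longlonglongrightarrow> 0"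
  proof (rule dominated_limit)
    fix x
    have "((\<lambda>p. \<psi> (fst p) (snd p) - h (W (fst p) x)) \<longlongrightarrow> f (rate x) - f (rate x)) (at_size x)"
      by (intro tendsto_diff lim tendsto_at_size[OF W_lim])
    then have "((\<lambda>p. \<psi> (fst p) (snd p) - h (W (fst p) x)) \<longlongrightarrow> 0) (at_size x)" by simp
    moreover have "eventually (\<lambda>p. \<psi> (fst p) (snd p) - h (W (fst p) x) =
        \<psi> (fst p) (snd p) - h (W (fst p) (card (snd p)))) (at_size x)"
      by (rule eventually_at_sizeI) simp
    ultimately show "((\<lambda>p. \<psi> (fst p) (snd p) - h (W (fst p) (card (snd p)))) \<longlongrightarrow> 0) (at_size x)"
      by (rule Lim_transform_eventually)
  next
    let ?D = "B + C * z1 * sqrt (1 / \<beta> + 1)"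
    show "?D \<ge> 0" using B C z1_nonneg beta(1) by simp
    have "eventually (\<lambda>n. real n / N n < 1 / \<beta> + 1) sequentially"
      by (rule order_tendstoD[OF ratio]) simp
    then show "eventually (\<lambda>n. \<forall>A. A \<subseteq> {1..m n} \<longrightarrow> \<bar>\<psi> n A - h (W n (card A))\<bar> \<le> ?D * Y (card A)) sequentially"
      using dom
    proof eventually_elim
      case (elim n)
      show ?case
      proof safe
        fix A assume A: "A \<subseteq> {1..m n}"
        have "\<bar>h (W n (card A))\<bar> \<le> C * z1 * \<bar>W n (card A)\<bar>" by (rule bd_h)
        also have "\<bar>W n (card A)\<bar> = sqrt (real n / N n) * Y (card A)"
          by (simp add: Z_scaled_eq abs_mult)
        also have "C * z1 * (sqrt (real n / N n) * Y (card A)) \<le> C * z1 * (sqrt (1 / \<beta> + 1) * Y (card A))"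
          using elim(1) C z1_nonneg by (intro mult_left_mono mult_right_mono real_sqrt_le_mono) auto
        finally have "\<bar>h (W n (card A))\<bar> \<le> C * z1 * sqrt (1 / \<beta> + 1) * Y (card A)" by simp
        moreover have "\<bar>\<psi> n A\<bar> \<le> B * Y (card A)" using elim(2) A by auto
        ultimately show "\<bar>\<psi> n A - h (W n (card A))\<bar> \<le> ?D * Y (card A)"
          by (simp add: distrib_right)
      qed
    qed
  qed
  from tendsto_add[OF this h_lim]
  have "(\<lambda>n. EQn n (\<lambda>A. \<psi> n A - h (W n (card A))) + EPn n (\<lambda>x. h (W n x))) \<longlonglongrightarrow> integral\<^sup>L M (\<lambda>\<omega>. f (z1 * Z \<omega>))"
    by simp
  then show ?thesis
  proof (rule Lim_transform_eventually)
    show "eventually (\<lambda>n. EQn n (\<lambda>A. \<psi> n A - h (W n (card A))) + EPn n (\<lambda>x. h (W n x)) = EQn n (\<psi> n)) sequentially"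
      using ev_ge[of 1]
    proof eventually_elim
      case (elim n)
      interpret R: random_attr_set s "m n" "P n" by (rule attr_set_model[OF elim])
      show ?case using R.expectation_card[of "\<lambda>x. h (W n x)"] by simp
    qed
  qed
qed

text \<open>
  A fixed number \<open>j\<close> of vertices has already been revealed when the remaining degree is counted; this
  does not affect the limit.
\<close>

lemma binomial_link_limit:
  "((\<lambda>p. pmf (binomial_pmf (fst p - j) (linkp (fst p) (snd p))) i) \<longlongrightarrow>
     rate x ^ i / fact i * exp (- rate x)) (at_size x)"
proof -
  (* Along the filter linkp is a probability only for n \<ge> 1, hence the clamping. *)
  let ?q = "\<lambda>p. max 0 (min 1 (linkp (fst p) (snd p)))"
  have q_eq: "eventually (\<lambda>p. linkp (fst p) (snd p) = ?q p) (at_size x)"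
    by (rule eventually_at_sizeI, rule eventually_mono[OF link_upper_eventually]) auto
  have inv0: "(\<lambda>n. inverse (real n)) \<longlonglongrightarrow> 0"
    by (intro tendsto_inverse_0_at_top filterlim_real_sequentially)
  have "((\<lambda>p. real (fst p) * linkp (fst p) (snd p) - real j * (real (fst p) * linkp (fst p) (snd p) * inverse (real (fst p)))) \<longlongrightarrow>
      rate x - real j * (rate x * 0)) (at_size x)"
    by (intro tendsto_intros link_limit tendsto_at_size[OF inv0])
  then have "((\<lambda>p. real (fst p) * linkp (fst p) (snd p) - real j * (real (fst p) * linkp (fst p) (snd p) * inverse (real (fst p)))) \<longlongrightarrow>
      rate x) (at_size x)" by simp
  moreover have "eventually (\<lambda>p. real (fst p) * linkp (fst p) (snd p) - real j * (real (fst p) * linkp (fst p) (snd p) * inverse (real (fst p))) =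
     real (fst p - j) * ?q p) (at_size x)"
  proof -
    have "eventually (\<lambda>p. fst p \<ge> Suc j) (at_size x)"
      using fst_at_size unfolding filterlim_at_top by blast
    with q_eq show ?thesis
    proof eventually_elim
      case (elim p)
      then have "real (fst p) > 0" by simp
      then show ?case using elim by (simp add: of_nat_diff left_diff_distrib field_simps)
    qed
  qed
  ultimately have "((\<lambda>p. real (fst p - j) * ?q p) \<longlongrightarrow> rate x) (at_size x)" by (rule Lim_transform_eventually)
  moreover have "filterlim (\<lambda>p. fst p - j) sequentially (at_size x)"
    by (rule filterlim_compose[OF filterlim_minus_const_nat_at_top fst_at_size])
  ultimately have "((\<lambda>p. pmf (binomial_pmf (fst p - j) (?q p)) i) \<longlongrightarrow>
     rate x ^ i / fact i * exp (- rate x)) (at_size x)"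
    by (intro binomial_tendsto_poisson) auto
  then show ?thesis
    by (rule Lim_transform_eventually) (use q_eq in \<open>eventually_elim, simp\<close>)
qed

text \<open>
  The three weights are expectations of products of a probability with limit \<open>rate\<close> times a constant
  and of a bounded functional of the degree with a Poisson limit. Hence all limits are integrals of
  \<open>\<Lambda> G(\<Lambda>)\<close> with \<open>\<Lambda> = z1 Z\<close>, the size bias \<open>\<Lambda>\<close> coming from the edge to \<open>v\<^sub>1\<close>. Triangles
  contribute the factor \<open>\<alpha>1 / \<beta>\<close> and paths \<open>\<alpha>2 / \<beta>\<close>.
\<close>

lemma weight_limits:
  fixes g :: "nat \<Rightarrow> real" and G1 G2 :: "real \<Rightarrow> real"
  assumes g: "\<And>c. \<bar>g c\<bar> \<le> 1"
    and cont: "continuous_on UNIV G1" "continuous_on UNIV G2"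
    and bd: "\<And>t. t \<ge> 0 \<Longrightarrow> \<bar>G1 t\<bar> \<le> 1" "\<And>t. t \<ge> 0 \<Longrightarrow> \<bar>G2 t\<bar> \<le> 1"
    and G1: "\<And>j x. ((\<lambda>p. measure_pmf.expectation (binomial_pmf (fst p - j) (linkp (fst p) (snd p)))
        (\<lambda>c. g (Suc c))) \<longlongrightarrow> G1 (rate x)) (at_size x)"
    and G2: "\<And>j x. ((\<lambda>p. measure_pmf.expectation (binomial_pmf (fst p - j) (linkp (fst p) (snd p)))
        (\<lambda>c. g (Suc (Suc c)))) \<longlongrightarrow> G2 (rate x)) (at_size x)"
  shows "(\<lambda>n. real n * random_attr_set.edge_weight s (m n) (P n) n g) \<longlonglongrightarrow>
           integral\<^sup>L M (\<lambda>\<omega>. z1 * Z \<omega> * G1 (z1 * Z \<omega>))" (is ?edge)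
    and "(\<lambda>n. real n ^ 2 * random_attr_set.triangle_weight s (m n) (P n) n g) \<longlonglongrightarrow>
           \<alpha>1 / \<beta> * integral\<^sup>L M (\<lambda>\<omega>. z1 * Z \<omega> * G2 (z1 * Z \<omega>))" (is ?triangle)
    and "(\<lambda>n. real n ^ 2 * random_attr_set.wedge_weight s (m n) (P n) n g) \<longlonglongrightarrow>
           (\<alpha>2 - \<alpha>1) / \<beta> * integral\<^sup>L M (\<lambda>\<omega>. z1 * Z \<omega> * G1 (z1 * Z \<omega>))" (is ?wedge)
proof -
  have binE_bound: "\<bar>measure_pmf.expectation (binomial_pmf i q) (\<lambda>c. g (f c))\<bar> \<le> 1" for i q f
  proof -
    have "\<bar>measure_pmf.expectation (binomial_pmf i q) (\<lambda>c. g (f c))\<bar> \<le>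
        measure_pmf.expectation (binomial_pmf i q) (\<lambda>c. \<bar>g (f c)\<bar>)" by (rule integral_abs_bound)
    also have "\<dots> \<le> measure_pmf.expectation (binomial_pmf i q) (\<lambda>c. 1)"
      by (intro Bochner_Integration.integral_mono measure_pmf.integrable_const_bound[where B = 1])
        (auto simp: g)
    finally show ?thesis by simp
  qed
  let ?b = "\<lambda>j n A f. measure_pmf.expectation (binomial_pmf (n - j) (linkp n A)) (\<lambda>c. g (f c))"
  have "\<alpha>1 \<ge> 0" using z1_nonneg beta(1) by (simp add: \<alpha>1_def)
  have "\<alpha>2 \<ge> 0" using beta(1) unfolding \<alpha>2_def z2_def
    by (intro mult_nonneg_nonneg Bochner_Integration.integral_nonneg) auto
  have path_dom: "eventually (\<lambda>n. \<forall>A. A \<subseteq> {1..m n} \<longrightarrow>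
      real n ^ 2 * pathp n A \<le> ((1 / \<beta>) ^ 2 * \<alpha>1 * \<alpha>2 + 1) * Y (card A)) sequentially"
  proof -
    have "(\<lambda>n. (real n / N n) ^ 2 * momn n 1 * momn n 2) \<longlonglongrightarrow> (1 / \<beta>) ^ 2 * \<alpha>1 * \<alpha>2"
      by (intro tendsto_intros ratio mom_1_limit mom_2_limit)
    then have "eventually (\<lambda>n. (real n / N n) ^ 2 * momn n 1 * momn n 2 < (1 / \<beta>) ^ 2 * \<alpha>1 * \<alpha>2 + 1) sequentially"
      by (rule order_tendstoD) simp
    then show ?thesis using path_upper_eventually
    proof eventually_elim
      case (elim n)
      show ?case
      proof safe
        fix A assume "A \<subseteq> {1..m n}"
        then have "real n ^ 2 * pathp n A \<le> Y (card A) * ((real n / N n) ^ 2 * momn n 1 * momn n 2)"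
          using elim(2) by auto
        also have "\<dots> \<le> Y (card A) * ((1 / \<beta>) ^ 2 * \<alpha>1 * \<alpha>2 + 1)"
          using elim(1) by (intro mult_left_mono) auto
        finally show "real n ^ 2 * pathp n A \<le> ((1 / \<beta>) ^ 2 * \<alpha>1 * \<alpha>2 + 1) * Y (card A)"
          by (simp only: mult.commute)
      qed
    qed
  qed
  have B: "(1 / \<beta>) ^ 2 * \<alpha>1 * \<alpha>2 + 1 \<ge> 0" using \<open>\<alpha>1 \<ge> 0\<close> \<open>\<alpha>2 \<ge> 0\<close> by simp
  have "(\<lambda>n. EQn n (\<lambda>A. real n * linkp n A * ?b 2 n A Suc)) \<longlonglongrightarrow>
      integral\<^sup>L M (\<lambda>\<omega>. z1 * Z \<omega> * G1 (z1 * Z \<omega>))"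
  proof (rule expectation_limit[where C = 1 and B = "1 / \<beta> * \<alpha>1 + 1"])
    show "continuous_on UNIV (\<lambda>t. t * G1 t)" by (intro continuous_intros cont)
    show "\<bar>t * G1 t\<bar> \<le> 1 * t" if "t \<ge> 0" for t
      using mult_left_mono[OF bd(1)[OF that] that] that by (simp add: abs_mult)
    show "((\<lambda>p. real (fst p) * linkp (fst p) (snd p) * ?b 2 (fst p) (snd p) Suc) \<longlongrightarrow> rate x * G1 (rate x)) (at_size x)" for x
      by (intro tendsto_mult link_limit G1)
    show "1 / \<beta> * \<alpha>1 + 1 \<ge> 0" using \<open>\<alpha>1 \<ge> 0\<close> beta(1) by simp
    have "(\<lambda>n. real n / N n * momn n 1) \<longlonglongrightarrow> 1 / \<beta> * \<alpha>1"
      by (intro tendsto_intros ratio mom_1_limit)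
    then have "eventually (\<lambda>n. real n / N n * momn n 1 < 1 / \<beta> * \<alpha>1 + 1) sequentially"
      by (rule order_tendstoD) simp
    then show "eventually (\<lambda>n. \<forall>A. A \<subseteq> {1..m n} \<longrightarrow>
        \<bar>real n * linkp n A * ?b 2 n A Suc\<bar> \<le> (1 / \<beta> * \<alpha>1 + 1) * Y (card A)) sequentially"
      using link_upper_eventually
    proof eventually_elim
      case (elim n)
      show ?case
      proof safe
        fix A assume A: "A \<subseteq> {1..m n}"
        have l0: "0 \<le> real n * linkp n A" using elim(2) A by auto
        have "\<bar>real n * linkp n A * ?b 2 n A Suc\<bar> \<le> real n * linkp n A * 1"
          unfolding abs_mult[of "real n * linkp n A"] abs_of_nonneg[OF l0]
          by (rule mult_left_mono[OF binE_bound l0])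
        also have "\<dots> \<le> Y (card A) * (real n / N n * momn n 1)" using elim(2) A by auto
        also have "\<dots> \<le> Y (card A) * (1 / \<beta> * \<alpha>1 + 1)" using elim(1) by (intro mult_left_mono) auto
        finally show "\<bar>real n * linkp n A * ?b 2 n A Suc\<bar> \<le> (1 / \<beta> * \<alpha>1 + 1) * Y (card A)"
          by (simp only: mult.commute)
      qed
    qed
  qed simp
  then show ?edge
  proof (rule Lim_transform_eventually)
    show "eventually (\<lambda>n. EQn n (\<lambda>A. real n * linkp n A * ?b 2 n A Suc) =
        real n * random_attr_set.edge_weight s (m n) (P n) n g) sequentially"
      using ev_ge[of 1]
    proof eventually_elim
      case (elim n)
      interpret R: random_attr_set s "m n" "P n" by (rule attr_set_model[OF elim])
      show ?case unfolding R.edge_weight_def by (simp add: mult.assoc)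
    qed
  qed
  have "(\<lambda>n. EQn n (\<lambda>A. real n ^ 2 * trianglep n A * ?b 3 n A (\<lambda>c. Suc (Suc c)))) \<longlonglongrightarrow>
      integral\<^sup>L M (\<lambda>\<omega>. (z1 * Z \<omega>) * \<alpha>1 / \<beta> * G2 (z1 * Z \<omega>))"
  proof (rule expectation_limit[where C = "\<alpha>1 / \<beta>", OF _ _ _ _ B])
    show "continuous_on UNIV (\<lambda>t. t * \<alpha>1 / \<beta> * G2 t)" using beta(1) by (intro continuous_intros cont) auto
    show "\<bar>t * \<alpha>1 / \<beta> * G2 t\<bar> \<le> \<alpha>1 / \<beta> * t" if t: "t \<ge> 0" for t
    proof -
      have t0: "0 \<le> t * \<alpha>1 / \<beta>" using t \<open>\<alpha>1 \<ge> 0\<close> beta(1) by simp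
      from mult_left_mono[OF bd(2)[OF t] t0] show ?thesis
        unfolding abs_mult[of "t * \<alpha>1 / \<beta>"] abs_of_nonneg[OF t0] by (simp add: mult_ac)
    qed
    show "((\<lambda>p. real (fst p) ^ 2 * trianglep (fst p) (snd p) * ?b 3 (fst p) (snd p) (\<lambda>c. Suc (Suc c))) \<longlongrightarrow>
        rate x * \<alpha>1 / \<beta> * G2 (rate x)) (at_size x)" for x
      by (intro tendsto_mult triangle_limit G2)
    show "\<alpha>1 / \<beta> \<ge> 0" using \<open>\<alpha>1 \<ge> 0\<close> beta(1) by simp
    show "eventually (\<lambda>n. \<forall>A. A \<subseteq> {1..m n} \<longrightarrow> \<bar>real n ^ 2 * trianglep n A * ?b 3 n A (\<lambda>c. Suc (Suc c))\<bar> \<le>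
        ((1 / \<beta>) ^ 2 * \<alpha>1 * \<alpha>2 + 1) * Y (card A)) sequentially"
      using path_dom path_upper_eventually
    proof eventually_elim
      case (elim n)
      show ?case
      proof safe
        fix A assume A: "A \<subseteq> {1..m n}"
        have l0: "0 \<le> real n ^ 2 * trianglep n A" using elim(2) A by auto
        have "\<bar>real n ^ 2 * trianglep n A * ?b 3 n A (\<lambda>c. Suc (Suc c))\<bar> \<le> real n ^ 2 * trianglep n A * 1"
          unfolding abs_mult[of "real n ^ 2 * trianglep n A"] abs_of_nonneg[OF l0]
          by (rule mult_left_mono[OF binE_bound l0])
        also have "\<dots> \<le> real n ^ 2 * pathp n A" using elim(2) A by (auto intro!: mult_left_mono)
        also have "\<dots> \<le> ((1 / \<beta>) ^ 2 * \<alpha>1 * \<alpha>2 + 1) * Y (card A)" using elim(1) A by auto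
        finally show "\<bar>real n ^ 2 * trianglep n A * ?b 3 n A (\<lambda>c. Suc (Suc c))\<bar> \<le>
            ((1 / \<beta>) ^ 2 * \<alpha>1 * \<alpha>2 + 1) * Y (card A)" .
      qed
    qed
  qed
  moreover have "integral\<^sup>L M (\<lambda>\<omega>. (z1 * Z \<omega>) * \<alpha>1 / \<beta> * G2 (z1 * Z \<omega>)) =
      \<alpha>1 / \<beta> * integral\<^sup>L M (\<lambda>\<omega>. z1 * Z \<omega> * G2 (z1 * Z \<omega>))"
    unfolding integral_mult_right_zero[symmetric] by (rule Bochner_Integration.integral_cong) simp_all
  ultimately have "(\<lambda>n. EQn n (\<lambda>A. real n ^ 2 * trianglep n A * ?b 3 n A (\<lambda>c. Suc (Suc c)))) \<longlonglongrightarrow>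
      \<alpha>1 / \<beta> * integral\<^sup>L M (\<lambda>\<omega>. z1 * Z \<omega> * G2 (z1 * Z \<omega>))" by (simp only:)
  then show ?triangle
  proof (rule Lim_transform_eventually)
    show "eventually (\<lambda>n. EQn n (\<lambda>A. real n ^ 2 * trianglep n A * ?b 3 n A (\<lambda>c. Suc (Suc c))) =
        real n ^ 2 * random_attr_set.triangle_weight s (m n) (P n) n g) sequentially"
      using ev_ge[of 1]
    proof eventually_elim
      case (elim n)
      interpret R: random_attr_set s "m n" "P n" by (rule attr_set_model[OF elim])
      show ?case unfolding R.triangle_weight_def by (simp add: mult.assoc)
    qed
  qed
  have "(\<lambda>n. EQn n (\<lambda>A. real n ^ 2 * (pathp n A - trianglep n A) * ?b 3 n A Suc)) \<longlonglongrightarrow>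
      integral\<^sup>L M (\<lambda>\<omega>. ((z1 * Z \<omega>) * \<alpha>2 / \<beta> - (z1 * Z \<omega>) * \<alpha>1 / \<beta>) * G1 (z1 * Z \<omega>))"
  proof (rule expectation_limit[where C = "\<alpha>2 / \<beta> + \<alpha>1 / \<beta>", OF _ _ _ _ B])
    show "continuous_on UNIV (\<lambda>t. (t * \<alpha>2 / \<beta> - t * \<alpha>1 / \<beta>) * G1 t)" using beta(1) by (intro continuous_intros cont) auto
    show "\<bar>(t * \<alpha>2 / \<beta> - t * \<alpha>1 / \<beta>) * G1 t\<bar> \<le> (\<alpha>2 / \<beta> + \<alpha>1 / \<beta>) * t" if t: "t \<ge> 0" for t
    proof -
      have pos: "0 \<le> t * \<alpha>1 / \<beta>" "0 \<le> t * \<alpha>2 / \<beta>" using t \<open>\<alpha>1 \<ge> 0\<close> \<open>\<alpha>2 \<ge> 0\<close> beta(1) by simp_all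
      have "\<bar>(t * \<alpha>2 / \<beta> - t * \<alpha>1 / \<beta>) * G1 t\<bar> \<le> \<bar>t * \<alpha>2 / \<beta> - t * \<alpha>1 / \<beta>\<bar> * 1"
        unfolding abs_mult[of _ "G1 t"] by (intro mult_left_mono bd t) simp
      also have "\<dots> \<le> t * \<alpha>2 / \<beta> + t * \<alpha>1 / \<beta>"
        using abs_triangle_ineq4[of "t * \<alpha>2 / \<beta>" "t * \<alpha>1 / \<beta>"]
        unfolding abs_of_nonneg[OF pos(1)] abs_of_nonneg[OF pos(2)] mult_1_right .
      also have "\<dots> = (\<alpha>2 / \<beta> + \<alpha>1 / \<beta>) * t" by (simp add: distrib_right mult.commute[of t])
      finally show ?thesis .
    qed
    show "((\<lambda>p. real (fst p) ^ 2 * (pathp (fst p) (snd p) - trianglep (fst p) (snd p)) * ?b 3 (fst p) (snd p) Suc) \<longlongrightarrow>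
        (rate x * \<alpha>2 / \<beta> - rate x * \<alpha>1 / \<beta>) * G1 (rate x)) (at_size x)" for x
      unfolding right_diff_distrib by (intro tendsto_mult tendsto_diff path_limit triangle_limit G1)
    show "\<alpha>2 / \<beta> + \<alpha>1 / \<beta> \<ge> 0" using \<open>\<alpha>1 \<ge> 0\<close> \<open>\<alpha>2 \<ge> 0\<close> beta(1) by simp
    show "eventually (\<lambda>n. \<forall>A. A \<subseteq> {1..m n} \<longrightarrow> \<bar>real n ^ 2 * (pathp n A - trianglep n A) * ?b 3 n A Suc\<bar> \<le>
        ((1 / \<beta>) ^ 2 * \<alpha>1 * \<alpha>2 + 1) * Y (card A)) sequentially"
      using path_dom path_upper_eventually
    proof eventually_elim
      case (elim n)
      show ?case
      proof safe
        fix A assume A: "A \<subseteq> {1..m n}"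
        have l0: "0 \<le> real n ^ 2 * (pathp n A - trianglep n A)" using elim(2) A by auto
        have "\<bar>real n ^ 2 * (pathp n A - trianglep n A) * ?b 3 n A Suc\<bar> \<le> real n ^ 2 * (pathp n A - trianglep n A) * 1"
          unfolding abs_mult[of "real n ^ 2 * (pathp n A - trianglep n A)"] abs_of_nonneg[OF l0]
          by (rule mult_left_mono[OF binE_bound l0])
        also have "\<dots> \<le> real n ^ 2 * pathp n A" using elim(2) A by (auto intro!: mult_left_mono)
        also have "\<dots> \<le> ((1 / \<beta>) ^ 2 * \<alpha>1 * \<alpha>2 + 1) * Y (card A)" using elim(1) A by auto
        finally show "\<bar>real n ^ 2 * (pathp n A - trianglep n A) * ?b 3 n A Suc\<bar> \<le>
            ((1 / \<beta>) ^ 2 * \<alpha>1 * \<alpha>2 + 1) * Y (card A)" .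
      qed
    qed
  qed
  moreover have "integral\<^sup>L M (\<lambda>\<omega>. ((z1 * Z \<omega>) * \<alpha>2 / \<beta> - (z1 * Z \<omega>) * \<alpha>1 / \<beta>) * G1 (z1 * Z \<omega>)) =
      (\<alpha>2 - \<alpha>1) / \<beta> * integral\<^sup>L M (\<lambda>\<omega>. z1 * Z \<omega> * G1 (z1 * Z \<omega>))"
    by (subst Bochner_Integration.integral_mult_right_zero[symmetric])
      (auto intro!: Bochner_Integration.integral_cong simp: diff_divide_distrib algebra_simps)
  ultimately have "(\<lambda>n. EQn n (\<lambda>A. real n ^ 2 * (pathp n A - trianglep n A) * ?b 3 n A Suc)) \<longlonglongrightarrow>
      (\<alpha>2 - \<alpha>1) / \<beta> * integral\<^sup>L M (\<lambda>\<omega>. z1 * Z \<omega> * G1 (z1 * Z \<omega>))" by (simp only:)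
  then show ?wedge
  proof (rule Lim_transform_eventually)
    show "eventually (\<lambda>n. EQn n (\<lambda>A. real n ^ 2 * (pathp n A - trianglep n A) * ?b 3 n A Suc) =
        real n ^ 2 * random_attr_set.wedge_weight s (m n) (P n) n g) sequentially"
      using ev_ge[of 1]
    proof eventually_elim
      case (elim n)
      interpret R: random_attr_set s "m n" "P n" by (rule attr_set_model[OF elim])
      show ?case unfolding R.wedge_weight_def by (simp add: mult.assoc)
    qed
  qed
qed

end

section \<open>The mixed Poisson law and the conditional expectations\<close>

context rig_limit
begin

lemma mixed_poisson_eq:
  "mixed_poisson_prob M Z k = integral\<^sup>L M (\<lambda>\<omega>. (z1 * Z \<omega>) ^ k * exp (- (z1 * Z \<omega>)) / fact k)"
  by (simp add: mixed_poisson_prob_def z1_def Let_def)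

text \<open>
  Multiplying the Poisson weight of \<open>k\<close> by its parameter gives \<open>k + 1\<close> times the weight of \<open>k + 1\<close>.
  This identity produces the ratio of consecutive probabilities in the formula for common neighbours.
\<close>

lemma mixed_poisson_size_bias:
  "integral\<^sup>L M (\<lambda>\<omega>. z1 * Z \<omega> * ((z1 * Z \<omega>) ^ k / fact k * exp (- (z1 * Z \<omega>)))) =
    real (Suc k) * mixed_poisson_prob M Z (Suc k)"
  unfolding mixed_poisson_eq
  by (subst Bochner_Integration.integral_mult_right_zero[symmetric], rule Bochner_Integration.integral_cong[OF refl],
      simp only: fact_Suc of_nat_mult power_Suc) (simp add: divide_simps del: of_nat_Suc)

lemma mixed_poisson_integrable:
  "integrable M (\<lambda>\<omega>. (z1 * Z \<omega>) ^ k * exp (- (z1 * Z \<omega>)) / fact k)"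
proof (rule integrable_const_bound[where B = 1])
  show "AE \<omega> in M. norm ((z1 * Z \<omega>) ^ k * exp (- (z1 * Z \<omega>)) / fact k) \<le> 1"
    using Z_nonneg
  proof eventually_elim
    case (elim \<omega>)
    then have "z1 * Z \<omega> \<ge> 0" using z1_nonneg by simp
    from poisson_density_le_1[OF this, of k] this show ?case by simp
  qed
qed simp

text \<open>
  Moments of the mixed Poisson law are obtained by first averaging over the Poisson law with fixed
  parameter \<open>r\<close>, whose moment is \<open>S r\<close>; monotone convergence exchanges sum and integral.
\<close>

lemma mixed_poisson_nn_integral:
  fixes dstar :: "nat pmf" and h :: "nat \<Rightarrow> real" and S :: "real \<Rightarrow> real"
  assumes dstar: "\<And>j. pmf dstar j = mixed_poisson_prob M Z j"
    and h: "\<And>j. h j \<ge> 0"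
    and S: "\<And>r. (\<lambda>j. r ^ j * exp (- r) / fact j * h j) sums S r"
    and S_int: "integrable M (\<lambda>\<omega>. S (z1 * Z \<omega>))"
  shows "measure_pmf.expectation dstar h = integral\<^sup>L M (\<lambda>\<omega>. S (z1 * Z \<omega>))"
proof -
  let ?\<pi> = "\<lambda>j \<omega>. (z1 * Z \<omega>) ^ j * exp (- (z1 * Z \<omega>)) / fact j"
  have pos: "AE \<omega> in M. z1 * Z \<omega> \<ge> 0"
    using Z_nonneg by eventually_elim (simp add: z1_nonneg)
  have p: "ennreal (pmf dstar j) = (\<integral>\<^sup>+\<omega>. ennreal (?\<pi> j \<omega>) \<partial>M)" for j
    unfolding dstar mixed_poisson_eq using pos
    by (intro nn_integral_eq_integral[symmetric] mixed_poisson_integrable) auto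
  have S0: "AE \<omega> in M. 0 \<le> S (z1 * Z \<omega>)"
    using pos
  proof eventually_elim
    case (elim \<omega>)
    then show ?case using h by (intro sums_le[OF _ sums_zero S]) auto
  qed
  have "(\<integral>\<^sup>+j. ennreal (h j) \<partial>measure_pmf dstar) = (\<Sum>j. ennreal (pmf dstar j) * ennreal (h j))"
    by (simp add: nn_integral_measure_pmf nn_integral_count_space_nat)
  also have "\<dots> = (\<Sum>j. (\<integral>\<^sup>+\<omega>. ennreal (?\<pi> j \<omega>) * ennreal (h j) \<partial>M))"
    unfolding p by (subst nn_integral_multc) auto
  also have "\<dots> = (\<integral>\<^sup>+\<omega>. (\<Sum>j. ennreal (?\<pi> j \<omega>) * ennreal (h j)) \<partial>M)"
    by (rule nn_integral_suminf[symmetric]) simp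
  also have "\<dots> = (\<integral>\<^sup>+\<omega>. ennreal (S (z1 * Z \<omega>)) \<partial>M)"
  proof (rule nn_integral_cong_AE)
    show "AE \<omega> in M. (\<Sum>j. ennreal (?\<pi> j \<omega>) * ennreal (h j)) = ennreal (S (z1 * Z \<omega>))"
      using pos
    proof eventually_elim
      case (elim \<omega>)
      have "(\<Sum>j. ennreal (?\<pi> j \<omega>) * ennreal (h j)) = (\<Sum>j. ennreal (?\<pi> j \<omega> * h j))"
        using elim h by (intro suminf_cong, subst ennreal_mult[symmetric]) auto
      also have "\<dots> = ennreal (S (z1 * Z \<omega>))"
        using elim h S by (intro suminf_ennreal_eq) auto
      finally show ?case .
    qed
  qed
  also have "\<dots> = ennreal (integral\<^sup>L M (\<lambda>\<omega>. S (z1 * Z \<omega>)))"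
    by (rule nn_integral_eq_integral[OF S_int S0])
  finally have "(\<integral>\<^sup>+j. ennreal (h j) \<partial>measure_pmf dstar) = ennreal (integral\<^sup>L M (\<lambda>\<omega>. S (z1 * Z \<omega>)))" .
  then show ?thesis
    using h integral_nonneg_AE[OF S0] by (subst integral_eq_nn_integral) auto
qed

lemma moment_mixed_poisson:
  assumes dstar: "\<And>j. pmf dstar j = mixed_poisson_prob M Z j"
  shows "moment dstar 1 = z1 ^ 2"
proof -
  have "moment dstar 1 = measure_pmf.expectation dstar real" by (simp add: moment_def)
  also have "\<dots> = integral\<^sup>L M (\<lambda>\<omega>. z1 * Z \<omega>)"
    by (rule mixed_poisson_nn_integral[OF dstar _ poisson_moment_sums(1)]) (simp_all add: Z_integrable)
  also have "\<dots> = z1 ^ 2" by (simp add: z1_def power2_eq_square)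
  finally show ?thesis .
qed

lemma factorial_moment_mixed_poisson:
  assumes dstar: "\<And>j. pmf dstar j = mixed_poisson_prob M Z j"
  shows "factorial_moment dstar 2 = z1 ^ 2 * z2"
proof -
  have "factorial_moment dstar 2 = measure_pmf.expectation dstar (\<lambda>j. real j * (real j - 1))"
    by (simp add: factorial_moment_def numeral_2_eq_2)
  also have "\<dots> = integral\<^sup>L M (\<lambda>\<omega>. (z1 * Z \<omega>)\<^sup>2)"
  proof (rule mixed_poisson_nn_integral[OF dstar _ poisson_moment_sums(2)])
    show "0 \<le> real j * (real j - 1)" for j by (cases j) auto
  qed (simp add: power_mult_distrib Z2_integrable)
  also have "\<dots> = z1 ^ 2 * z2" by (simp add: z2_def power_mult_distrib)
  finally show ?thesis .
qed

lemma z1_pos: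
  assumes "z2 > 0" shows "z1 > 0"
proof (rule ccontr)
  assume "\<not> z1 > 0"
  then have "z1 = 0" using z1_nonneg by simp
  then have "AE \<omega> in M. Z \<omega> = 0"
    unfolding z1_def using integral_nonneg_eq_0_iff_AE[OF Z_integrable Z_nonneg] by simp
  then have "AE \<omega> in M. (Z \<omega>)\<^sup>2 = 0" by eventually_elim simp
  then have "z2 = integral\<^sup>L M (\<lambda>\<omega>. 0)" unfolding z2_def by (intro integral_cong_AE) auto
  then show False using assms by simp
qed

lemma mixed_poisson_pos:
  assumes "z2 > 0" shows "mixed_poisson_prob M Z (Suc k) > 0"
proof (rule ccontr)
  let ?\<pi> = "\<lambda>\<omega>. (z1 * Z \<omega>) ^ Suc k * exp (- (z1 * Z \<omega>)) / fact (Suc k)"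
  have nn: "AE \<omega> in M. 0 \<le> ?\<pi> \<omega>" using Z_nonneg
    by eventually_elim (intro divide_nonneg_nonneg mult_nonneg_nonneg zero_le_power z1_nonneg, auto)
  assume "\<not> mixed_poisson_prob M Z (Suc k) > 0"
  then have "integral\<^sup>L M ?\<pi> = 0"
    using integral_nonneg_AE[OF nn] unfolding mixed_poisson_eq by linarith
  then have "AE \<omega> in M. ?\<pi> \<omega> = 0"
    using integral_nonneg_eq_0_iff_AE[OF mixed_poisson_integrable nn] by simp
  then have "AE \<omega> in M. (Z \<omega>)\<^sup>2 = 0" by eventually_elim (use z1_pos[OF assms] in auto)
  then have "z2 = integral\<^sup>L M (\<lambda>\<omega>. 0)" unfolding z2_def by (intro integral_cong_AE) auto
  then show False using assms by simp
qed

text \<open>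
  The conditional expectations are quotients of weights in which the powers of \<open>n\<close> cancel: a third
  vertex can be chosen in \<open>n - 2\<close> ways, a triangle or path has probability of order \<open>n\<^sup>-\<^sup>2\<close>, and
  an edge of order \<open>n\<^sup>-\<^sup>1\<close>. Positivity of \<open>J0\<close> ensures that the conditioning event eventually has
  positive probability.
\<close>

lemma conditional_limits:
  fixes g :: "nat \<Rightarrow> real" and S :: "nat \<Rightarrow> ((nat \<Rightarrow> nat set) \<times> nat \<times> nat) set"
  assumes S: "\<And>n D i j. of_bool ((D, i, j) \<in> S n) = of_bool (adj s D i j) * g (deg s n D j)"
    and edge: "(\<lambda>n. real n * random_attr_set.edge_weight s (m n) (P n) n g) \<longlonglongrightarrow> J0"
    and triangle: "(\<lambda>n. real n ^ 2 * random_attr_set.triangle_weight s (m n) (P n) n g) \<longlonglongrightarrow> J1"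
    and wedge: "(\<lambda>n. real n ^ 2 * random_attr_set.wedge_weight s (m n) (P n) n g) \<longlonglongrightarrow> J2"
    and J0: "J0 > 0"
  shows "(\<lambda>n. measure_pmf.expectation (cond_pmf (rig_pair_pmf n (m n) (P n)) (S n))
      (\<lambda>(D, v1, v2). real (codeg s n D v1 v2))) \<longlonglongrightarrow> J1 / J0"
    and "(\<lambda>n. measure_pmf.expectation (cond_pmf (rig_pair_pmf n (m n) (P n)) (S n))
      (\<lambda>(D, v1, v2). real (deg s n D v1))) \<longlonglongrightarrow> 1 + (J1 + J2) / J0"
proof -
  let ?e = "\<lambda>n. random_attr_set.edge_weight s (m n) (P n) n g"
  let ?t = "\<lambda>n. random_attr_set.triangle_weight s (m n) (P n) n g"
  let ?w = "\<lambda>n. random_attr_set.wedge_weight s (m n) (P n) n g"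
  have inv0: "(\<lambda>n. 2 * inverse (real n)) \<longlonglongrightarrow> 2 * 0"
    by (intro tendsto_mult tendsto_const tendsto_inverse_0_at_top filterlim_real_sequentially)
  have pos: "eventually (\<lambda>n. real n * ?e n > 0) sequentially" by (rule order_tendstoD(1)[OF edge J0])
  have "(\<lambda>n. (1 - 2 * inverse (real n)) * (real n ^ 2 * ?t n) / (real n * ?e n)) \<longlonglongrightarrow> (1 - 2 * 0) * J1 / J0"
    using J0 by (intro tendsto_intros triangle edge inv0) auto
  then have l1: "(\<lambda>n. (1 - 2 * inverse (real n)) * (real n ^ 2 * ?t n) / (real n * ?e n)) \<longlonglongrightarrow> J1 / J0" by simp
  have "(\<lambda>n. 1 + (1 - 2 * inverse (real n)) * (real n ^ 2 * ?t n + real n ^ 2 * ?w n) / (real n * ?e n)) \<longlonglongrightarrow>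
      1 + (1 - 2 * 0) * (J1 + J2) / J0"
    using J0 by (intro tendsto_intros triangle wedge edge inv0) auto
  then have l2: "(\<lambda>n. 1 + (1 - 2 * inverse (real n)) * (real n ^ 2 * ?t n + real n ^ 2 * ?w n) / (real n * ?e n)) \<longlonglongrightarrow>
      1 + (J1 + J2) / J0" by simp
  show "(\<lambda>n. measure_pmf.expectation (cond_pmf (rig_pair_pmf n (m n) (P n)) (S n))
      (\<lambda>(D, v1, v2). real (codeg s n D v1 v2))) \<longlonglongrightarrow> J1 / J0"
    using l1
  proof (rule Lim_transform_eventually)
    show "eventually (\<lambda>n. (1 - 2 * inverse (real n)) * (real n ^ 2 * ?t n) / (real n * ?e n) =
      measure_pmf.expectation (cond_pmf (rig_pair_pmf n (m n) (P n)) (S n))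
      (\<lambda>(D, v1, v2). real (codeg s n D v1 v2))) sequentially"
      using pos ev_ge[of 2]
    proof eventually_elim
      case (elim n)
      interpret R: random_attr_set s "m n" "P n" by (rule attr_set_model) (use elim in simp)
      have e: "R.edge_weight n g > 0" using elim by (simp add: zero_less_mult_iff)
      have "real n > 0" using elim by simp
      then have "(1 - 2 * inverse (real n)) * (real n ^ 2 * ?t n) / (real n * ?e n) =
          (real n - 2) * ?t n / ?e n"
        using e by (simp add: field_simps power2_eq_square)
      then show ?case by (subst R.expectation_cond_rig(1)[OF elim(2) e S]) simp
    qed
  qed
  show "(\<lambda>n. measure_pmf.expectation (cond_pmf (rig_pair_pmf n (m n) (P n)) (S n))
      (\<lambda>(D, v1, v2). real (deg s n D v1))) \<longlonglongrightarrow> 1 + (J1 + J2) / J0"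
    using l2
  proof (rule Lim_transform_eventually)
    show "eventually (\<lambda>n. 1 + (1 - 2 * inverse (real n)) * (real n ^ 2 * ?t n + real n ^ 2 * ?w n) / (real n * ?e n) =
      measure_pmf.expectation (cond_pmf (rig_pair_pmf n (m n) (P n)) (S n))
      (\<lambda>(D, v1, v2). real (deg s n D v1))) sequentially"
      using pos ev_ge[of 2]
    proof eventually_elim
      case (elim n)
      interpret R: random_attr_set s "m n" "P n" by (rule attr_set_model) (use elim in simp)
      have e: "R.edge_weight n g > 0" using elim by (simp add: zero_less_mult_iff)
      have "real n > 0" using elim by simp
      then have "(1 - 2 * inverse (real n)) * (real n ^ 2 * ?t n + real n ^ 2 * ?w n) / (real n * ?e n) =
          (real n - 2) * (?t n + ?w n) / ?e n"
        using e by (simp add: field_simps power2_eq_square)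
      then show ?case by (subst R.expectation_cond_rig(2)[OF elim(2) e S]) simp
    qed
  qed
qed

lemma unconditioned_limits:
  assumes z2: "z2 > 0"
  shows "(\<lambda>n. h_star s n (m n) (P n)) \<longlonglongrightarrow> \<alpha>1 / \<beta>"
    and "(\<lambda>n. b_star s n (m n) (P n)) \<longlonglongrightarrow> 1 + \<alpha>2 / \<beta>"
proof -
  have J: "integral\<^sup>L M (\<lambda>\<omega>. z1 * Z \<omega>) = z1 ^ 2" by (simp add: z1_def power2_eq_square)
  have z1: "z1 ^ 2 > 0" using z1_pos[OF z2] by simp
  have S: "of_bool ((D, i, j) \<in> adj_event s) = of_bool (adj s D i j) * (1::real)" for D i j
    by (simp add: adj_event_def)
  note L = conditional_limits[of "\<lambda>_. adj_event s" "\<lambda>_. 1", OF S, of "z1 ^ 2" "\<alpha>1 / \<beta> * z1 ^ 2"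
      "(\<alpha>2 - \<alpha>1) / \<beta> * z1 ^ 2"]
  have w1: "(\<lambda>n. real n * random_attr_set.edge_weight s (m n) (P n) n (\<lambda>_. 1)) \<longlonglongrightarrow> z1 ^ 2"
    and w2: "(\<lambda>n. real n ^ 2 * random_attr_set.triangle_weight s (m n) (P n) n (\<lambda>_. 1)) \<longlonglongrightarrow> \<alpha>1 / \<beta> * z1 ^ 2"
    and w3: "(\<lambda>n. real n ^ 2 * random_attr_set.wedge_weight s (m n) (P n) n (\<lambda>_. 1)) \<longlonglongrightarrow> (\<alpha>2 - \<alpha>1) / \<beta> * z1 ^ 2"
    using weight_limits[of "\<lambda>_. 1" "\<lambda>_. 1" "\<lambda>_. 1"] J by simp_all
  show "(\<lambda>n. h_star s n (m n) (P n)) \<longlonglongrightarrow> \<alpha>1 / \<beta>"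
    using L(1)[OF w1 w2 w3 z1] z1 unfolding h_star_def by simp
  have "1 + (\<alpha>1 / \<beta> * z1 ^ 2 + (\<alpha>2 - \<alpha>1) / \<beta> * z1 ^ 2) / z1 ^ 2 = 1 + \<alpha>2 / \<beta>"
    using z1 beta(1) by (simp add: field_simps)
  then show "(\<lambda>n. b_star s n (m n) (P n)) \<longlonglongrightarrow> 1 + \<alpha>2 / \<beta>"
    using L(2)[OF w1 w2 w3 z1] unfolding b_star_def by simp
qed

lemma degree_conditioned_limits:
  fixes k :: nat
  assumes z2: "z2 > 0"
  defines "p \<equiv> mixed_poisson_prob M Z"
  shows "(\<lambda>n. h_star_k s n (m n) (P n) (k + 1)) \<longlonglongrightarrow>
      \<alpha>1 / \<beta> * (real k / real (k + 1)) * (p k / p (k + 1))" (is "_ \<longlonglongrightarrow> ?H")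
    and "(\<lambda>n. b_star_k s n (m n) (P n) (k + 1)) \<longlonglongrightarrow>
      1 + (\<alpha>2 - \<alpha>1) / \<beta> + \<alpha>1 / \<beta> * (real k / real (k + 1)) * (p k / p (k + 1))"
proof -
  define \<pi> where "\<pi> i r = r ^ i / fact i * exp (- r)" for i and r :: real
  (* In a triangle the vertex has two neighbours already, so degree k + 1 needs k - 1 further ones and
     is impossible for k = 0. *)
  define G2 where "G2 r = (if k = 0 then 0 else \<pi> (k - 1) r)" for r :: real
  define g where "g c = (of_bool (c = k + 1) :: real)" for c :: nat
  have \<pi>_bound: "\<bar>\<pi> i r\<bar> \<le> 1" if "r \<ge> 0" for i r
    using poisson_density_le_1[OF that, of i] that by (simp add: \<pi>_def)
  have cont: "continuous_on UNIV (\<pi> i)" for i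
    unfolding \<pi>_def by (intro continuous_intros) auto
  have E1: "measure_pmf.expectation q (\<lambda>c. g (Suc c)) = pmf q k" for q :: "nat pmf"
  proof -
    have "(\<lambda>c. g (Suc c)) = indicator {k}" by (auto simp: g_def fun_eq_iff)
    then show ?thesis by (simp add: measure_pmf_single)
  qed
  have E2: "measure_pmf.expectation q (\<lambda>c. g (Suc (Suc c))) = (if k = 0 then 0 else pmf q (k - 1))"
    for q :: "nat pmf"
  proof -
    have "(\<lambda>c. g (Suc (Suc c))) = (if k = 0 then (\<lambda>_. 0) else indicator {k - 1})"
      by (auto simp: g_def fun_eq_iff)
    then show ?thesis by (simp add: measure_pmf_single)
  qed
  have g_bound: "\<bar>g c\<bar> \<le> 1" for c by (simp add: g_def)
  have G2_cont: "continuous_on UNIV G2" using cont[of "k - 1"] by (cases "k = 0") (simp_all add: G2_def)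
  have G2_bound: "\<bar>G2 r\<bar> \<le> 1" if "r \<ge> 0" for r using \<pi>_bound[OF that] by (simp add: G2_def)
  have lim: "((\<lambda>p. pmf (binomial_pmf (fst p - j) (linkp (fst p) (snd p))) i) \<longlongrightarrow> \<pi> i (rate x)) (at_size x)" for i j x
    using binomial_link_limit[of j i x] by (simp only: \<pi>_def)
  have G1_lim: "((\<lambda>p. measure_pmf.expectation (binomial_pmf (fst p - j) (linkp (fst p) (snd p)))
        (\<lambda>c. g (Suc c))) \<longlongrightarrow> \<pi> k (rate x)) (at_size x)" for j x
    unfolding E1 by (rule lim)
  have G2_lim: "((\<lambda>p. measure_pmf.expectation (binomial_pmf (fst p - j) (linkp (fst p) (snd p)))
        (\<lambda>c. g (Suc (Suc c)))) \<longlongrightarrow> G2 (rate x)) (at_size x)" for j x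
    unfolding E2 G2_def using lim[of j "k - 1" x] by simp
  note w = weight_limits[of g "\<pi> k" G2, OF g_bound cont G2_cont \<pi>_bound G2_bound G1_lim G2_lim]
  define J0 where "J0 = real (k + 1) * p (k + 1)"
  have J0: "integral\<^sup>L M (\<lambda>\<omega>. z1 * Z \<omega> * \<pi> k (z1 * Z \<omega>)) = J0"
    unfolding \<pi>_def J0_def p_def by (subst mixed_poisson_size_bias) simp
  have J1: "integral\<^sup>L M (\<lambda>\<omega>. z1 * Z \<omega> * G2 (z1 * Z \<omega>)) = real k * p k"
  proof (cases k)
    case (Suc i)
    then show ?thesis unfolding G2_def \<pi>_def p_def using mixed_poisson_size_bias[of i] by simp
  qed (simp add: G2_def)
  have pos: "J0 > 0" unfolding J0_def p_def using mixed_poisson_pos[OF z2, of k] by simp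
  have S: "of_bool ((D, i, j) \<in> adj_deg_event s n (k + 1)) = of_bool (adj s D i j) * g (deg s n D j)" for n D i j
    by (simp add: adj_deg_event_def g_def)
  note L = conditional_limits[of "\<lambda>n. adj_deg_event s n (k + 1)" g, OF S w(1)[unfolded J0] w(2)[unfolded J1] w(3)[unfolded J0] pos]
  have e1: "\<alpha>1 / \<beta> * (real k * p k) / J0 = ?H"
    by (simp add: J0_def)
  have e2: "1 + (\<alpha>1 / \<beta> * (real k * p k) + (\<alpha>2 - \<alpha>1) / \<beta> * J0) / J0 = 1 + (\<alpha>2 - \<alpha>1) / \<beta> + ?H"
    unfolding add_divide_distrib e1 using pos by simp
  show "(\<lambda>n. h_star_k s n (m n) (P n) (k + 1)) \<longlonglongrightarrow> ?H"
    using L(1) unfolding e1 h_star_k_def .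
  show "(\<lambda>n. b_star_k s n (m n) (P n) (k + 1)) \<longlonglongrightarrow> 1 + (\<alpha>2 - \<alpha>1) / \<beta> + ?H"
    using L(2) unfolding e2 b_star_k_def .
qed

end

lemma smallo_1_of_common_limit:
  fixes f g :: "nat \<Rightarrow> real"
  assumes "f \<longlonglongrightarrow> L" "g \<longlonglongrightarrow> L"
  shows "(\<lambda>n. f n - g n) \<in> o(\<lambda>_. 1)"
  by (rule smalloI_tendsto) (use tendsto_diff[OF assms] in simp_all)

theorem theorem2:
  fixes s k :: nat and m :: "nat \<Rightarrow> nat" and P :: "nat \<Rightarrow> nat pmf" and \<beta> :: real
    and M :: "'a measure" and Z :: "'a \<Rightarrow> real" and dstar :: "nat pmf"
  defines "a \<equiv> \<lambda>i n. binom_moment s (P n) i"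
    and "p \<equiv> mixed_poisson_prob M Z"
    and "b \<equiv> \<lambda>n. b_star s n (m n) (P n)"
    and "h \<equiv> \<lambda>n. h_star s n (m n) (P n)"
    and "bk \<equiv> \<lambda>j n. b_star_k s n (m n) (P n) j"
    and "hk \<equiv> \<lambda>j n. h_star_k s n (m n) (P n) j"
  assumes s: "s \<ge> 1"
    and supp: "\<And>n. n \<ge> 1 \<Longrightarrow> set_pmf (P n) \<subseteq> {0..m n}"
    and m: "filterlim m at_top sequentially"
    and M: "prob_space M"
    and Z: "Z \<in> borel_measurable M"
    and conv: "weak_conv_m (\<lambda>n. distr (measure_pmf (P n)) borel (Z_scaled s n (m n))) (distr M borel Z)"
    and Z2_int: "integrable M (\<lambda>\<omega>. (Z \<omega>)\<^sup>2)"
    and Z2_pos: "0 < integral\<^sup>L M (\<lambda>\<omega>. (Z \<omega>)\<^sup>2)"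
    and Z2_lim: "(\<lambda>n. measure_pmf.expectation (P n) (\<lambda>x. (Z_scaled s n (m n) x)\<^sup>2))
                   \<longlonglongrightarrow> integral\<^sup>L M (\<lambda>\<omega>. (Z \<omega>)\<^sup>2)"
    and beta: "0 < \<beta>" "(\<lambda>n. real (m n choose s) / real n) \<longlonglongrightarrow> \<beta>"
    and dstar: "\<And>j. pmf dstar j = p j"
  shows "(\<lambda>n. b n - (1 + a 2 n / \<beta>)) \<in> o(\<lambda>_. 1)
       \<and> (\<lambda>n. h n - a 1 n / \<beta>) \<in> o(\<lambda>_. 1)
       \<and> (\<lambda>n. hk (k + 1) n - a 1 n / \<beta> * (real k / real (k + 1)) * (p k / p (k + 1))) \<in> o(\<lambda>_. 1)
       \<and> (\<lambda>n. bk (k + 1) n - (1 + (a 2 n - a 1 n) / \<beta> + hk (k + 1) n)) \<in> o(\<lambda>_. 1)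
       \<and> (\<lambda>n. a 1 n - sqrt (\<beta> * moment dstar 1)) \<in> o(\<lambda>_. 1)
       \<and> (\<lambda>n. a 2 n - \<beta> * factorial_moment dstar 2 / moment dstar 1) \<in> o(\<lambda>_. 1)"
proof -
  interpret prob_space M by (rule M)
  interpret L: rig_limit M Z s m P \<beta>
    by unfold_locales (use s supp m Z conv Z2_int Z2_lim beta in auto)
  have z2: "L.z2 > 0" using Z2_pos by (simp add: L.z2_def)
  have z1: "L.z1 > 0" by (rule L.z1_pos[OF z2])
  have mom_a: "random_attr_set.mom s (P n) i = a i n" if "n \<ge> 1" for i n
    using random_attr_set.mom_def[OF L.attr_set_model[OF that]] by (simp add: a_def binom_moment_def)
  have a_eq: "eventually (\<lambda>n. random_attr_set.mom s (P n) i = a i n) sequentially" for i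
    by (rule eventually_mono[OF L.ev_ge[of 1] mom_a])
  have a1: "a 1 \<longlonglongrightarrow> L.\<alpha>1" by (rule Lim_transform_eventually[OF L.mom_1_limit a_eq])
  have a2: "a 2 \<longlonglongrightarrow> L.\<alpha>2" by (rule Lim_transform_eventually[OF L.mom_2_limit a_eq])
  have dstar': "\<And>j. pmf dstar j = mixed_poisson_prob M Z j" using dstar by (simp add: p_def)
  have m1: "sqrt (\<beta> * moment dstar 1) = L.\<alpha>1"
    unfolding L.moment_mixed_poisson[OF dstar'] L.\<alpha>1_def using z1 by (simp add: real_sqrt_mult)
  have m2: "\<beta> * factorial_moment dstar 2 / moment dstar 1 = L.\<alpha>2"
    unfolding L.moment_mixed_poisson[OF dstar'] L.factorial_moment_mixed_poisson[OF dstar'] L.\<alpha>2_def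
    using z1 by simp
  have hk_lim: "hk (k + 1) \<longlonglongrightarrow> L.\<alpha>1 / \<beta> * (real k / real (k + 1)) * (p k / p (k + 1))"
    unfolding hk_def p_def by (rule L.degree_conditioned_limits(1)[OF z2])
  have bk_lim: "bk (k + 1) \<longlonglongrightarrow>
      1 + (L.\<alpha>2 - L.\<alpha>1) / \<beta> + L.\<alpha>1 / \<beta> * (real k / real (k + 1)) * (p k / p (k + 1))"
    unfolding bk_def p_def by (rule L.degree_conditioned_limits(2)[OF z2])
  have b_lim: "b \<longlonglongrightarrow> 1 + L.\<alpha>2 / \<beta>" unfolding b_def by (rule L.unconditioned_limits(2)[OF z2])
  have h_lim: "h \<longlonglongrightarrow> L.\<alpha>1 / \<beta>" unfolding h_def by (rule L.unconditioned_limits(1)[OF z2])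
  have \<beta>: "\<beta> \<noteq> 0" using beta(1) by simp
  have r1: "(\<lambda>n. 1 + a 2 n / \<beta>) \<longlonglongrightarrow> 1 + L.\<alpha>2 / \<beta>" by (intro tendsto_intros a2 \<beta>)
  have r2: "(\<lambda>n. a 1 n / \<beta>) \<longlonglongrightarrow> L.\<alpha>1 / \<beta>" by (intro tendsto_intros a1 \<beta>)
  have r3: "(\<lambda>n. a 1 n / \<beta> * (real k / real (k + 1)) * (p k / p (k + 1))) \<longlonglongrightarrow>
      L.\<alpha>1 / \<beta> * (real k / real (k + 1)) * (p k / p (k + 1))"
    by (intro tendsto_mult tendsto_const r2)
  have r4: "(\<lambda>n. 1 + (a 2 n - a 1 n) / \<beta> + hk (k + 1) n) \<longlonglongrightarrow>
      1 + (L.\<alpha>2 - L.\<alpha>1) / \<beta> + L.\<alpha>1 / \<beta> * (real k / real (k + 1)) * (p k / p (k + 1))"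
    by (intro tendsto_add hk_lim) (intro tendsto_intros a1 a2 \<beta>)+
  show ?thesis
    unfolding m1 m2
    by (intro conjI smallo_1_of_common_limit[OF b_lim r1] smallo_1_of_common_limit[OF h_lim r2]
        smallo_1_of_common_limit[OF hk_lim r3] smallo_1_of_common_limit[OF bk_lim r4]
        smallo_1_of_common_limit[OF a1 tendsto_const] smallo_1_of_common_limit[OF a2 tendsto_const])
qed

end
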